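(* For integers $m\ge1$ and $0\le\ell\le m-1$ let $\gamma_{m,\ell}$ be the Hölder regularity of the (primal) pseudo-spline subdivision scheme with symbol $$a_{m,\ell}(z)=2\sigma^m(z)\sum_{k=0}^{\ell}\binom{m-1+k}{k}\delta^k(z),\qquad \sigma(z)=\frac{(1+z)^2}{4z},\quad \delta(z)=-\frac{(1-z)^2}{4z},$$ and let $\gamma_m=\gamma_{m,m-1}$. Then: (i) $\gamma_{m,\ell}$ is decreasing (in the non-strict sense) in $\ell$, and moreover, for $1\le\ell\le m-1$, $$\gamma_{m,\ell-1}-\log_2\left(\frac{m+\ell}{\ell}\right)\le\gamma_{m,\ell}\le\gamma_{m,\ell-1};$$ (ii) $\gamma_{m,\ell}$ is increasing in $m$, and moreover, for $0\le\ell\le m-1$, $$\gamma_{m,\ell}+\log_2\left(\frac{4m}{m+\ell}\right)\le\gamma_{m+1,\ell}\le\gamma_{m,\ell}+2;$$ (iii) $\gamma_m$ is increasing in $m$, and moreover, for $m\ge1$, $$\gamma_m+\log_2\left(\frac{2m+2}{2m+1}\right)\le\gamma_{m+1}\le\gamma_m+2.$$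
   Context: A subdivision scheme with symbol $a(z)=\sum_k a_kz^k$ (a Laurent polynomial with real coefficients) acts on real initial data $(f_{0,k})_{k\in\mathbb{Z}}$, only finitely many of which are non-zero, by $f_{j+1,k}=\sum_\ell a_{k-2\ell}f_{j,\ell}$. Let $f_j$ be the piecewise linear function with value $f_{j,k}$ at $2^{-j}k$; the limit function is the pointwise limit $f=\lim_{j\to\infty}f_j$. Hölder classes: for $0<\alpha<1$, $f\in C^\alpha$ means $|f(x)-f(y)|\le C|x-y|^\alpha$ for all $x,y\in\mathbb{R}$ and some constant $C$. For $q\in\mathbb{N}_0$, $f\in C^q$ means $f$ is $q$ times continuously differentiable, and $f\in C^{q+\alpha}$ means $f\in C^q$ and $f^{(q)}\in C^\alpha$. The scheme has Hölder regularity $\gamma\ge0$ if for $\beta<\gamma$, $f\in C^\beta$ for all initial data, and for $\beta>\gamma$, $f\notin C^\beta$ for some initial data. For $\ell=0$ the scheme is B-spline subdivision of degree $2m-1$, and for $\ell=m-1$ it is the $(2m)$-point Dubuc-Deslauriers scheme. *)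

theory Defs
  imports "HOL-Analysis.Analysis" "HOL-Library.Poly_Mapping"
begin

text \<open>
  A real Laurent polynomial \<open>a(z) = \<Sum>\<^sub>k a\<^sub>k z\<^sup>k\<close> is an element of the group ring
  \<^typ>\<open>int \<Rightarrow>\<^sub>0 real\<close>, where \<open>Poly_Mapping.lookup a k\<close> is the coefficient \<open>a\<^sub>k\<close> and
  \<open>Poly_Mapping.single k c\<close> is the monomial \<open>c z\<^sup>k\<close>.
\<close>

type_synonym laurent_poly = "int \<Rightarrow>\<^sub>0 real"

abbreviation Z :: laurent_poly
  where "Z \<equiv> Poly_Mapping.single 1 1"

text \<open>The sum ranges over the finitely many \<open>l\<close> with \<open>a\<^bsub>k-2l\<^esub> \<noteq> 0\<close>; all other terms vanish.\<close>

definition subdivision_step :: "laurent_poly \<Rightarrow> (int \<Rightarrow> real) \<Rightarrow> int \<Rightarrow> real"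
  where "subdivision_step a f k =
    (\<Sum>l | k - 2 * l \<in> Poly_Mapping.keys a. Poly_Mapping.lookup a (k - 2 * l) * f l)"

definition subdivision :: "laurent_poly \<Rightarrow> (int \<Rightarrow> real) \<Rightarrow> nat \<Rightarrow> int \<Rightarrow> real"
  where "subdivision a f0 j = (subdivision_step a ^^ j) f0"

text \<open>The piecewise linear function with knots \<open>2\<^sup>-\<^sup>j k\<close> and value \<open>c k\<close> at \<open>2\<^sup>-\<^sup>j k\<close>.\<close>

definition linear_interpolant :: "nat \<Rightarrow> (int \<Rightarrow> real) \<Rightarrow> real \<Rightarrow> real"
  where "linear_interpolant j c x =
    (1 - frac (2 ^ j * x)) * c \<lfloor>2 ^ j * x\<rfloor> + frac (2 ^ j * x) * c (\<lfloor>2 ^ j * x\<rfloor> + 1)"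

definition initial_data :: "(int \<Rightarrow> real) set"
  where "initial_data = {f0. finite {k. f0 k \<noteq> 0}}"

definition convergent_scheme :: "laurent_poly \<Rightarrow> bool"
  where "convergent_scheme a \<longleftrightarrow>
    (\<forall>f0\<in>initial_data. \<forall>x. convergent (\<lambda>j. linear_interpolant j (subdivision a f0 j) x))"

definition limit_function :: "laurent_poly \<Rightarrow> (int \<Rightarrow> real) \<Rightarrow> real \<Rightarrow> real"
  where "limit_function a f0 x = lim (\<lambda>j. linear_interpolant j (subdivision a f0 j) x)"

definition times_cont_differentiable :: "nat \<Rightarrow> (real \<Rightarrow> real) \<Rightarrow> bool"
  where "times_cont_differentiable q f \<longleftrightarrow>
    (\<forall>i<q. (deriv ^^ i) f differentiable_on UNIV) \<and> continuous_on UNIV ((deriv ^^ q) f)"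

definition holder_continuous :: "real \<Rightarrow> (real \<Rightarrow> real) \<Rightarrow> bool"
  where "holder_continuous \<alpha> f \<longleftrightarrow> (\<exists>C. \<forall>x y. \<bar>f x - f y\<bar> \<le> C * \<bar>x - y\<bar> powr \<alpha>)"

text \<open>
  The class \<open>C\<^sup>\<beta>\<close> for \<open>\<beta> \<ge> 0\<close>, where \<open>\<beta> = q + \<alpha>\<close> with integer part \<open>q\<close> and
  \<open>0 \<le> \<alpha> < 1\<close>. For \<open>\<alpha> = 0\<close> this is \<open>C\<^sup>q\<close> in the sense of continuous differentiability.
\<close>

definition holder_class :: "real \<Rightarrow> (real \<Rightarrow> real) set"
  where "holder_class \<beta> = {f.
    times_cont_differentiable (nat \<lfloor>\<beta>\<rfloor>) f \<and>
    (frac \<beta> > 0 \<longrightarrow> holder_continuous (frac \<beta>) ((deriv ^^ nat \<lfloor>\<beta>\<rfloor>) f))}"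

definition has_holder_regularity :: "laurent_poly \<Rightarrow> real \<Rightarrow> bool"
  where "has_holder_regularity a \<gamma> \<longleftrightarrow>
    convergent_scheme a \<and> \<gamma> \<ge> 0 \<and>
    (\<forall>\<beta>. 0 \<le> \<beta> \<and> \<beta> < \<gamma> \<longrightarrow> (\<forall>f0\<in>initial_data. limit_function a f0 \<in> holder_class \<beta>)) \<and>
    (\<forall>\<beta>. \<gamma> < \<beta> \<longrightarrow> (\<exists>f0\<in>initial_data. limit_function a f0 \<notin> holder_class \<beta>))"

lemma has_holder_regularity_unique:
  assumes "has_holder_regularity a \<gamma>" "has_holder_regularity a \<gamma>'"
  shows "\<gamma> = \<gamma>'"
proof -
  have *: "\<not> c < d" if "has_holder_regularity a c" "has_holder_regularity a d" for c d
  proof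
    assume "c < d"
    then obtain \<beta> where "c < \<beta>" "\<beta> < d"
      using dense by blast
    moreover have "0 \<le> \<beta>"
      using that(1) \<open>c < \<beta>\<close> by (simp add: has_holder_regularity_def)
    ultimately show False
      using that unfolding has_holder_regularity_def by blast
  qed
  show ?thesis
    using *[OF assms] *[OF assms(2,1)] by simp
qed

definition holder_regularity :: "laurent_poly \<Rightarrow> real"
  where "holder_regularity a = (THE \<gamma>. has_holder_regularity a \<gamma>)"

text \<open>\<open>\<sigma>(z) = (1 + z)\<^sup>2 / (4z)\<close> and \<open>\<delta>(z) = -(1 - z)\<^sup>2 / (4z)\<close>\<close>

definition sigma :: laurent_poly
  where "sigma = Poly_Mapping.single (-1) (1/4) * (1 + Z)\<^sup>2"

definition delta :: laurent_poly
  where "delta = - (Poly_Mapping.single (-1) (1/4) * (1 - Z)\<^sup>2)"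

definition pseudo_spline_symbol :: "nat \<Rightarrow> nat \<Rightarrow> laurent_poly"
  where "pseudo_spline_symbol m l =
    2 * sigma ^ m * (\<Sum>k=0..l. of_nat ((m - 1 + k) choose k) * delta ^ k)"

definition pseudo_spline_regularity :: "nat \<Rightarrow> nat \<Rightarrow> real"
  where "pseudo_spline_regularity m l = holder_regularity (pseudo_spline_symbol m l)"

definition dubuc_deslauriers_regularity :: "nat \<Rightarrow> real"
  where "dubuc_deslauriers_regularity m = pseudo_spline_regularity m (m - 1)"

end

theory Submission
  imports Defs
begin

text \<open>
  Write the symbol as \<open>2 \<sigma>\<^sup>m b\<close> with \<open>b = P(\<delta>)\<close>, where \<open>P\<close> is a truncated binomial series, and let
  \<open>B\<^sub>n(z) = \<Prod>\<^bsub>j<n\<^esub> b(z\<^bsup>2^j\<^esup>)\<close>. Since \<open>\<delta>(z\<^sup>2) = 4 \<delta>(z) \<sigma>(z)\<close>, the \<open>2m\<close>-th differences of the data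
  at level \<open>n\<close> are those of the initial data convolved with \<open>2\<^bsup>n(1-2m)\<^esup> B\<^sub>n\<close>. On the unit circle
  \<open>b \<ge> 1\<close>, so the largest coefficient \<open>M\<^sub>n\<close> of \<open>B\<^sub>n\<close> is the zeroth one, the mean over the circle.
  The regularity is \<open>2m - 1 - s\<close>, where \<open>s\<close> is the infimum of the exponents with \<open>M\<^sub>n = O(2\<^bsup>ns\<^esup>)\<close>:
  decay of the differences expands the limit function into a multiscale series of B-splines of degree
  \<open>2m - 1\<close>; conversely, by positivity, the \<open>2m\<close>-th difference of the limit function at the origin
  with step \<open>2\<^sup>-\<^sup>n\<close> bounds \<open>M\<^sub>n\<close> from above. Pointwise bounds \<open>b \<le> K b'\<close> on the circle give
  \<open>s \<le> s' + log\<^sub>2 K\<close>, and the claims become inequalities between truncated binomial series on \<open>[0, 1]\<close>.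
\<close>

section \<open>Laurent polynomials\<close>

text \<open>The scheme cannot be compared with B-spline subdivision directly: b(1) = 1, but b - 1 is
  in general divisible only by a low power of 1 - z, so the discrepancy is not made of 2m-th
  differences. A corrector q for which q(z) b(z) - q(z^2) is divisible by (1 - z)^(2m) removes this
  obstacle, and q is inverted modulo 2m-th differences to return to the original data. In the
  converse, sampling the limit function at step 2^(-n) multiplies the symbol of level n by the limit
  of decimated symbols \<open>\<Phi>\<close>. Since b is at least 1 on the circle, these stay above
  (1/9)^m, so that no cancellation can hide large differences. The expression 2m - 1 - s is known to
  be the regularity only once it is positive, and positivity is itself obtained from the comparison
  inequalities, by induction along l = m - 1. The comparisons are therefore proved for the
  expression \<open>regularity_exponent\<close> and transferred to the regularity at the end.
  Raising m by one gains 2 from the extra factor \<open>sigma\<close>; the change of P then costs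
  log_2 K.\<close>

abbreviation (input) lookup :: "laurent_poly \<Rightarrow> int \<Rightarrow> real"
  where "lookup \<equiv> Poly_Mapping.lookup"

abbreviation (input) keys :: "laurent_poly \<Rightarrow> int set"
  where "keys \<equiv> Poly_Mapping.keys"

abbreviation (input) single :: "int \<Rightarrow> real \<Rightarrow> laurent_poly"
  where "single \<equiv> Poly_Mapping.single"

lemma lookup_single_if: "lookup (single k c) j = (if j = k then c else 0)"
  by (auto simp: lookup_single)

lemma sum_single_lookup: "(\<Sum>k\<in>keys F. single k (lookup F k)) = F"
proof (rule poly_mapping_eqI)
  fix j
  have "lookup (\<Sum>k\<in>keys F. single k (lookup F k)) j = (\<Sum>k\<in>keys F. if k = j then lookup F k else 0)"
    unfolding lookup_sum by (intro sum.cong) (auto simp: lookup_single_if)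
  also have "\<dots> = lookup F j"
    by (simp add: sum.delta in_keys_iff)
  finally show "lookup (\<Sum>k\<in>keys F. single k (lookup F k)) j = lookup F j" .
qed

lemma laurent_induct [case_names single add]:
  assumes single: "\<And>k c. P (single k c)"
    and add: "\<And>F G. P F \<Longrightarrow> P G \<Longrightarrow> P (F + G)"
  shows "P F"
proof -
  have "P (\<Sum>k\<in>A. single k (lookup F k))" if "finite A" for A
    using that
  proof (induction A rule: finite_induct)
    case empty
    show ?case using single[of 0 0] by simp
  qed (simp add: single add)
  then show ?thesis
    using sum_single_lookup[of F] by (metis finite_keys)
qed

lemma sum_keys_superset:
  fixes t :: "int \<Rightarrow> real \<Rightarrow> 'b::comm_monoid_add"
  assumes "finite A" "keys F \<subseteq> A" "\<And>k. t k 0 = 0"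
  shows "(\<Sum>k\<in>keys F. t k (lookup F k)) = (\<Sum>k\<in>A. t k (lookup F k))"
  using assms by (intro sum.mono_neutral_left) (auto simp: in_keys_iff)

text \<open>Cancellation can make the keys of the sum smaller than the union, so all three sums are
  extended to the union, where the new terms vanish.\<close>

lemma sum_keys_add:
  fixes t :: "int \<Rightarrow> real \<Rightarrow> 'b::comm_monoid_add"
  assumes "\<And>k. t k 0 = 0" "\<And>k c d. t k (c + d) = t k c + t k d"
  shows "(\<Sum>k\<in>keys (F + G). t k (lookup (F + G) k)) =
    (\<Sum>k\<in>keys F. t k (lookup F k)) + (\<Sum>k\<in>keys G. t k (lookup G k))"
proof -
  let ?A = "keys F \<union> keys G"
  have "(\<Sum>k\<in>keys (F + G). t k (lookup (F + G) k)) = (\<Sum>k\<in>?A. t k (lookup (F + G) k))"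
    using keys_add[of F G] assms(1) by (intro sum_keys_superset) auto
  also have "\<dots> = (\<Sum>k\<in>?A. t k (lookup F k)) + (\<Sum>k\<in>?A. t k (lookup G k))"
    by (simp add: lookup_add assms(2) sum.distrib)
  also have "(\<Sum>k\<in>?A. t k (lookup F k)) = (\<Sum>k\<in>keys F. t k (lookup F k))"
    using assms(1) by (intro sum_keys_superset[symmetric]) auto
  also have "(\<Sum>k\<in>?A. t k (lookup G k)) = (\<Sum>k\<in>keys G. t k (lookup G k))"
    using assms(1) by (intro sum_keys_superset[symmetric]) auto
  finally show ?thesis .
qed

lemma lookup_mult_keys: "lookup (F * G) k = (\<Sum>l\<in>keys F. lookup F l * lookup G (k - l))"
proof (induction F rule: laurent_induct)
  case (single j c)
  have "lookup (single j c * G) k = c * lookup G (k - j)"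
  proof (induction G rule: laurent_induct)
    case (single i d)
    then show ?case by (auto simp: mult_single lookup_single_if)
  next
    case (add F G)
    then show ?case by (simp add: distrib_left lookup_add)
  qed
  then show ?case by auto
next
  case (add F1 F2)
  have "(\<Sum>l\<in>keys (F1 + F2). lookup (F1 + F2) l * lookup G (k - l)) =
      (\<Sum>l\<in>keys F1. lookup F1 l * lookup G (k - l)) + (\<Sum>l\<in>keys F2. lookup F2 l * lookup G (k - l))"
    by (rule sum_keys_add[of "\<lambda>l c. c * lookup G (k - l)"]) (simp_all add: distrib_right)
  with add show ?case
    by (simp only: distrib_right lookup_add)
qed

lemma lookup_single_mult: "lookup (single j c * G) k = c * lookup G (k - j)"
  by (auto simp: lookup_mult_keys)

lemma lookup_mult_single: "lookup (G * single j c) k = c * lookup G (k - j)"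
  by (subst mult.commute) (rule lookup_single_mult)

text \<open>Evaluation of a Laurent polynomial, where \<open>u k\<close> is the value of \<open>z\<^sup>k\<close> and \<open>h\<close>
  embeds the coefficients.\<close>

definition leval :: "(real \<Rightarrow> 'a::comm_ring_1) \<Rightarrow> (int \<Rightarrow> 'a) \<Rightarrow> laurent_poly \<Rightarrow> 'a"
  where "leval h u F = (\<Sum>k\<in>keys F. h (lookup F k) * u k)"

text \<open>The ring homomorphisms needed have three different targets: the reals (value at 1),
  Laurent polynomials (substitution of z^N) and the complex numbers (restriction to the unit
  circle).\<close>

locale laurent_eval =
  fixes h :: "real \<Rightarrow> 'a::comm_ring_1" and u :: "int \<Rightarrow> 'a"
  assumes h_zero: "h 0 = 0" and h_one: "h 1 = 1"
    and h_add: "h (x + y) = h x + h y" and h_mult: "h (x * y) = h x * h y"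
    and u_zero: "u 0 = 1" and u_add: "u (i + j) = u i * u j"
begin

lemma eval_single: "leval h u (single k c) = h c * u k"
  by (auto simp: leval_def h_zero)

lemma eval_add: "leval h u (F + G) = leval h u F + leval h u G"
  unfolding leval_def
  by (rule sum_keys_add[of "\<lambda>k c. h c * u k"]) (auto simp: h_zero h_add distrib_right)

lemma eval_zero: "leval h u 0 = 0"
  by (simp add: leval_def)

lemma eval_one: "leval h u 1 = 1"
  using eval_single[of 0 1] by (simp add: h_one u_zero)

lemma eval_uminus: "leval h u (- F) = - leval h u F"
  using eval_add[of F "- F"] by (simp add: eval_zero add_eq_0_iff)

lemma eval_diff: "leval h u (F - G) = leval h u F - leval h u G"
  using eval_add[of F "- G"] by (simp add: eval_uminus)

lemma eval_mult: "leval h u (F * G) = leval h u F * leval h u G"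
proof (induction F rule: laurent_induct)
  case (single j c)
  show ?case
  proof (induction G rule: laurent_induct)
    case (single i d)
    then show ?case by (simp add: mult_single eval_single h_mult u_add mult_ac)
  next
    case (add F G)
    then show ?case by (simp add: distrib_left eval_add)
  qed
next
  case (add F1 F2)
  then show ?case by (simp add: distrib_right eval_add)
qed

lemma eval_power: "leval h u (F ^ n) = leval h u F ^ n"
  by (induction n) (simp_all add: eval_one eval_mult)

lemma eval_sum: "leval h u (sum f A) = (\<Sum>x\<in>A. leval h u (f x))"
  by (induction A rule: infinite_finite_induct) (simp_all add: eval_zero eval_add)

lemma eval_of_nat: "leval h u (of_nat n) = of_nat n"
  by (induction n) (simp_all add: eval_zero eval_one eval_add)

lemma eval_numeral: "leval h u (numeral n) = numeral n"
  using eval_of_nat[of "numeral n"] by simp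

lemmas eval_simps = eval_single eval_add eval_zero eval_one eval_uminus eval_diff eval_mult
  eval_power eval_sum eval_of_nat eval_numeral

end

definition at_one :: "laurent_poly \<Rightarrow> real"
  where "at_one = leval (\<lambda>x. x) (\<lambda>k. 1)"

interpretation at_one: laurent_eval "\<lambda>x. x" "\<lambda>k. 1 :: real"
  rewrites "leval (\<lambda>x. x) (\<lambda>k. 1 :: real) = at_one"
  by unfold_locales (auto simp: at_one_def)

text \<open>\<open>dil N F\<close> is \<open>F(z\<^sup>N)\<close>.\<close>

definition dil :: "int \<Rightarrow> laurent_poly \<Rightarrow> laurent_poly"
  where "dil N = leval (single 0) (\<lambda>k. single (N * k) 1)"

interpretation dil: laurent_eval "single 0" "\<lambda>k. single (N * k) 1"
  rewrites "leval (single 0) (\<lambda>k. single (N * k) 1) = dil N"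
  by unfold_locales (auto simp: dil_def single_add mult_single distrib_left)

definition circle :: "laurent_poly \<Rightarrow> real \<Rightarrow> complex"
  where "circle F \<xi> = leval of_real (\<lambda>k. cis (of_int k * \<xi>)) F"

interpretation circle: laurent_eval "of_real" "\<lambda>k. cis (of_int k * \<xi>)"
  rewrites "leval of_real (\<lambda>k. cis (of_int k * \<xi>)) = (\<lambda>F. circle F \<xi>)"
  by unfold_locales (auto simp: circle_def cis_mult distrib_right fun_eq_iff)

lemma dil_single: "dil N (single k c) = single (N * k) c"
  by (simp add: dil.eval_single mult_single)

lemma dil_one [simp]: "dil 1 F = F"
  by (induction F rule: laurent_induct) (simp_all add: dil_single dil.eval_add)

lemma dil_dil: "dil M (dil N F) = dil (M * N) F"
  by (induction F rule: laurent_induct) (simp_all add: dil_single dil.eval_add mult_ac)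

lemma circle_dil: "circle (dil N F) \<xi> = circle F (of_int N * \<xi>)"
  by (induction F rule: laurent_induct)
     (simp_all add: dil_single dil.eval_add circle.eval_add circle.eval_single mult_ac)

lemma lookup_dil:
  assumes "N \<noteq> 0"
  shows "lookup (dil N F) k = (if N dvd k then lookup F (k div N) else 0)"
  using assms
  by (induction F rule: laurent_induct) (auto simp: dil_single dil.eval_add lookup_add lookup_single_if)

text \<open>Decimation, a left inverse of \<open>dil N\<close>. \<open>map_key\<close> composes with
  the key map only if that map is injective, whence \<open>N \<noteq> 0\<close> below.\<close>

definition dec :: "int \<Rightarrow> laurent_poly \<Rightarrow> laurent_poly"
  where "dec N F = Poly_Mapping.map_key ((*) N) F"

lemma inj_mult_int: "N \<noteq> 0 \<Longrightarrow> inj ((*) (N::int))"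
  by (auto simp: inj_def)

lemma lookup_dec:
  assumes "N \<noteq> 0"
  shows "lookup (dec N F) k = lookup F (N * k)"
  unfolding dec_def using inj_mult_int[OF assms] by (simp add: Poly_Mapping.map_key.rep_eq)

lemma dec_one [simp]: "dec 1 F = F"
  by (rule poly_mapping_eqI) (simp add: lookup_dec)

lemma dec_add: "N \<noteq> 0 \<Longrightarrow> dec N (F + G) = dec N F + dec N G"
  by (rule poly_mapping_eqI) (simp add: lookup_dec lookup_add)

lemma dec_dec:
  assumes "M \<noteq> 0" "N \<noteq> 0" shows "dec M (dec N F) = dec (M * N) F"
  using assms by (intro poly_mapping_eqI) (simp add: lookup_dec mult_ac)

text \<open>F(z^N) shifts indices by multiples of N only, so it leaves the decimation as the factor
  F.\<close>

lemma dec_dil_mult: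
  assumes "N \<noteq> 0"
  shows "dec N (dil N F * G) = F * dec N G"
proof (induction F rule: laurent_induct)
  case (single k c)
  show ?case using assms
    by (intro poly_mapping_eqI) (simp add: lookup_dec dil_single lookup_single_mult right_diff_distrib)
next
  case (add F1 F2)
  then show ?case using assms by (simp add: dil.eval_add distrib_right dec_add)
qed

text \<open>The two angles are the square roots of the given point of the circle; averaging over
  them cancels the odd powers.\<close>

lemma circle_dec_two: "circle (dec 2 F) \<xi> = (circle F (\<xi> / 2) + circle F (\<xi> / 2 + pi)) / 2"
proof (induction F rule: laurent_induct)
  case (single k c)
  show ?case
  proof (cases "even k")
    case True
    then obtain j where j: "k = 2 * j" by blast
    have "dec 2 (single k c) = single j c"
      by (rule poly_mapping_eqI) (auto simp: lookup_dec lookup_single_if j)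
    moreover have "cis (of_int k * (\<xi> / 2 + pi)) = cis (of_int j * \<xi>)"
    proof -
      have "of_int k * (\<xi> / 2 + pi) = of_int j * \<xi> + 2 * pi * of_int j"
        by (simp add: j algebra_simps)
      then show ?thesis by (simp add: cis_mult[symmetric] cis_multiple_2pi)
    qed
    ultimately show ?thesis by (simp add: circle.eval_single j)
  next
    case False
    then obtain j where j: "k = 2 * j + 1" by (elim oddE)
    have "dec 2 (single k c) = 0"
      by (rule poly_mapping_eqI) (use False in \<open>auto simp: lookup_dec lookup_single_if\<close>)
    moreover have "cis (of_int k * (\<xi> / 2 + pi)) = - cis (of_int k * (\<xi> / 2))"
    proof -
      have "of_int k * (\<xi> / 2 + pi) = of_int k * (\<xi> / 2) + (2 * pi * of_int j + pi)"
        by (simp add: j algebra_simps)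
      then show ?thesis by (simp add: cis_mult[symmetric] cis_multiple_2pi)
    qed
    ultimately show ?thesis by (simp add: circle.eval_single circle.eval_zero)
  qed
next
  case (add F1 F2)
  then show ?case by (simp add: dec_add circle.eval_add field_simps)
qed

section \<open>Coefficient bounds and means over the circle\<close>

definition l1_norm :: "laurent_poly \<Rightarrow> real"
  where "l1_norm F = (\<Sum>k\<in>keys F. \<bar>lookup F k\<bar>)"

lemma l1_norm_nonneg: "0 \<le> l1_norm F"
  by (simp add: l1_norm_def sum_nonneg)

lemma abs_lookup_mult_le:
  assumes "\<And>k. \<bar>lookup G k\<bar> \<le> E"
  shows "\<bar>lookup (F * G) k\<bar> \<le> l1_norm F * E"
proof -
  have "\<bar>lookup (F * G) k\<bar> \<le> (\<Sum>l\<in>keys F. \<bar>lookup F l * lookup G (k - l)\<bar>)"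
    unfolding lookup_mult_keys by (rule sum_abs)
  also have "\<dots> \<le> (\<Sum>l\<in>keys F. \<bar>lookup F l\<bar> * E)"
    using assms by (intro sum_mono) (simp add: abs_mult mult_left_mono)
  finally show ?thesis by (simp add: l1_norm_def sum_distrib_right)
qed

lemma abs_lookup_dil_le:
  assumes "\<And>k. \<bar>lookup G k\<bar> \<le> E" "N \<noteq> 0"
  shows "\<bar>lookup (dil N G) k\<bar> \<le> E"
  using assms(1)[of 0] assms(1)[of "k div N"] assms(2) by (auto simp: lookup_dil)

lemma keys_dil:
  assumes "N \<noteq> 0"
  shows "keys (dil N F) = (*) N ` keys F"
proof (intro equalityI subsetI)
  fix k assume "k \<in> keys (dil N F)"
  then have "N dvd k" "k div N \<in> keys F"
    using assms by (auto simp: in_keys_iff lookup_dil split: if_splits)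
  then show "k \<in> (*) N ` keys F"
    by (intro image_eqI[of _ _ "k div N"]) auto
qed (use assms in \<open>auto simp: in_keys_iff lookup_dil\<close>)

lemma l1_norm_dil: "N \<noteq> 0 \<Longrightarrow> l1_norm (dil N F) = l1_norm F"
  unfolding l1_norm_def
  by (simp add: keys_dil sum.reindex inj_on_subset[OF inj_mult_int] lookup_dil)

lemma Re_circle: "Re (circle F \<xi>) = (\<Sum>k\<in>keys F. lookup F k * cos (of_int k * \<xi>))"
  by (simp add: circle_def leval_def)

lemma has_integral_cos_int:
  "((\<lambda>\<xi>. cos (of_int k * \<xi>)) has_integral (if k = 0 then 2 * pi else 0)) {-pi..pi}"
proof (cases "k = 0")
  case True
  have "((\<lambda>\<xi>::real. 1) has_integral (2 * pi)) {-pi..pi}"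
    using has_integral_const_real[of "1::real" "-pi" pi] by simp
  then show ?thesis using True by simp
next
  case False
  have "((\<lambda>\<xi>. cos (of_int k * \<xi>)) has_integral
      (sin (of_int k * pi) / of_int k - sin (of_int k * (-pi)) / of_int k)) {-pi..pi}"
    using False
    by (intro fundamental_theorem_of_calculus)
       (auto intro!: derivative_eq_intros simp flip: has_real_derivative_iff_has_vector_derivative)
  moreover have "sin (of_int k * pi) = 0"
    using sin_zero_iff_int2 by blast
  ultimately show ?thesis using False by simp
qed

text \<open>Coefficients are real, so integrating the real part over a period leaves 2 pi times the
  zeroth one. The hypothesis asks for one period only because \<open>\<Phi>_lower_bound\<close> is
  available only there.\<close>

lemma zero_coeff_nonneg:
  assumes "\<And>\<xi>. \<bar>\<xi>\<bar> \<le> pi \<Longrightarrow> 0 \<le> Re (circle F \<xi>)"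
  shows "0 \<le> lookup F 0"
proof -
  have "((\<lambda>\<xi>. \<Sum>k\<in>keys F. lookup F k * cos (of_int k * \<xi>)) has_integral
      (\<Sum>k\<in>keys F. lookup F k * (if k = 0 then 2 * pi else 0))) {-pi..pi}"
    by (intro has_integral_sum has_integral_mult_right has_integral_cos_int) simp
  moreover have "(\<Sum>k\<in>keys F. lookup F k * (if k = 0 then 2 * pi else 0)) = 2 * pi * lookup F 0"
  proof -
    have "(\<Sum>k\<in>keys F. lookup F k * (if k = 0 then 2 * pi else 0)) =
        (\<Sum>k\<in>keys F. if k = 0 then 2 * pi * lookup F k else 0)"
      by (intro sum.cong) auto
    then show ?thesis by (simp add: sum.delta in_keys_iff)
  qed
  ultimately have "((\<lambda>\<xi>. Re (circle F \<xi>)) has_integral (2 * pi * lookup F 0)) {-pi..pi}"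
    by (simp add: Re_circle)
  then have "0 \<le> 2 * pi * lookup F 0"
    using assms by (rule has_integral_nonneg) (auto simp: abs_le_iff)
  then show ?thesis using pi_gt_zero by (simp add: zero_le_mult_iff)
qed

section \<open>Positivity on the unit circle\<close>

text \<open>This includes that the values are real, which makes \<open>Re\<close> multiplicative in
  \<open>Re_circle_mult\<close>.\<close>

definition circle_nonneg :: "laurent_poly \<Rightarrow> bool"
  where "circle_nonneg F \<longleftrightarrow> (\<forall>\<xi>. circle F \<xi> \<in> \<real>\<^sub>\<ge>\<^sub>0)"

lemma circle_nonneg_Im: "circle_nonneg F \<Longrightarrow> Im (circle F \<xi>) = 0"
  by (simp add: circle_nonneg_def complex_nonneg_Reals_iff)

lemma circle_nonneg_Re: "circle_nonneg F \<Longrightarrow> 0 \<le> Re (circle F \<xi>)"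
  by (simp add: circle_nonneg_def complex_nonneg_Reals_iff)

lemma circle_nonneg_add: "circle_nonneg F \<Longrightarrow> circle_nonneg G \<Longrightarrow> circle_nonneg (F + G)"
  by (simp add: circle_nonneg_def circle.eval_add nonneg_Reals_add_I)

lemma circle_nonneg_mult: "circle_nonneg F \<Longrightarrow> circle_nonneg G \<Longrightarrow> circle_nonneg (F * G)"
  by (simp add: circle_nonneg_def circle.eval_mult nonneg_Reals_mult_I)

lemma circle_nonneg_one: "circle_nonneg 1"
  by (simp add: circle_nonneg_def circle.eval_one)

lemma circle_nonneg_power: "circle_nonneg F \<Longrightarrow> circle_nonneg (F ^ n)"
  by (induction n) (simp_all add: circle_nonneg_one circle_nonneg_mult)

lemma circle_nonneg_dil: "circle_nonneg F \<Longrightarrow> circle_nonneg (dil N F)"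
  by (simp add: circle_nonneg_def circle_dil)

lemma circle_nonneg_of_nat: "circle_nonneg (of_nat n)"
  by (induction n) (simp_all add: circle_nonneg_add circle_nonneg_one,
      simp add: circle_nonneg_def circle.eval_zero)

lemma circle_nonneg_sum:
  assumes "\<And>x. x \<in> A \<Longrightarrow> circle_nonneg (f x)"
  shows "circle_nonneg (sum f A)"
  using assms
proof (induction A rule: infinite_finite_induct)
  case (insert x A)
  then show ?case by (simp add: circle_nonneg_add)
qed (simp_all add: circle_nonneg_def circle.eval_zero)

lemma circle_nonneg_dec_two:
  assumes "circle_nonneg F" shows "circle_nonneg (dec 2 F)"
  using assms
  by (auto simp: circle_nonneg_def circle_dec_two complex_nonneg_Reals_iff)

lemma Re_circle_mult:
  "circle_nonneg F \<Longrightarrow> Re (circle (F * G) \<xi>) = Re (circle F \<xi>) * Re (circle G \<xi>)"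
  by (simp add: circle.eval_mult circle_nonneg_Im)

text \<open>The zeroth coefficient is the mean over the unit circle, so it dominates all the others.\<close>

lemma abs_lookup_le_zero_coeff:
  assumes "circle_nonneg F"
  shows "\<bar>lookup F k\<bar> \<le> lookup F 0"
proof -
  \<comment> \<open>The factor has real part 1 - c cos(k xi), which is nonnegative for both signs c,
    and the zeroth coefficient of the product is that of F minus c times its k-th.\<close>
  have "0 \<le> lookup (F * (1 - single (-k) c)) 0" if "c = 1 \<or> c = -1" for c
  proof (rule zero_coeff_nonneg)
    fix \<xi> :: real
    have "0 \<le> 1 + cos (of_int k * \<xi>)"
      using cos_ge_minus_one[of "of_int k * \<xi>"] by linarith
    then show "0 \<le> Re (circle (F * (1 - single (-k) c)) \<xi>)"
      using assms that circle_nonneg_Re[OF assms, of \<xi>] circle_nonneg_Im[OF assms, of \<xi>]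
      by (auto simp: Re_circle_mult circle.eval_simps intro!: mult_nonneg_nonneg)
  qed
  from this[of 1] this[of "-1"] show ?thesis
    by (simp add: right_diff_distrib lookup_minus lookup_mult_single)
qed

lemma zero_coeff_mono:
  assumes "\<And>\<xi>. Re (circle F \<xi>) \<le> Re (circle G \<xi>)"
  shows "lookup F 0 \<le> lookup G 0"
  using zero_coeff_nonneg[of "G - F"] assms by (simp add: circle.eval_diff lookup_minus)

section \<open>Subdivision and its symbol\<close>

lemma lookup_range_initial_data: "initial_data = range (Poly_Mapping.lookup :: laurent_poly \<Rightarrow> _)"
proof (intro equalityI subsetI)
  fix f :: "int \<Rightarrow> real" assume "f \<in> initial_data"
  then have "Poly_Mapping.lookup (Abs_poly_mapping f) = f"
    by (simp add: initial_data_def)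
  then show "f \<in> range (Poly_Mapping.lookup :: laurent_poly \<Rightarrow> _)" by (metis rangeI)
qed (auto simp: initial_data_def)

lemma subdivision_step_lookup: "subdivision_step a (lookup F) = lookup (a * dil 2 F)"
proof
  fix k
  have "lookup (a * dil 2 F) k = (\<Sum>j\<in>keys a. lookup a j * (if even (k - j) then lookup F ((k - j) div 2) else 0))"
    by (simp add: lookup_mult_keys lookup_dil)
  also have "\<dots> = (\<Sum>j\<in>{j \<in> keys a. even (k - j)}. lookup a j * lookup F ((k - j) div 2))"
    by (rule sum.mono_neutral_cong_right) auto
  also have "\<dots> = subdivision_step a (lookup F) k"
    unfolding subdivision_step_def
    by (rule sum.reindex_bij_witness[of _ "\<lambda>l. k - 2 * l" "\<lambda>j. (k - j) div 2"]) auto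
  finally show "subdivision_step a (lookup F) k = lookup (a * dil 2 F) k" by simp
qed

text \<open>The product of a(z^(2^j)) over j < n. It serves both for the symbol of n subdivision
  steps and for the B_n of the overview.\<close>

primrec iter_symbol :: "laurent_poly \<Rightarrow> nat \<Rightarrow> laurent_poly"
  where "iter_symbol a 0 = 1"
  | "iter_symbol a (Suc n) = a * dil 2 (iter_symbol a n)"

lemma iter_symbol_add: "iter_symbol a (n + r) = iter_symbol a n * dil (2 ^ n) (iter_symbol a r)"
  by (induction n) (simp_all add: dil.eval_mult dil_dil mult_ac)

lemma iter_symbol_Suc: "iter_symbol a (Suc n) = iter_symbol a n * dil (2 ^ n) a"
  using iter_symbol_add[of a n 1] by (simp add: dil.eval_one)

lemma circle_nonneg_iter_symbol: "circle_nonneg a \<Longrightarrow> circle_nonneg (iter_symbol a n)"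
  by (induction n) (simp_all add: circle_nonneg_one circle_nonneg_mult circle_nonneg_dil)

lemma subdivision_lookup: "subdivision a (lookup F) n = lookup (iter_symbol a n * dil (2 ^ n) F)"
proof (induction n)
  case (Suc n)
  have "subdivision a (lookup F) (Suc n) = subdivision_step a (subdivision a (lookup F) n)"
    by (simp add: subdivision_def)
  also have "\<dots> = lookup (a * dil 2 (iter_symbol a n * dil (2 ^ n) F))"
    by (simp only: Suc subdivision_step_lookup)
  finally show ?case by (simp add: dil.eval_mult dil_dil mult_ac)
qed (simp add: subdivision_def)

section \<open>Identities for \<open>sigma\<close> and \<open>delta\<close> and their values on the
  circle\<close>

lemma single_eq_power: "single (int n) 1 = Z ^ n"
proof (induction n)
  case (Suc n)
  have "single (int (Suc n)) 1 = Z * single (int n) 1"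
    by (simp add: mult_single add.commute)
  then show ?case by (simp only: Suc power_Suc)
qed simp

lemma single_numeral_eq_power: "single (numeral n) 1 = Z ^ (numeral n)"
  using single_eq_power[of "numeral n"] by simp

lemma Z_mult_Zinv: "single (-1) 1 * Z = 1"
  by (simp add: mult_single)

lemma single_quarter: "4 * single k (1/4) = single k 1"
  using mult_single[of 0 "4::real" k "1/4"] by simp

lemma four_sigma: "4 * sigma = single (-1) 1 * (1 + Z)\<^sup>2"
  unfolding sigma_def by (simp only: mult.assoc[symmetric] single_quarter)

lemma four_delta: "4 * delta = - (single (-1) 1 * (1 - Z)\<^sup>2)"
  unfolding delta_def by (simp only: mult_minus_right mult.assoc[symmetric] single_quarter)

lemma sigma_add_delta: "sigma + delta = 1"
proof -
  have "4 * (sigma + delta) = single (-1) 1 * ((1 + Z)\<^sup>2 - (1 - Z)\<^sup>2)"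
    using four_sigma four_delta by (simp add: algebra_simps)
  also have "(1 + Z)\<^sup>2 - (1 - Z)\<^sup>2 = 4 * Z"
    by (simp add: power2_eq_square algebra_simps)
  also have "single (-1) 1 * (4 * Z) = 4 * 1"
    using Z_mult_Zinv by (simp add: mult.left_commute)
  finally show ?thesis by (simp only: mult_cancel_left) simp
qed

lemma dil_Z: "dil N Z = single N 1"
  by (simp add: dil_single)

lemma dil_two_one_minus_Z: "dil 2 (1 - Z) = (1 - Z) * (1 + Z)"
  by (simp add: dil.eval_simps dil_Z single_numeral_eq_power power2_eq_square algebra_simps)

lemma dil_two_delta: "dil 2 delta = 4 * delta * sigma"
proof -
  have "4 * dil 2 delta = dil 2 (4 * delta)"
    by (simp add: dil.eval_simps)
  also have "\<dots> = - (single (-2) 1 * (dil 2 (1 - Z))\<^sup>2)"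
    unfolding four_delta by (simp only: dil.eval_uminus dil.eval_mult dil.eval_power dil_single) simp
  also have "single (-2) 1 = single (-1) 1 * single (-1) 1"
    by (simp add: mult_single)
  also have "- (single (-1) 1 * single (-1) 1 * (dil 2 (1 - Z))\<^sup>2) = (4 * delta) * (4 * sigma)"
    unfolding dil_two_one_minus_Z four_delta four_sigma
    by (simp only: power_mult_distrib mult_minus_left mult_minus_right mult_ac)
  also have "\<dots> = 4 * (4 * delta * sigma)"
    by (simp only: mult_ac)
  finally show ?thesis by (simp only: mult_cancel_left) simp
qed

lemma circle_sigma: "circle sigma \<xi> = of_real ((cos (\<xi> / 2))\<^sup>2)"
proof -
  have "circle sigma \<xi> = of_real (1 / 4) * (cis (- \<xi>) * (1 + cis \<xi>)\<^sup>2)"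
    by (simp add: sigma_def circle.eval_simps)
  also have "cis (- \<xi>) * (1 + cis \<xi>)\<^sup>2 = cis (- \<xi>) + 2 * (cis (- \<xi>) * cis \<xi>) + cis (- \<xi>) * cis \<xi> * cis \<xi>"
    by (simp add: power2_eq_square algebra_simps)
  also have "\<dots> = of_real (2 * cos \<xi> + 2)"
    by (simp add: cis_mult complex_eq_iff)
  also have "of_real (1 / 4) * \<dots> = (of_real ((2 * cos \<xi> + 2) / 4) :: complex)"
    by simp
  also have "(2 * cos \<xi> + 2) / 4 = (cos (\<xi> / 2))\<^sup>2"
    using cos_double_cos[of "\<xi> / 2"] by simp
  finally show ?thesis .
qed

lemma circle_delta: "circle delta \<xi> = of_real ((sin (\<xi> / 2))\<^sup>2)"
proof -
  have "circle delta \<xi> = circle (sigma + delta) \<xi> - circle sigma \<xi>"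
    by (simp add: circle.eval_add)
  then have "circle delta \<xi> = 1 - circle sigma \<xi>"
    by (simp only: sigma_add_delta circle.eval_one)
  then show ?thesis by (simp add: circle_sigma sin_squared_eq)
qed

lemma circle_nonneg_sigma: "circle_nonneg sigma"
  by (simp add: circle_nonneg_def circle_sigma del: of_real_power)

lemma circle_nonneg_delta: "circle_nonneg delta"
  by (simp add: circle_nonneg_def circle_delta del: of_real_power)

text \<open>Each step turns delta(z)^m sigma(z)^m into 4^(-m) delta(z^2)^m, so the factors
  \<open>sigma\<close> telescope away and only b is left. The powers of 4 are kept on the left to
  avoid division.\<close>

lemma delta_power_iter_symbol:
  "4 ^ (n * m) * (delta ^ m * iter_symbol (2 * sigma ^ m * b) n) =
    2 ^ n * (dil (2 ^ n) (delta ^ m) * iter_symbol b n)"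
proof (induction n)
  case (Suc n)
  let ?a = "2 * sigma ^ m * b"
  have "4 ^ (Suc n * m) * (delta ^ m * iter_symbol ?a (Suc n)) =
      2 * b * (4 ^ (n * m) * ((4 * delta * sigma) ^ m * dil 2 (iter_symbol ?a n)))"
    by (simp add: power_add power_mult_distrib mult_ac)
  also have "\<dots> = 2 * b * dil 2 (4 ^ (n * m) * (delta ^ m * iter_symbol ?a n))"
    by (simp add: dil.eval_mult dil.eval_power dil.eval_numeral dil_two_delta)
  also have "\<dots> = 2 ^ Suc n * (dil (2 ^ Suc n) (delta ^ m) * iter_symbol b (Suc n))"
    by (subst Suc) (simp add: dil.eval_mult dil.eval_numeral dil.eval_power dil_dil mult_ac)
  finally show ?case .
qed (simp add: dil.eval_power)

text \<open>The remainder theorem at z = 1; a negative power of z reduces to a positive one through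
  the unit z^k.\<close>

lemma one_minus_Z_dvd_diff_at_one: "1 - Z dvd F - single 0 (at_one F)"
proof (induction F rule: laurent_induct)
  case (single k c)
  have nat: "1 - Z dvd 1 - single (int n) 1" for n
    unfolding single_eq_power one_diff_power_eq by simp
  have "1 - Z dvd 1 - single k 1"
  proof (cases "k \<ge> 0")
    case True
    then show ?thesis using nat[of "nat k"] by simp
  next
    case False
    have "1 - single k 1 = (1 - single (- k) 1) * (- single k 1)"
      by (simp add: left_diff_distrib mult_single)
    then show ?thesis using nat[of "nat (- k)"] False by simp
  qed
  then have "1 - Z dvd (1 - single k 1) * single 0 (- c)"
    by (rule dvd_mult2)
  also have "(1 - single k 1) * single 0 (- c) = single k c - single 0 (at_one (single k c))"
    by (simp add: left_diff_distrib mult_single at_one.eval_single single_uminus)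
  finally show ?case .
next
  case (add F G)
  have "F + G - single 0 (at_one (F + G)) =
      (F - single 0 (at_one F)) + (G - single 0 (at_one G))"
    by (simp add: at_one.eval_add single_add)
  then show ?case using dvd_add[OF add] by (simp only:)
qed

lemma one_minus_Z_dvd: "at_one F = 0 \<Longrightarrow> 1 - Z dvd F"
  using one_minus_Z_dvd_diff_at_one[of F] by simp

lemma at_one_Z: "at_one Z = 1"
  by (simp add: at_one.eval_single)

text \<open>q solves q(z) b(z) = q(z^2) to finite order at z = 1, one order at a time. Substituting
  z^2 multiplies (1 - z)^i by (1 + z)^i, which is 2^i at 1, so each new coefficient meets the factor
  1 - 2^i, nonzero for i > 0.\<close>

lemma refinement_correction_exists:
  assumes "at_one b = 1"
  obtains q where "at_one q = 1" "(1 - Z) ^ Suc i dvd q * b - dil 2 q"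
proof -
  have "\<exists>q. at_one q = 1 \<and> (1 - Z) ^ Suc i dvd q * b - dil 2 q"
  proof (induction i)
    case 0
    have "1 - Z dvd b - 1"
      using assms by (intro one_minus_Z_dvd) (simp add: at_one.eval_simps)
    then show ?case by (intro exI[of _ 1]) (simp add: at_one.eval_one dil.eval_one)
  next
    case (Suc i)
    then obtain q R where q: "at_one q = 1" "q * b - dil 2 q = (1 - Z) ^ Suc i * R"
      by (auto elim!: dvdE)
    \<comment> \<open>Solves R(1) + c (1 - 2^(i+1)) = 0, so that the remainder gains one more factor
      1 - z.\<close>
    define c where "c = at_one R / (2 ^ Suc i - 1)"
    define q' where "q' = q + single 0 c * (1 - Z) ^ Suc i"
    have "q' * b - dil 2 q' = (q * b - dil 2 q) +
        (single 0 c * (1 - Z) ^ Suc i * b - single 0 c * ((1 - Z) * (1 + Z)) ^ Suc i)"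
    proof -
      have "dil 2 q' = dil 2 q + single 0 c * ((1 - Z) * (1 + Z)) ^ Suc i"
        unfolding q'_def
        by (simp only: dil.eval_add dil.eval_mult dil.eval_power dil_two_one_minus_Z dil_single mult_zero_right)
      moreover have "(x + s) * y - (w + t) = (x * y - w) + (s * y - t)" for x s y w t :: laurent_poly
        by (simp add: algebra_simps)
      ultimately show ?thesis unfolding q'_def by simp
    qed
    also have "\<dots> = (1 - Z) ^ Suc i * (R + single 0 c * (b - (1 + Z) ^ Suc i))"
      unfolding q power_mult_distrib by (simp only: algebra_simps)
    finally have *: "q' * b - dil 2 q' = (1 - Z) ^ Suc i * (R + single 0 c * (b - (1 + Z) ^ Suc i))" .
    have "(2::real) ^ Suc i - 1 \<noteq> 0"
      using one_less_power[of "2::real" "Suc i"] by simp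
    then have "c * (1 - 2 ^ Suc i) = - at_one R"
      by (simp add: c_def field_simps)
    then have "at_one (R + single 0 c * (b - (1 + Z) ^ Suc i)) = 0"
      by (simp add: at_one.eval_add at_one.eval_mult at_one.eval_diff at_one.eval_power
          at_one.eval_one at_one_Z at_one.eval_single assms del: power_Suc)
    then have "1 - Z dvd R + single 0 c * (b - (1 + Z) ^ Suc i)"
      by (rule one_minus_Z_dvd)
    then have "(1 - Z) ^ Suc (Suc i) dvd q' * b - dil 2 q'"
      unfolding * power_Suc2[of _ "Suc i"] by (intro mult_dvd_mono) auto
    moreover have "at_one q' = 1"
      by (simp add: q'_def at_one.eval_simps q)
    ultimately show ?case by blast
  qed
  then show ?thesis using that by blast
qed

lemma lookup_sigma_mult:
  "lookup (sigma * G) k = (lookup G (k + 1) + 2 * lookup G k + lookup G (k - 1)) / 4"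
proof -
  have *: "sigma = single (-1) (1/4) + single 0 (1/2) + single 1 (1/4)"
  proof -
    have "(1 + Z)\<^sup>2 = single 0 1 + single 1 2 + single 2 1"
    proof -
      have "(1 + Z)\<^sup>2 = 1 + 2 * Z + Z * Z"
        by (simp add: power2_eq_square algebra_simps)
      moreover have "Z * Z = single 2 1" "2 * Z = single 1 2"
        using mult_single[of 0 "2::real" "1::int" 1] by (simp_all add: mult_single)
      ultimately show ?thesis by simp
    qed
    then show ?thesis
      by (simp only: sigma_def distrib_left mult_single) simp
  qed
  show ?thesis
    unfolding * distrib_right lookup_add lookup_single_mult by simp
qed

text \<open>\<open>sigma\<close> averages neighbours with weights 1/4, 1/2, 1/4.\<close>

lemma abs_lookup_sigma_power_le:
  assumes "\<And>k. \<bar>lookup G k\<bar> \<le> E"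
  shows "\<bar>lookup (sigma ^ m * G) k\<bar> \<le> E"
proof (induction m arbitrary: k)
  case (Suc m)
  show ?case
    using Suc[of "k + 1"] Suc[of k] Suc[of "k - 1"]
    by (simp add: mult.assoc lookup_sigma_mult)
qed (use assms in simp)

section \<open>B-splines\<close>

text \<open>The convolution of \<open>g\<close> with the coefficients of \<open>F\<close>, so that \<open>z\<close> acts as the unit shift.\<close>

definition act :: "laurent_poly \<Rightarrow> (real \<Rightarrow> real) \<Rightarrow> real \<Rightarrow> real"
  where "act F g x = (\<Sum>k\<in>keys F. lookup F k * g (x - of_int k))"

lemma act_single: "act (single k c) g x = c * g (x - of_int k)"
  by (auto simp: act_def)

lemma act_add: "act (F + G) g x = act F g x + act G g x"
  unfolding act_def by (rule sum_keys_add[of "\<lambda>k c. c * g (x - of_int k)"]) (auto simp: distrib_right)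

lemma act_one [simp]: "act 1 g x = g x"
  using act_single[of 0 1] by simp

lemma act_uminus: "act (- F) g x = - act F g x"
  using act_add[of F "- F" g x] by (simp add: act_def[of 0])

lemma act_diff: "act (F - G) g x = act F g x - act G g x"
  using act_add[of F "- G" g x] by (simp add: act_uminus)

lemma act_mult: "act (F * G) g x = act F (act G g) x"
proof (induction F arbitrary: x rule: laurent_induct)
  case (single j c)
  show ?case
  proof (induction G rule: laurent_induct)
    case (single i d)
    then show ?case by (simp add: mult_single act_single algebra_simps)
  next
    case (add F G)
    then show ?case by (simp add: act_single distrib_left act_add)
  qed
next
  case (add F1 F2)
  then show ?case by (simp add: distrib_right act_add)
qed

lemma act_scale_fun: "act F (\<lambda>x. c * g x) x = c * act F g x"
  by (simp add: act_def sum_distrib_left mult_ac)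

lemma act_sum_fun: "act F (\<lambda>x. \<Sum>i\<in>A. g i x) x = (\<Sum>i\<in>A. act F (g i) x)"
  unfolding act_def by (simp add: sum_distrib_left sum.swap[of _ A])

lemma act_dil: "act (dil N F) g (of_int N * x) = act F (\<lambda>y. g (of_int N * y)) x"
  by (induction F rule: laurent_induct)
     (simp_all add: dil_single dil.eval_add act_add act_single right_diff_distrib)

lemma numeral_power_eq_single: "numeral w ^ n = single 0 (numeral w ^ n)"
proof (induction n)
  case (Suc n)
  have "numeral w ^ Suc n = single 0 (numeral w) * single 0 (numeral w ^ n)"
    by (simp add: Suc)
  also have "\<dots> = single 0 (numeral w ^ Suc n)"
    by (simp only: mult_single) simp
  finally show ?case .
qed simp

lemma act_numeral_power_mult: "act (numeral w ^ n * F) g x = numeral w ^ n * act F g x"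
  unfolding act_mult numeral_power_eq_single by (simp add: act_single)

lemma lookup_numeral_power_mult: "lookup (numeral w ^ n * F) k = numeral w ^ n * lookup F k"
  unfolding numeral_power_eq_single by (simp add: lookup_single_mult)

lemma act_one_minus_Z: "act (1 - Z) g x = g x - g (x - 1)"
  by (simp add: act_diff act_single)

lemma act_one_minus_Z_power_Suc:
  "act ((1 - Z) ^ Suc n) g x = act ((1 - Z) ^ n) g x - act ((1 - Z) ^ n) g (x - 1)"
  by (simp add: act_mult act_one_minus_Z)

text \<open>The n-th backward difference at x samples only x, x - 1, ..., x - n. Truncated powers
  may thus be replaced by polynomials or by zero.\<close>

lemma act_one_minus_Z_power_cong:
  assumes "\<And>y. x - real n \<le> y \<Longrightarrow> y \<le> x \<Longrightarrow> g y = h y"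
  shows "act ((1 - Z) ^ n) g x = act ((1 - Z) ^ n) h x"
  using assms
proof (induction n arbitrary: x)
  case (Suc n)
  have "act ((1 - Z) ^ n) g x = act ((1 - Z) ^ n) h x"
    by (rule Suc.IH) (use Suc.prems in auto)
  moreover have "act ((1 - Z) ^ n) g (x - 1) = act ((1 - Z) ^ n) h (x - 1)"
    by (rule Suc.IH) (use Suc.prems in auto)
  ultimately show ?case by (simp only: act_one_minus_Z_power_Suc)
qed simp

lemma act_one_minus_Z_power_monomial:
  assumes "j \<le> n"
  shows "act ((1 - Z) ^ n) (\<lambda>x. x ^ j) x = (if j = n then fact n else 0)"
  using assms
proof (induction n arbitrary: j x)
  case (Suc n)
  show ?case
  proof (cases j)
    case 0
    have "act ((1 - Z) ^ Suc n) (\<lambda>x. x ^ j) x = act ((1 - Z) ^ n) (\<lambda>y. 0) x"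
      unfolding power_Suc2 act_mult by (simp add: act_one_minus_Z[abs_def] 0)
    then show ?thesis
      using 0 by (simp add: act_def)
  next
    case (Suc i)
    \<comment> \<open>The leading power cancels in the difference, leaving degree i = j - 1 with
      leading coefficient j; this factor completes the factorial.\<close>
    define c where "c l = - (real (j choose l) * (-1) ^ (j - l))" for l
    have diff: "y ^ j - (y - 1) ^ j = (\<Sum>l\<le>i. c l * y ^ l)" for y :: real
    proof -
      have "(y + -1) ^ j = (\<Sum>l\<le>j. real (j choose l) * y ^ l * (-1) ^ (j - l))"
        by (rule binomial_ring)
      also have "\<dots> = y ^ j - (\<Sum>l\<le>i. c l * y ^ l)"
        by (simp add: Suc c_def sum_negf mult_ac)
      finally show ?thesis by simp
    qed
    have "act ((1 - Z) ^ Suc n) (\<lambda>x. x ^ j) x = act ((1 - Z) ^ n) (\<lambda>y. \<Sum>l\<le>i. c l * y ^ l) x"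
      unfolding power_Suc2 act_mult by (simp add: act_one_minus_Z[abs_def] diff)
    also have "\<dots> = (\<Sum>l\<le>i. c l * (if l = n then fact n else 0))"
      using Suc.prems Suc
      by (simp add: act_sum_fun act_scale_fun Suc.IH)
    also have "\<dots> = (if i = n then c n * fact n else 0)"
      using Suc.prems Suc by (auto simp: sum.delta if_distrib cong: if_cong)
    also have "\<dots> = (if j = Suc n then fact (Suc n) else 0)"
      by (auto simp: Suc c_def)
    finally show ?thesis .
  qed
qed simp

text \<open>Division by the factorial makes the derivative of each truncated power the previous one.
  At i = 0 the formula is the constant 1, since \<open>0 ^ 0 = 1\<close>, so the lemmas on vanishing
  ask for a positive exponent.\<close>

definition trunc_power :: "nat \<Rightarrow> real \<Rightarrow> real"
  where "trunc_power i x = max x 0 ^ i / fact i"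

lemma trunc_power_nonpos: "x \<le> 0 \<Longrightarrow> 0 < i \<Longrightarrow> trunc_power i x = 0"
  by (simp add: trunc_power_def)

lemma DERIV_trunc_power:
  "(trunc_power (Suc (Suc i)) has_real_derivative trunc_power (Suc i) x) (at x)"
proof -
  consider "x < 0" | "x > 0" | "x = 0" by linarith
  then show ?thesis
  proof cases
    case 1
    have "((\<lambda>x. 0) has_real_derivative trunc_power (Suc i) x) (at x)"
      using 1 by (simp add: trunc_power_nonpos)
    then show ?thesis
      by (rule has_field_derivative_transform_within_open[where S = "{..<0}"])
         (use 1 in \<open>auto simp: trunc_power_nonpos\<close>)
  next
    case 2
    have "((\<lambda>x. x ^ Suc (Suc i) / fact (Suc (Suc i))) has_real_derivative trunc_power (Suc i) x) (at x)"
      by (rule derivative_eq_intros refl | simp)+ (use 2 in \<open>simp add: trunc_power_def field_simps\<close>)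
    then show ?thesis
      by (rule has_field_derivative_transform_within_open[where S = "{0<..}"])
         (use 2 in \<open>auto simp: trunc_power_def max_def\<close>)
  next
    case 3
    have "((\<lambda>h. trunc_power (Suc (Suc i)) h / h) \<longlongrightarrow> 0) (at 0)"
    proof (rule Lim_null_comparison)
      show "\<forall>\<^sub>F h in at 0. norm (trunc_power (Suc (Suc i)) h / h) \<le> \<bar>h\<bar> ^ Suc i"
      proof (intro always_eventually allI)
        fix h :: real
        have "max h 0 ^ Suc (Suc i) \<le> \<bar>h\<bar> ^ Suc (Suc i) * fact (Suc (Suc i))"
          using power_mono[of "max h 0" "\<bar>h\<bar>" "Suc (Suc i)"] fact_ge_1[of "Suc (Suc i)", where 'a = real]
            mult_mono[of "max h 0 ^ Suc (Suc i)" "\<bar>h\<bar> ^ Suc (Suc i)" 1 "fact (Suc (Suc i)) :: real"]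
          by simp
        then have "trunc_power (Suc (Suc i)) h \<le> \<bar>h\<bar> * \<bar>h\<bar> ^ Suc i"
          by (simp add: trunc_power_def divide_le_eq)
        moreover have "0 \<le> trunc_power (Suc (Suc i)) h" by (simp add: trunc_power_def)
        ultimately show "norm (trunc_power (Suc (Suc i)) h / h) \<le> \<bar>h\<bar> ^ Suc i"
          by (cases "h = 0") (auto simp: divide_le_eq mult_ac)
      qed
      show "((\<lambda>h. \<bar>h\<bar> ^ Suc i) \<longlongrightarrow> (0::real)) (at 0)"
        by (rule tendsto_eq_intros refl | simp)+
    qed
    then show ?thesis
      using 3 by (simp add: DERIV_def trunc_power_nonpos)
  qed
qed

lemma trunc_power_one_Lipschitz: "\<bar>trunc_power 1 x - trunc_power 1 y\<bar> \<le> \<bar>x - y\<bar>"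
  by (auto simp: trunc_power_def)

text \<open>For \<open>i = 2m - 1\<close> this is the centred B-spline of degree \<open>2m - 1\<close>; smaller \<open>i\<close>
  give its derivatives.\<close>

definition spline :: "nat \<Rightarrow> nat \<Rightarrow> real \<Rightarrow> real"
  where "spline m i = act ((- 4 * delta) ^ m) (trunc_power i)"

text \<open>-4 \<open>delta\<close> is (1 - z)^2 / z, the second central difference; its m-th power
  is a 2m-th backward difference centred by the shift m.\<close>

lemma minus_four_delta_power: "(- 4 * delta) ^ m = single (- int m) 1 * (1 - Z) ^ (2 * m)"
proof -
  have "- 4 * delta = single (-1) 1 * (1 - Z)\<^sup>2"
    using four_delta by simp
  moreover have "single (-1) 1 ^ m = single (- int m) 1"
    by (induction m) (simp_all add: mult_single)
  ultimately show ?thesis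
    by (simp add: power_mult_distrib power_mult)
qed

lemma spline_eq: "spline m i x = act ((1 - Z) ^ (2 * m)) (trunc_power i) (x + real m)"
  unfolding spline_def minus_four_delta_power act_mult by (simp add: act_single)

lemma act_one_minus_Z_power_trunc_power:
  assumes "j \<le> n" "real n \<le> x" "0 < j"
  shows "act ((1 - Z) ^ n) (trunc_power j) x = (if j = n then 1 else 0)"
proof -
  have "act ((1 - Z) ^ n) (trunc_power j) x = act ((1 - Z) ^ n) (\<lambda>x. inverse (fact j) * x ^ j) x"
    using assms by (intro act_one_minus_Z_power_cong) (simp add: trunc_power_def field_simps)
  also have "\<dots> = inverse (fact j) * act ((1 - Z) ^ n) (\<lambda>x. x ^ j) x"
    by (rule act_scale_fun)
  finally show ?thesis
    using assms by (simp add: act_one_minus_Z_power_monomial)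
qed

lemma act_one_minus_Z_power_trunc_power_nonpos:
  assumes "x \<le> 0" "0 < j"
  shows "act ((1 - Z) ^ n) (trunc_power j) x = 0"
proof -
  have "act ((1 - Z) ^ n) (trunc_power j) x = act ((1 - Z) ^ n) (\<lambda>x. 0) x"
    using assms by (intro act_one_minus_Z_power_cong) (simp add: trunc_power_nonpos)
  then show ?thesis by (simp add: act_def)
qed

text \<open>Left of the support all truncated powers vanish; right of it they are polynomials of
  degree i < 2m, which a 2m-th difference annihilates.\<close>

lemma spline_eq_zero:
  assumes "0 < i" "i < 2 * m" "real m \<le> \<bar>x\<bar>"
  shows "spline m i x = 0"
proof (cases "x \<ge> 0")
  case True
  then show ?thesis
    unfolding spline_eq using assms by (subst act_one_minus_Z_power_trunc_power) auto
next
  case False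
  then show ?thesis
    unfolding spline_eq using assms by (subst act_one_minus_Z_power_trunc_power_nonpos) auto
qed

section \<open>Smoothness and boundedness of splines\<close>

lemma DERIV_act:
  assumes "\<And>x. (g has_real_derivative g' x) (at x)"
  shows "(act F g has_real_derivative act F g' x) (at x)"
  unfolding act_def
proof (intro DERIV_sum DERIV_cmult)
  fix k
  show "((\<lambda>x. g (x - of_int k)) has_real_derivative g' (x - of_int k)) (at x)"
    using DERIV_shift[of g "g' (x - of_int k)" x "- of_int k"] assms by simp
qed

lemma DERIV_spline: "(spline m (Suc (Suc i)) has_real_derivative spline m (Suc i) x) (at x)"
  unfolding spline_def by (rule DERIV_act) (rule DERIV_trunc_power)

lemma act_Lipschitz:
  assumes "\<And>x y. \<bar>g x - g y\<bar> \<le> L * \<bar>x - y\<bar>"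
  shows "\<bar>act F g x - act F g y\<bar> \<le> l1_norm F * L * \<bar>x - y\<bar>"
proof -
  have "act F g x - act F g y = (\<Sum>k\<in>keys F. lookup F k * (g (x - of_int k) - g (y - of_int k)))"
    by (simp add: act_def right_diff_distrib sum_subtractf)
  also have "\<bar>\<dots>\<bar> \<le> (\<Sum>k\<in>keys F. \<bar>lookup F k * (g (x - of_int k) - g (y - of_int k))\<bar>)"
    by (rule sum_abs)
  also have "\<dots> \<le> (\<Sum>k\<in>keys F. \<bar>lookup F k\<bar> * (L * \<bar>x - y\<bar>))"
  proof (intro sum_mono)
    fix k
    show "\<bar>lookup F k * (g (x - of_int k) - g (y - of_int k))\<bar> \<le> \<bar>lookup F k\<bar> * (L * \<bar>x - y\<bar>)"
      using assms[of "x - of_int k" "y - of_int k"] by (simp add: abs_mult mult_left_mono)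
  qed
  also have "\<dots> = l1_norm F * L * \<bar>x - y\<bar>"
    by (simp add: l1_norm_def sum_distrib_right mult.assoc)
  finally show ?thesis .
qed

lemma spline_one_Lipschitz: "\<bar>spline m 1 x - spline m 1 y\<bar> \<le> l1_norm ((- 4 * delta) ^ m) * \<bar>x - y\<bar>"
  using act_Lipschitz[of "trunc_power 1" 1] trunc_power_one_Lipschitz by (simp add: spline_def)

lemma continuous_spline:
  assumes "0 < i" shows "continuous_on A (spline m i)"
proof -
  have "continuous_on UNIV (spline m i)"
  proof (cases "i = 1")
    case True
    have "(l1_norm ((- 4 * delta) ^ m))-lipschitz_on UNIV (spline m 1)"
      using spline_one_Lipschitz l1_norm_nonneg by (intro lipschitz_onI) (auto simp: dist_real_def)
    then show ?thesis using True lipschitz_on_continuous_on by blast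
  next
    case False
    then obtain j where "i = Suc (Suc j)"
      using assms by (metis One_nat_def gr0_implies_Suc not0_implies_Suc)
    then show ?thesis
      using DERIV_spline DERIV_isCont by (blast intro: continuous_at_imp_continuous_on)
  qed
  then show ?thesis by (rule continuous_on_subset) simp
qed

lemma spline_bounded:
  assumes "0 < i" "i < 2 * m"
  obtains K where "0 \<le> K" "\<And>x. \<bar>spline m i x\<bar> \<le> K"
proof -
  have "compact (spline m i ` {- real m..real m})"
    using assms by (intro compact_continuous_image continuous_spline) auto
  then have "bounded (spline m i ` {- real m..real m})"
    by (rule compact_imp_bounded)
  then obtain K where K: "\<And>x. x \<in> {- real m..real m} \<Longrightarrow> \<bar>spline m i x\<bar> \<le> K"
    unfolding bounded_iff real_norm_def by blast
  have "0 \<le> K" using K[of 0] by fastforce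
  have "\<bar>spline m i x\<bar> \<le> K" for x
  proof (cases "\<bar>x\<bar> \<le> real m")
    case True
    then show ?thesis using K[of x] by (simp add: abs_le_iff)
  next
    case False
    then show ?thesis using spline_eq_zero[OF assms, of x] \<open>0 \<le> K\<close> by simp
  qed
  then show ?thesis using that \<open>0 \<le> K\<close> by blast
qed

lemma spline_Lipschitz:
  assumes "0 < i" "i < 2 * m"
  obtains L where "0 \<le> L" "\<And>x y. \<bar>spline m i x - spline m i y\<bar> \<le> L * \<bar>x - y\<bar>"
proof (cases "i = 1")
  case True
  then show ?thesis using that spline_one_Lipschitz l1_norm_nonneg by blast
next
  case False
  then obtain j where j: "i = Suc (Suc j)"
    using assms by (metis One_nat_def gr0_implies_Suc not0_implies_Suc)
  obtain K where K: "0 \<le> K" "\<And>x. \<bar>spline m (Suc j) x\<bar> \<le> K"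
    using spline_bounded[of "Suc j" m] assms j by auto
  have "\<bar>spline m i x - spline m i y\<bar> \<le> K * \<bar>x - y\<bar>" for x y
    using field_differentiable_bound[of UNIV "spline m i" "spline m (Suc j)" K x y] DERIV_spline K j
    by (auto simp: has_field_derivative_at_within)
  then show ?thesis using that K by blast
qed

text \<open>At most 2R + 1 integers lie within distance R of x.\<close>

lemma sum_local_le:
  fixes t :: "int \<Rightarrow> real"
  assumes "finite A" "0 \<le> C" "\<And>k. k \<in> A \<Longrightarrow> \<bar>t k\<bar> \<le> C"
    and "\<And>k. k \<in> A \<Longrightarrow> real R < \<bar>x - of_int k\<bar> \<Longrightarrow> t k = 0"
  shows "\<bar>sum t A\<bar> \<le> (2 * real R + 1) * C"
proof -
  let ?J = "{\<lceil>x - real R\<rceil>..\<lfloor>x + real R\<rfloor>}"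
  have "sum t A = sum t (A \<inter> ?J)"
  proof (intro sum.mono_neutral_right assms(1) ballI)
    fix k assume "k \<in> A - A \<inter> ?J"
    then have "\<not> (x - real R \<le> of_int k \<and> of_int k \<le> x + real R)"
      unfolding Diff_iff Int_iff atLeastAtMost_iff le_floor_iff ceiling_le_iff by blast
    then have "real R < \<bar>x - of_int k\<bar>" by linarith
    then show "t k = 0" using assms(4) \<open>k \<in> A - A \<inter> ?J\<close> by blast
  qed auto
  also have "\<bar>\<dots>\<bar> \<le> (\<Sum>k\<in>A \<inter> ?J. \<bar>t k\<bar>)" by (rule sum_abs)
  also have "\<dots> \<le> real (card (A \<inter> ?J)) * C"
    using assms by (intro sum_bounded_above) auto
  also have "\<dots> \<le> (2 * real R + 1) * C"
  proof (intro mult_right_mono assms)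
    have "card (A \<inter> ?J) \<le> card ?J" by (intro card_mono) auto
    also have "card ?J = nat (\<lfloor>x + real R\<rfloor> - \<lceil>x - real R\<rceil> + 1)" by simp
    also have "\<lfloor>x + real R\<rfloor> - \<lceil>x - real R\<rceil> + 1 \<le> 2 * int R + 1"
      by linarith
    finally show "real (card (A \<inter> ?J)) \<le> 2 * real R + 1" by linarith
  qed
  finally show ?thesis .
qed

text \<open>For compactly supported g the supremum of the coefficients suffices. A bound by
  \<open>l1_norm\<close> would grow with the number of coefficients, hence with the level.\<close>

lemma abs_act_le:
  assumes "\<And>k. \<bar>lookup F k\<bar> \<le> E" "\<And>x. \<bar>g x\<bar> \<le> K" "\<And>x. real R < \<bar>x\<bar> \<Longrightarrow> g x = 0"
  shows "\<bar>act F g x\<bar> \<le> (2 * real R + 1) * (K * E)"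
proof -
  have "0 \<le> E" "0 \<le> K" using assms(1)[of 0] assms(2)[of 0] by linarith+
  then show ?thesis
    unfolding act_def using assms(3)
    by (intro sum_local_le[of _ _ _ _ x])
       (auto simp: abs_mult mult.commute[of K] intro!: mult_mono assms(1,2))
qed

lemma act_local_Lipschitz:
  assumes F: "\<And>k. \<bar>lookup F k\<bar> \<le> E" and L: "0 \<le> L" "\<And>x y. \<bar>g x - g y\<bar> \<le> L * \<bar>x - y\<bar>"
    and supp: "\<And>x. real R < \<bar>x\<bar> \<Longrightarrow> g x = 0"
  shows "\<bar>act F g x - act F g y\<bar> \<le> 2 * (2 * real R + 1) * (L * E * \<bar>x - y\<bar>)"
proof -
  let ?t = "\<lambda>k. lookup F k * (g (x - of_int k) - g (y - of_int k))"
  \<comment> \<open>Terms with index far from both x and y vanish. \<open>?A\<close> holds the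
    indices near x; those in \<open>?B\<close> contribute only near y. Each group obeys
    \<open>sum_local_le\<close>, hence the factor 2.\<close>
  let ?A = "{k \<in> keys F. \<bar>x - of_int k\<bar> \<le> real R}" and ?B = "{k \<in> keys F. real R < \<bar>x - of_int k\<bar>}"
  have "0 \<le> E" using F[of 0] by linarith
  have t: "\<bar>?t k\<bar> \<le> L * E * \<bar>x - y\<bar>" for k
  proof -
    have "\<bar>?t k\<bar> \<le> E * (L * \<bar>x - y\<bar>)"
      unfolding abs_mult using F[of k] L(2)[of "x - of_int k" "y - of_int k"] L(1) \<open>0 \<le> E\<close>
      by (intro mult_mono) auto
    then show ?thesis by (simp add: mult_ac)
  qed
  have "0 \<le> L * E * \<bar>x - y\<bar>" using L \<open>0 \<le> E\<close> by simp
  have "keys F = ?A \<union> ?B" by auto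
  then have "act F g x - act F g y = sum ?t (?A \<union> ?B)"
    by (simp add: act_def right_diff_distrib sum_subtractf)
  also have "\<dots> = sum ?t ?A + sum ?t ?B"
    by (intro sum.union_disjoint) auto
  finally have "act F g x - act F g y = sum ?t ?A + sum ?t ?B" .
  moreover have "\<bar>sum ?t ?A\<bar> \<le> (2 * real R + 1) * (L * E * \<bar>x - y\<bar>)"
    using t \<open>0 \<le> L * E * \<bar>x - y\<bar>\<close> by (intro sum_local_le[of _ _ _ _ x]) auto
  moreover have "\<bar>sum ?t ?B\<bar> \<le> (2 * real R + 1) * (L * E * \<bar>x - y\<bar>)"
  proof (intro sum_local_le[of _ _ _ _ y])
    fix k assume "k \<in> ?B"
    show "\<bar>?t k\<bar> \<le> L * E * \<bar>x - y\<bar>" by (rule t)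
    assume "real R < \<bar>y - of_int k\<bar>"
    with \<open>k \<in> ?B\<close> show "?t k = 0" using supp by simp
  qed (use \<open>0 \<le> L * E * \<bar>x - y\<bar>\<close> in simp_all)
  ultimately show ?thesis by linarith
qed

text \<open>The two-scale relation of B-splines. It combines 4^m sigma^m kappa(z) = kappa(z^2) for
  kappa = (-4 delta)^m with the homogeneity of truncated powers; the factors 2 and 2^(2m-1) multiply
  to 4^m.\<close>

lemma act_spline_refine:
  assumes "1 \<le> m"
  shows "act (2 * sigma ^ m * dil 2 c) (spline m (2 * m - 1)) (2 * x) = act c (spline m (2 * m - 1)) x"
proof -
  let ?T = "trunc_power (2 * m - 1)" and ?\<kappa> = "(- 4 * delta) ^ m"
  have refine: "act (2 * sigma ^ m) (spline m (2 * m - 1)) (2 * y) = spline m (2 * m - 1) y" for y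
  proof -
    have "(2::real) * 2 ^ (2 * m - 1) = 2 ^ (2 * m)"
      using assms by (simp flip: power_Suc)
    then have two: "(2::real) * 2 ^ (2 * m - 1) = 4 ^ m"
      by (simp add: power_mult)
    have "4 ^ m * act (2 * sigma ^ m) (spline m (2 * m - 1)) (2 * y) =
        act (2 * (4 ^ m * (sigma ^ m * ?\<kappa>))) ?T (2 * y)"
      by (simp only: spline_def act_mult[symmetric] act_numeral_power_mult[symmetric] mult_ac)
    also have "4 ^ m * (sigma ^ m * ?\<kappa>) = dil 2 ?\<kappa>"
      by (simp add: dil.eval_simps dil_two_delta power_mult_distrib[symmetric] mult_ac)
    also have "act (2 * dil 2 ?\<kappa>) ?T (2 * y) = 2 * act (dil 2 ?\<kappa>) ?T (2 * y)"
      using act_numeral_power_mult[of _ 1] by simp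
    also have "act (dil 2 ?\<kappa>) ?T (2 * y) = act ?\<kappa> (\<lambda>y. ?T (2 * y)) y"
      using act_dil[of 2] by simp
    also have "(\<lambda>y. ?T (2 * y)) = (\<lambda>y. 2 ^ (2 * m - 1) * ?T y)"
    proof
      fix y :: real
      have "max (2 * y) 0 = 2 * max y 0" by auto
      then show "?T (2 * y) = 2 ^ (2 * m - 1) * ?T y"
        by (simp only: trunc_power_def power_mult_distrib times_divide_eq_right)
    qed
    also have "2 * act ?\<kappa> (\<lambda>y. 2 ^ (2 * m - 1) * ?T y) y = 4 ^ m * spline m (2 * m - 1) y"
      unfolding act_scale_fun spline_def mult.assoc[symmetric] two ..
    finally show ?thesis by simp
  qed
  have "act (2 * sigma ^ m * dil 2 c) (spline m (2 * m - 1)) (2 * x) =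
      act (dil 2 c) (act (2 * sigma ^ m) (spline m (2 * m - 1))) (2 * x)"
    by (simp only: act_mult[symmetric] mult.commute)
  also have "\<dots> = act c (\<lambda>y. act (2 * sigma ^ m) (spline m (2 * m - 1)) (2 * y)) x"
    using act_dil[of 2] by simp
  finally show ?thesis by (simp only: refine)
qed

lemma sum_int_telescope:
  fixes h :: "int \<Rightarrow> real"
  assumes "a \<le> b"
  shows "(\<Sum>j=a..b. h j - h (j + 1)) = h a - h (b + 1)"
  using assms
proof (induction b rule: int_ge_induct)
  case (step i)
  have "{a..i + 1} = insert (i + 1) {a..i}" using step by auto
  then show ?case using step by simp
qed simp

text \<open>A 2m-th difference is a first difference of (2m-1)-th differences, so the sum
  telescopes. The (2m-1)-th difference of the truncated power of the same degree is 0 far to the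
  left and 1 far to the right.\<close>

lemma sum_spline_shifts:
  assumes "1 \<le> m"
  shows "(\<Sum>j=\<lfloor>x\<rfloor> - int m - 1..\<lfloor>x\<rfloor> + int m + 1. spline m (2 * m - 1) (x - of_int j)) = 1"
proof -
  let ?h = "\<lambda>j. act ((1 - Z) ^ (2 * m - 1)) (trunc_power (2 * m - 1)) (x - of_int j + real m)"
  let ?a = "\<lfloor>x\<rfloor> - int m - 1" and ?b = "\<lfloor>x\<rfloor> + int m + 1"
  have m: "2 * m = Suc (2 * m - 1)" using assms by simp
  have "spline m (2 * m - 1) (x - of_int j) = ?h j - ?h (j + 1)" for j
  proof -
    have "spline m (2 * m - 1) (x - of_int j) = act ((1 - Z) ^ Suc (2 * m - 1)) (trunc_power (2 * m - 1)) (x - of_int j + real m)"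
      unfolding spline_eq using m by simp
    then show ?thesis
      unfolding act_one_minus_Z_power_Suc by (simp add: algebra_simps)
  qed
  then have "(\<Sum>j=?a..?b. spline m (2 * m - 1) (x - of_int j)) = ?h ?a - ?h (?b + 1)"
    using sum_int_telescope[of ?a ?b ?h] by simp
  moreover have "?h ?a = 1"
    using assms by (subst act_one_minus_Z_power_trunc_power) (simp, linarith, simp_all)
  moreover have "?h (?b + 1) = 0"
    using assms by (subst act_one_minus_Z_power_trunc_power_nonpos) (linarith, simp_all)
  ultimately show ?thesis by simp
qed

lemma abs_lookup_diff_le:
  assumes "\<And>k. \<bar>lookup ((1 - Z) * F) k\<bar> \<le> D"
  shows "\<bar>lookup F i - lookup F j\<bar> \<le> \<bar>of_int (i - j)\<bar> * D"
proof -
  have step: "\<bar>lookup F k - lookup F (k - 1)\<bar> \<le> D" for k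
    using assms[of k] by (simp add: left_diff_distrib lookup_minus lookup_single_mult)
  have *: "\<bar>lookup F i - lookup F j\<bar> \<le> of_int (i - j) * D" if "j \<le> i" for i j
    using that
  proof (induction i rule: int_ge_induct)
    case (step i)
    have "\<bar>lookup F (i + 1) - lookup F i\<bar> \<le> D"
      using \<open>\<And>k. \<bar>lookup F k - lookup F (k - 1)\<bar> \<le> D\<close>[of "i + 1"] by simp
    then show ?case using step.IH by (simp add: distrib_right left_diff_distrib)
  qed simp
  show ?thesis
    using *[of i j] *[of j i] by (cases "j \<le> i") (auto simp: abs_minus_commute)
qed

text \<open>The shifted splines form a partition of unity, so near \<open>x\<close> a spline is close to any of its
  coefficients when these vary slowly.\<close>

lemma act_spline_near_coeff:
  assumes "1 \<le> m"
  obtains C where "0 \<le> C"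
    "\<And>c D x. (\<And>k. \<bar>lookup ((1 - Z) * c) k\<bar> \<le> D) \<Longrightarrow> \<bar>act c (spline m (2 * m - 1)) x - lookup c \<lfloor>x\<rfloor>\<bar> \<le> C * D"
proof -
  let ?N = "spline m (2 * m - 1)"
  obtain K where K: "0 \<le> K" "\<And>x. \<bar>?N x\<bar> \<le> K"
    using spline_bounded[of "2 * m - 1" m] assms by auto
  have "\<bar>act c ?N x - lookup c \<lfloor>x\<rfloor>\<bar> \<le> ((2 * real m + 3) * (real m + 1) * K) * D"
    if D: "\<And>k. \<bar>lookup ((1 - Z) * c) k\<bar> \<le> D" for c D x
  proof -
    have "0 \<le> D" using D[of 0] by linarith
    let ?J = "{\<lfloor>x\<rfloor> - int m - 1..\<lfloor>x\<rfloor> + int m + 1}"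
    have zero: "?N (x - of_int k) = 0" if "k \<notin> ?J" for k
    proof -
      have "real m \<le> \<bar>x - of_int k\<bar>"
        using that by (auto simp: not_le) linarith+
      then show ?thesis using assms by (intro spline_eq_zero) auto
    qed
    have "act c ?N x = (\<Sum>k\<in>keys c \<union> ?J. lookup c k * ?N (x - of_int k))"
      unfolding act_def by (rule sum_keys_superset) auto
    also have "\<dots> = (\<Sum>k\<in>?J. lookup c k * ?N (x - of_int k))"
      using zero by (intro sum.mono_neutral_right) auto
    finally have "act c ?N x = (\<Sum>k\<in>?J. lookup c k * ?N (x - of_int k))" .
    moreover have "lookup c \<lfloor>x\<rfloor> = (\<Sum>k\<in>?J. lookup c \<lfloor>x\<rfloor> * ?N (x - of_int k))"
      using sum_spline_shifts[OF assms, of x] by (simp flip: sum_distrib_left)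
    ultimately have "act c ?N x - lookup c \<lfloor>x\<rfloor> =
        (\<Sum>k\<in>?J. (lookup c k - lookup c \<lfloor>x\<rfloor>) * ?N (x - of_int k))"
      by (simp add: left_diff_distrib sum_subtractf)
    also have "\<bar>\<dots>\<bar> \<le> (\<Sum>k\<in>?J. \<bar>(lookup c k - lookup c \<lfloor>x\<rfloor>) * ?N (x - of_int k)\<bar>)"
      by (rule sum_abs)
    also have "\<dots> \<le> real (card ?J) * ((real m + 1) * D * K)"
    proof (rule sum_bounded_above)
      fix k assume "k \<in> ?J"
      then have "\<bar>of_int (k - \<lfloor>x\<rfloor>)\<bar> \<le> real m + 1" by auto
      then have "\<bar>of_int (k - \<lfloor>x\<rfloor>)\<bar> * D \<le> (real m + 1) * D"
        using \<open>0 \<le> D\<close> by (intro mult_right_mono)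
      then have "\<bar>lookup c k - lookup c \<lfloor>x\<rfloor>\<bar> \<le> (real m + 1) * D"
        using abs_lookup_diff_le[OF D, of k "\<lfloor>x\<rfloor>"] by linarith
      then show "\<bar>(lookup c k - lookup c \<lfloor>x\<rfloor>) * ?N (x - of_int k)\<bar> \<le> (real m + 1) * D * K"
        unfolding abs_mult using K \<open>0 \<le> D\<close> by (intro mult_mono) auto
    qed
    also have "card ?J = 2 * m + 3" by simp
    finally show ?thesis by (simp add: mult_ac)
  qed
  then show ?thesis using that[of "(2 * real m + 3) * (real m + 1) * K"] K by simp
qed

section \<open>Hoelder classes and multiscale series\<close>

lemma funpow_deriv_eq:
  fixes D :: "nat \<Rightarrow> real \<Rightarrow> real"
  assumes "\<And>i x. i < q \<Longrightarrow> (D i has_real_derivative D (Suc i) x) (at x)" and "i \<le> q"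
  shows "(deriv ^^ i) (D 0) = D i"
  using assms(2)
proof (induction i)
  case (Suc i)
  then have "(deriv ^^ Suc i) (D 0) = deriv (D i)" by simp
  also have "\<dots> = D (Suc i)"
    using assms(1) Suc.prems by (intro ext DERIV_imp_deriv) auto
  finally show ?case .
qed simp

lemma holder_classI:
  fixes D :: "nat \<Rightarrow> real \<Rightarrow> real"
  assumes "nat \<lfloor>\<beta>\<rfloor> = q"
    and D: "\<And>i x. i < q \<Longrightarrow> (D i has_real_derivative D (Suc i) x) (at x)"
    and "continuous_on UNIV (D q)"
    and "0 < frac \<beta> \<Longrightarrow> holder_continuous (frac \<beta>) (D q)"
  shows "D 0 \<in> holder_class \<beta>"
proof -
  have eq: "(deriv ^^ i) (D 0) = D i" if "i \<le> q" for i
    using D that by (rule funpow_deriv_eq)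
  have "D i differentiable_on UNIV" if "i < q" for i
    using D[OF that] by (metis differentiable_at_imp_differentiable_on real_differentiable_def)
  then show ?thesis
    using assms eq by (simp add: holder_class_def times_cont_differentiable_def)
qed

lemma continuous_on_act:
  assumes "continuous_on UNIV g"
  shows "continuous_on UNIV (act F g)"
  unfolding act_def[abs_def]
  by (intro continuous_on_sum continuous_on_mult_left continuous_on_compose2[OF assms])
     (auto intro!: continuous_intros)

text \<open>Interpolates between the size bound 1 and the Lipschitz bound t.\<close>

lemma min_le_powr:
  fixes t :: real
  assumes "0 \<le> t" "0 < \<alpha>" "\<alpha> \<le> 1"
  shows "min 1 t \<le> t powr \<alpha>"
proof (cases "t \<le> 1")
  case True
  show ?thesis
  proof (cases "t = 0")
    case False
    then have "t powr 1 \<le> t powr \<alpha>"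
      using True assms by (intro powr_mono') auto
    then show ?thesis using assms False by simp
  qed simp
next
  case False
  then show ?thesis using ge_one_powr_ge_zero[of t \<alpha>] assms by simp
qed

lemma powr_nat_mult: "(2::real) powr (real n * x) = (2 powr x) ^ n"
  by (simp add: powr_realpow[symmetric] powr_powr mult.commute)

text \<open>The \<open>i\<close>-th derivative of the part of scale \<open>2\<^sup>-\<^sup>j\<close> has size \<open>(2\<^sup>i \<rho>)\<^sup>j\<close>, which is summable
  for \<open>i\<close> up to the integer part of \<open>\<beta>\<close>. Its increments are interpolated between this bound and the
  Lipschitz bound.\<close>

lemma spline_series_holder:
  assumes m: "1 \<le> m" and d: "\<And>j k. \<bar>lookup (d j) k\<bar> \<le> C * \<rho> ^ j"
    and \<rho>: "0 < \<rho>" "2 powr \<beta> * \<rho> < 1" and \<beta>: "0 \<le> \<beta>" "\<beta> < 2 * real m - 1"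
  shows "(\<lambda>j. act (d j) (spline m (2 * m - 1)) (2 ^ j * x)) sums
      suminf (\<lambda>j. act (d j) (spline m (2 * m - 1)) (2 ^ j * x))"
    and "(\<lambda>x. suminf (\<lambda>j. act (d j) (spline m (2 * m - 1)) (2 ^ j * x))) \<in> holder_class \<beta>"
proof -
  define q where "q = nat \<lfloor>\<beta>\<rfloor>"
  define H where "H i j x = (2 ^ i) ^ j * act (d j) (spline m (2 * m - 1 - i)) (2 ^ j * x)" for i j :: nat and x
  define S where "S i x = suminf (\<lambda>j. H i j x)" for i x
  have q\<beta>: "real q \<le> \<beta>" using \<beta> by (simp add: q_def)
  have \<beta>q: "\<beta> = real q + frac \<beta>" using \<beta> by (simp add: q_def frac_def)
  \<comment> \<open>Keeps the degree 2m - 1 - i at least 1 for all i up to q, where splines are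
    still continuous and Lipschitz.\<close>
  have qm: "q + 2 \<le> 2 * m" using q\<beta> \<beta> m by linarith
  have "0 \<le> C" using d[of 0 0] by simp
  have pow_q: "2 ^ i * \<rho> < 1" if "i \<le> q" for i
  proof -
    have "(2::real) ^ i = 2 powr real i" by (simp add: powr_realpow)
    also have "\<dots> \<le> 2 powr \<beta>" using that q\<beta> by (intro powr_mono) auto
    finally show ?thesis using \<rho> by (meson less_eq_real_def mult_right_mono order_le_less_trans)
  qed
  have H_bound: "\<exists>K\<ge>0. \<forall>j x. \<bar>H i j x\<bar> \<le> K * (2 ^ i * \<rho>) ^ j" if "i \<le> q" for i
  proof -
    have i: "0 < 2 * m - 1 - i" "2 * m - 1 - i < 2 * m"
      using that qm by linarith+
    then obtain K where K: "0 \<le> K" "\<And>x. \<bar>spline m (2 * m - 1 - i) x\<bar> \<le> K"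
      using spline_bounded by blast
    have "\<bar>H i j x\<bar> \<le> (2 * real m + 1) * (K * C) * (2 ^ i * \<rho>) ^ j" for j x
    proof -
      have "\<bar>act (d j) (spline m (2 * m - 1 - i)) (2 ^ j * x)\<bar> \<le> (2 * real m + 1) * (K * (C * \<rho> ^ j))"
        using d K i by (intro abs_act_le) (auto intro: spline_eq_zero)
      then have "\<bar>H i j x\<bar> \<le> (2 ^ i) ^ j * ((2 * real m + 1) * (K * (C * \<rho> ^ j)))"
        by (simp add: H_def abs_mult)
      then show ?thesis by (simp add: power_mult_distrib mult_ac)
    qed
    moreover have "0 \<le> (2 * real m + 1) * (K * C)" using K \<open>0 \<le> C\<close> by simp
    ultimately show ?thesis by blast
  qed
  have summable_geo: "summable (\<lambda>j. K * (2 ^ i * \<rho>) ^ j)" if "i \<le> q" for K i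
    using pow_q[OF that] \<rho> by (intro summable_mult summable_geometric) simp
  have H_summable: "summable (\<lambda>j. H i j x)" if iq: "i \<le> q" for i x
  proof -
    obtain K where "\<And>j x. \<bar>H i j x\<bar> \<le> K * (2 ^ i * \<rho>) ^ j" using H_bound[OF iq] by blast
    then show ?thesis
      by (intro summable_comparison_test'[OF summable_geo[OF iq, of K], of 0]) simp
  qed
  have H_uniform: "uniform_limit UNIV (\<lambda>n x. \<Sum>j<n. H i j x) (S i) sequentially" if iq: "i \<le> q" for i
  proof -
    obtain K where "\<And>j x. \<bar>H i j x\<bar> \<le> K * (2 ^ i * \<rho>) ^ j" using H_bound[OF iq] by blast
    then show ?thesis unfolding S_def[abs_def]
      by (intro Weierstrass_m_test[OF _ summable_geo[OF iq, of K]]) simp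
  qed
  have H_deriv: "(H i j has_real_derivative H (Suc i) j x) (at x)" if iq: "i < q" for i j x
  proof -
    obtain l where "2 * m - 1 - Suc i = Suc l"
    proof (cases "2 * m - 1 - Suc i")
      case 0
      then show thesis using iq qm by linarith
    qed
    moreover have "2 * m - 1 - i = Suc (2 * m - 1 - Suc i)"
      using iq qm by linarith
    ultimately have l: "2 * m - 1 - i = Suc (Suc l)" "2 * m - 1 - Suc i = Suc l" by simp_all
    have "((\<lambda>x. act (d j) (spline m (Suc (Suc l))) (2 ^ j * x)) has_real_derivative
        act (d j) (spline m (Suc l)) (2 ^ j * x) * 2 ^ j) (at x)"
      by (rule DERIV_chain2[OF DERIV_act[OF DERIV_spline]]) (auto intro!: derivative_eq_intros)
    from DERIV_cmult[OF this, of "(2 ^ i) ^ j"] show ?thesis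
      unfolding H_def[abs_def] l by (simp add: power_mult_distrib mult_ac)
  qed
  have S_deriv: "(S i has_real_derivative S (Suc i) x) (at x)" if "i < q" for i x
  proof -
    have "((\<lambda>x. suminf (\<lambda>j. H i j x)) has_field_derivative suminf (\<lambda>j. H (Suc i) j x)) (at x)"
    proof (rule has_field_derivative_series'(2)[of UNIV _ _ 0])
      show "uniformly_convergent_on UNIV (\<lambda>n x. \<Sum>j<n. H (Suc i) j x)"
        using H_uniform[of "Suc i"] that by (auto simp: uniformly_convergent_on_def)
    qed (use that H_deriv H_summable in auto)
    then show ?thesis by (simp add: S_def[abs_def])
  qed
  have cont: "continuous_on UNIV (S q)"
  proof (rule uniform_limit_theorem[OF _ H_uniform])
    have "continuous_on UNIV (spline m (2 * m - 1 - q))"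
      using qm by (intro continuous_spline) linarith
    then have act: "continuous_on UNIV (act F (spline m (2 * m - 1 - q)))" for F
      by (rule continuous_on_act)
    have "continuous_on UNIV (H q j)" for j
      unfolding H_def[abs_def]
      by (intro continuous_on_mult_left continuous_on_compose2[OF act]) (auto intro!: continuous_intros)
    then show "\<forall>\<^sub>F n in sequentially. continuous_on UNIV (\<lambda>x. \<Sum>j<n. H q j x)"
      by (intro always_eventually allI continuous_on_sum) auto
  qed auto
  have holder: "holder_continuous (frac \<beta>) (S q)" if "0 < frac \<beta>"
  proof -
    have q: "0 < 2 * m - 1 - q" "2 * m - 1 - q < 2 * m"
      using qm by linarith+
    obtain K where K: "0 \<le> K" "\<And>j x. \<bar>H q j x\<bar> \<le> K * (2 ^ q * \<rho>) ^ j" using H_bound[of q] by blast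
    obtain L where L: "0 \<le> L" "\<And>x y. \<bar>spline m (2 * m - 1 - q) x - spline m (2 * m - 1 - q) y\<bar> \<le> L * \<bar>x - y\<bar>"
      using spline_Lipschitz q by blast
    \<comment> \<open>The maximum lets the size bound and the Lipschitz bound share one constant, so
      that they combine to min 1 t with t = 2^j |x - y|.\<close>
    define K' where "K' = max (2 * K) (2 * (2 * real m + 1) * (L * C))"
    have "0 \<le> K'" using K by (simp add: K'_def)
    have geo: "2 ^ q * \<rho> * 2 powr frac \<beta> < 1"
      using \<rho> \<beta>q by (metis mult.assoc mult.commute powr_add powr_realpow zero_less_numeral)
    have incr: "\<bar>H q j x - H q j y\<bar> \<le> K' * (2 ^ q * \<rho> * 2 powr frac \<beta>) ^ j * \<bar>x - y\<bar> powr frac \<beta>" for j x y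
    proof -
      let ?t = "2 ^ j * \<bar>x - y\<bar>"
      have "\<bar>H q j x - H q j y\<bar> \<le> 2 * K * (2 ^ q * \<rho>) ^ j"
        using K(2)[of j x] K(2)[of j y] by linarith
      also have "\<dots> \<le> K' * (2 ^ q * \<rho>) ^ j"
        using \<rho> by (intro mult_right_mono) (auto simp: K'_def)
      finally have b1: "\<bar>H q j x - H q j y\<bar> \<le> K' * (2 ^ q * \<rho>) ^ j" .
      have "\<bar>act (d j) (spline m (2 * m - 1 - q)) (2 ^ j * x) - act (d j) (spline m (2 * m - 1 - q)) (2 ^ j * y)\<bar>
          \<le> 2 * (2 * real m + 1) * (L * (C * \<rho> ^ j) * \<bar>2 ^ j * x - 2 ^ j * y\<bar>)"
        using d L q by (intro act_local_Lipschitz) (auto intro: spline_eq_zero)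
      moreover have "\<bar>2 ^ j * x - 2 ^ j * y\<bar> = ?t"
        by (simp flip: right_diff_distrib add: abs_mult)
      ultimately have "(2 ^ q) ^ j * \<bar>act (d j) (spline m (2 * m - 1 - q)) (2 ^ j * x) - act (d j) (spline m (2 * m - 1 - q)) (2 ^ j * y)\<bar>
          \<le> (2 ^ q) ^ j * (2 * (2 * real m + 1) * (L * (C * \<rho> ^ j) * ?t))"
        by (intro mult_left_mono) auto
      then have "\<bar>H q j x - H q j y\<bar> \<le> 2 * (2 * real m + 1) * (L * C) * ((2 ^ q * \<rho>) ^ j * ?t)"
        unfolding H_def right_diff_distrib[symmetric] by (simp add: abs_mult power_mult_distrib mult_ac)
      also have "\<dots> \<le> K' * ((2 ^ q * \<rho>) ^ j * ?t)"
        using \<rho> by (intro mult_right_mono) (auto simp: K'_def)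
      finally have "\<bar>H q j x - H q j y\<bar> \<le> K' * (2 ^ q * \<rho>) ^ j * min 1 ?t"
        using b1 by (simp add: min_def mult.assoc)
      also have "\<dots> \<le> K' * (2 ^ q * \<rho>) ^ j * ?t powr frac \<beta>"
        using \<open>0 \<le> K'\<close> \<rho> that frac_lt_1[of \<beta>]
        by (intro mult_left_mono min_le_powr) (auto simp: less_imp_le)
      also have "?t powr frac \<beta> = (2 powr frac \<beta>) ^ j * \<bar>x - y\<bar> powr frac \<beta>"
        by (simp add: powr_mult powr_nat_mult[symmetric] powr_realpow[symmetric] powr_powr)
      finally show ?thesis by (simp add: power_mult_distrib mult_ac)
    qed
    define G where "G = suminf (\<lambda>j. K' * (2 ^ q * \<rho> * 2 powr frac \<beta>) ^ j)"
    have sumG: "summable (\<lambda>j. K' * (2 ^ q * \<rho> * 2 powr frac \<beta>) ^ j)"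
      using geo \<rho> by (intro summable_mult summable_geometric) (simp add: abs_mult)
    have "\<bar>S q x - S q y\<bar> \<le> G * \<bar>x - y\<bar> powr frac \<beta>" for x y
    proof -
      have "S q x - S q y = suminf (\<lambda>j. H q j x - H q j y)"
        unfolding S_def by (rule suminf_diff) (auto intro: H_summable)
      also have "norm \<dots> \<le> suminf (\<lambda>j. K' * (2 ^ q * \<rho> * 2 powr frac \<beta>) ^ j * \<bar>x - y\<bar> powr frac \<beta>)"
        using incr[of _ x y] by (intro norm_suminf_le summable_mult2 sumG) auto
      also have "\<dots> = G * \<bar>x - y\<bar> powr frac \<beta>"
        unfolding G_def by (rule suminf_mult2[symmetric]) (rule sumG)
      finally show ?thesis by simp
    qed
    then show ?thesis unfolding holder_continuous_def by blast
  qed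
  have S0: "S 0 = (\<lambda>x. suminf (\<lambda>j. act (d j) (spline m (2 * m - 1)) (2 ^ j * x)))"
    by (simp add: S_def[abs_def] H_def)
  show "(\<lambda>x. suminf (\<lambda>j. act (d j) (spline m (2 * m - 1)) (2 ^ j * x))) \<in> holder_class \<beta>"
    unfolding S0[symmetric] by (rule holder_classI[OF q_def[symmetric] S_deriv cont holder])
  show "(\<lambda>j. act (d j) (spline m (2 * m - 1)) (2 ^ j * x)) sums
      suminf (\<lambda>j. act (d j) (spline m (2 * m - 1)) (2 ^ j * x))"
    using H_summable[of 0 x] by (simp add: H_def summable_sums)
qed

section \<open>Decay of differences implies regularity\<close>

lemma dil_power: "dil N (F ^ n) = dil N F ^ n"
  by (rule dil.eval_power)

text \<open>Converts an error divisible by (1 - z)^(2m), after smoothing by \<open>sigma\<close>,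
  into 2m-th differences of the coarser level.\<close>

lemma sigma_power_mult_one_minus_Z_power:
  "sigma ^ m * (1 - Z) ^ (2 * m) = single (-1) (1/4) ^ m * dil 2 ((1 - Z) ^ (2 * m))"
  unfolding sigma_def dil_power dil_two_one_minus_Z
  by (simp only: power_mult_distrib power_mult[symmetric] mult_ac)

lemma one_minus_Z_power_eq_delta_power: "(1 - Z) ^ (2 * m) = (- 4 * Z) ^ m * delta ^ m"
proof -
  have "- 4 * Z * delta = - (Z * (4 * delta))"
    by (simp add: mult_ac)
  also have "\<dots> = Z * (single (-1) 1 * (1 - Z)\<^sup>2)"
    unfolding four_delta by simp
  also have "\<dots> = (1 - Z)\<^sup>2"
    using Z_mult_Zinv by (simp add: mult.assoc[symmetric] mult.commute[of Z])
  finally show ?thesis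
    by (simp only: power_mult power_mult_distrib[symmetric])
qed

lemma abs_lookup_one_minus_Z_mult_le:
  assumes "\<And>k. \<bar>lookup F k\<bar> \<le> E"
  shows "\<bar>lookup ((1 - Z) * F) k\<bar> \<le> 2 * E"
  using assms[of k] assms[of "k - 1"]
  by (simp add: left_diff_distrib lookup_minus lookup_single_mult)

text \<open>One factor \<open>sigma\<close> turns 2 (1 - z) sigma(z) into (1 + z)(1 - z^2) / (2z);
  the other m - 1 only average. The series in z^2 has no odd coefficients, so the factor 1 + z never
  adds two nonzero terms and the 1/2 survives.\<close>

lemma spline_scheme_contraction:
  assumes m: "1 \<le> m" and U: "\<And>k. \<bar>lookup ((1 - Z) * c) k\<bar> \<le> U"
  shows "\<bar>lookup ((1 - Z) * (2 * sigma ^ m * dil 2 c)) k\<bar> \<le> U / 2"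
proof -
  let ?e = "dil 2 ((1 - Z) * c)"
  have "sigma ^ m = sigma ^ (m - 1) * sigma"
    using m by (metis power_minus_mult less_eq_Suc_le One_nat_def)
  then have "(1 - Z) * (2 * sigma ^ m * dil 2 c) =
      sigma ^ (m - 1) * (2 * single (-1) (1/4) * (1 + Z) * ?e)"
    unfolding dil.eval_mult dil_two_one_minus_Z
    by (simp add: sigma_def power2_eq_square mult_ac)
  also have "2 * single (-1) (1/4) = single (-1) (1/2)"
    using mult_single[of 0 "2::real" "- 1 :: int" "1/4"] by simp
  finally have eq: "(1 - Z) * (2 * sigma ^ m * dil 2 c) = sigma ^ (m - 1) * (single (-1) (1/2) * (1 + Z) * ?e)" .
  have "\<bar>lookup (single (-1) (1/2) * (1 + Z) * ?e) k\<bar> \<le> U / 2" for k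
  proof -
    have "lookup (single (-1) (1/2) * (1 + Z) * ?e) k = (lookup ?e (k + 1) + lookup ?e k) / 2"
      by (simp add: mult.assoc lookup_single_mult distrib_right lookup_add)
    moreover have "lookup ?e (k + 1) = 0 \<or> lookup ?e k = 0"
      by (auto simp: lookup_dil)
    moreover have "\<bar>lookup ?e (k + 1)\<bar> \<le> U" "\<bar>lookup ?e k\<bar> \<le> U"
      using U by (auto intro!: abs_lookup_dil_le)
    ultimately show ?thesis by auto
  qed
  then show ?thesis
    unfolding eq by (rule abs_lookup_sigma_power_le)
qed

text \<open>With a rate of at least 3/4 the gap to the contraction factor 1/2 is at least 1/4, so
  the constant 4C absorbs the forcing term even when \<rho> is 1/2 or less.\<close>

lemma halving_recurrence_bound:
  fixes u :: "nat \<Rightarrow> int \<Rightarrow> real"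
  assumes step: "\<And>n U k. (\<And>k. \<bar>u n k\<bar> \<le> U) \<Longrightarrow> \<bar>u (Suc n) k\<bar> \<le> U / 2 + C * \<rho> ^ n"
    and "\<And>k. \<bar>u 0 k\<bar> \<le> U0" "0 \<le> C" "0 \<le> \<rho>" "\<rho> \<le> \<theta>" "3 / 4 \<le> \<theta>"
  shows "\<bar>u n k\<bar> \<le> max U0 (4 * C) * \<theta> ^ n"
proof (induction n arbitrary: k)
  case 0
  then show ?case using assms(2)[of k] by simp
next
  case (Suc n)
  let ?K = "max U0 (4 * C)"
  have "\<bar>u (Suc n) k\<bar> \<le> ?K * \<theta> ^ n / 2 + C * \<rho> ^ n"
    by (rule step) (rule Suc)
  also have "C * \<rho> ^ n \<le> C * \<theta> ^ n"
    using assms by (intro mult_left_mono power_mono) auto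
  also have "C * \<theta> ^ n \<le> (?K * (\<theta> - 1 / 2)) * \<theta> ^ n"
  proof (intro mult_right_mono)
    have "C \<le> ?K * (1 / 4)" by simp
    also have "\<dots> \<le> ?K * (\<theta> - 1 / 2)" using assms by (intro mult_left_mono) auto
    finally show "C \<le> ?K * (\<theta> - 1 / 2)" .
  qed (use assms in simp)
  also have "?K * \<theta> ^ n / 2 + (?K * (\<theta> - 1 / 2)) * \<theta> ^ n = ?K * \<theta> ^ Suc n"
    by (simp add: algebra_simps)
  finally show ?case by simp
qed

lemma abs_lookup_le_l1_norm: "\<bar>lookup F k\<bar> \<le> l1_norm F"
proof (cases "k \<in> keys F")
  case True
  then show ?thesis unfolding l1_norm_def
    by (intro member_le_sum[of k "keys F" "\<lambda>k. \<bar>lookup F k\<bar>"]) auto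
next
  case False
  then show ?thesis using l1_norm_nonneg by (simp add: in_keys_iff)
qed

definition growth_exponent :: "laurent_poly \<Rightarrow> real \<Rightarrow> bool"
  where "growth_exponent b s \<longleftrightarrow>
    (\<exists>C. \<forall>n. lookup (iter_symbol b n) 0 \<le> C * 2 powr (real n * s))"

text \<open>The setting of the direct half. The lower bound on b enters with
  \<open>large_symbol\<close>, for the converse and for nonnegativity of growth exponents.\<close>

locale nonneg_symbol =
  fixes m :: nat and b :: laurent_poly
  assumes m_pos: "1 \<le> m" and b_one: "at_one b = 1" and b_nonneg: "circle_nonneg b"
begin

abbreviation a :: laurent_poly
  where "a \<equiv> 2 * sigma ^ m * b"

definition refined :: "laurent_poly \<Rightarrow> nat \<Rightarrow> laurent_poly"
  where "refined F n = iter_symbol a n * dil (2 ^ n) F"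

lemma refined_Suc: "refined F (Suc n) = a * dil 2 (refined F n)"
  by (simp add: refined_def dil.eval_mult dil_dil mult_ac)

lemma refined_difference_bound:
  assumes "growth_exponent b s"
  obtains C where "0 \<le> C"
    "\<And>n k. \<bar>lookup ((1 - Z) ^ (2 * m) * refined F n) k\<bar> \<le> C * (2 powr (s - (2 * real m - 1))) ^ n"
proof -
  obtain K where K: "\<And>n. lookup (iter_symbol b n) 0 \<le> K * 2 powr (real n * s)"
    using assms by (auto simp: growth_exponent_def)
  \<comment> \<open>The rate collects 2 / 4^m per step from \<open>delta_power_iter_symbol\<close>
    and 2^s from the growth of the product of the b(z^(2^j)).\<close>
  define \<rho> where "\<rho> = 2 powr (s - (2 * real m - 1))"
  define L where "L = l1_norm (delta ^ m * F)"
  have "0 \<le> K"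
    using K[of 0] by simp
  have delta: "\<bar>lookup (delta ^ m * refined F n) k\<bar> \<le> L * K * \<rho> ^ n" for n k
  proof -
    have "4 ^ (n * m) * (delta ^ m * refined F n) =
        4 ^ (n * m) * (delta ^ m * iter_symbol a n) * dil (2 ^ n) F"
      by (simp add: refined_def mult_ac)
    also have "\<dots> = 2 ^ n * (dil (2 ^ n) (delta ^ m * F) * iter_symbol b n)"
      unfolding delta_power_iter_symbol by (simp add: dil.eval_mult mult_ac)
    finally have "4 ^ (n * m) * lookup (delta ^ m * refined F n) k =
        2 ^ n * lookup (dil (2 ^ n) (delta ^ m * F) * iter_symbol b n) k"
      by (metis lookup_numeral_power_mult)
    then have "4 ^ (n * m) * \<bar>lookup (delta ^ m * refined F n) k\<bar> =
        2 ^ n * \<bar>lookup (dil (2 ^ n) (delta ^ m * F) * iter_symbol b n) k\<bar>"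
      by (metis abs_mult abs_numeral power_abs)
    moreover have "\<bar>lookup (dil (2 ^ n) (delta ^ m * F) * iter_symbol b n) k\<bar> \<le>
        l1_norm (dil (2 ^ n) (delta ^ m * F)) * lookup (iter_symbol b n) 0"
      by (intro abs_lookup_mult_le abs_lookup_le_zero_coeff circle_nonneg_iter_symbol b_nonneg)
    moreover have "\<dots> \<le> L * (K * 2 powr (real n * s))"
      using K[of n] l1_norm_nonneg by (simp add: L_def l1_norm_dil mult_left_mono)
    ultimately have "4 ^ (n * m) * \<bar>lookup (delta ^ m * refined F n) k\<bar> \<le> 2 ^ n * (L * (K * 2 powr (real n * s)))"
      by (simp only:) (intro mult_left_mono, simp_all)
    then have "\<bar>lookup (delta ^ m * refined F n) k\<bar> \<le> L * K * (2 ^ n * 2 powr (real n * s) / 4 ^ (n * m))"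
      by (simp add: field_simps)
    also have "2 ^ n * 2 powr (real n * s) / 4 ^ (n * m) = \<rho> ^ n"
    proof -
      have "(4::real) ^ (n * m) = 2 ^ (2 * (n * m))"
        by (simp add: power_mult)
      also have "\<dots> = 2 powr (2 * real n * real m)"
        by (subst powr_realpow[symmetric]) (simp_all add: mult_ac)
      finally show ?thesis
        by (simp add: \<rho>_def powr_realpow[symmetric] powr_powr powr_add[symmetric] powr_diff[symmetric] algebra_simps)
    qed
    finally show ?thesis .
  qed
  have "\<bar>lookup ((1 - Z) ^ (2 * m) * refined F n) k\<bar> \<le> l1_norm ((- 4 * Z) ^ m) * (L * K * \<rho> ^ n)" for n k
    unfolding one_minus_Z_power_eq_delta_power mult.assoc[of "(- 4 * Z) ^ m"]
    by (rule abs_lookup_mult_le) (rule delta)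
  then show ?thesis
    using that[of "l1_norm ((- 4 * Z) ^ m) * (L * K)"] l1_norm_nonneg \<open>0 \<le> K\<close>
    by (simp add: \<rho>_def L_def mult.assoc)
qed

text \<open>The coefficients \<open>q F\<^sub>n\<close> evolve by B-spline subdivision up to an error \<open>d\<^sub>n\<^sub>+\<^sub>1\<close> made of
  \<open>2m\<close>-th differences, which turns the limit function into a multiscale series of B-splines.\<close>

lemma refined_spline_series:
  assumes s: "growth_exponent b s" "0 \<le> s" "s < 2 * real m - 1"
  defines "\<rho> \<equiv> 2 powr (s - (2 * real m - 1))"
  obtains d C where "\<And>j k. \<bar>lookup (d j) k\<bar> \<le> C * \<rho> ^ j"
    "\<And>x. (\<lambda>n. linear_interpolant n (lookup (refined F n)) x -
        (\<Sum>j\<le>n. act (d j) (spline m (2 * m - 1)) (2 ^ j * x))) \<longlonglongrightarrow> 0"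
proof -
  let ?N = "spline m (2 * m - 1)"
  have \<rho>: "0 < \<rho>" "\<rho> < 1"
    using s by (auto simp: \<rho>_def powr_less_one)
  have "Suc (2 * m - 1) = 2 * m" using m_pos by simp
  then obtain q R where q: "at_one q = 1" "q * b - dil 2 q = (1 - Z) ^ (2 * m) * R"
    using refinement_correction_exists[OF b_one, of "2 * m - 1"] by (metis dvdE)
  obtain C where C: "0 \<le> C" "\<And>n k. \<bar>lookup ((1 - Z) ^ (2 * m) * refined F n) k\<bar> \<le> C * \<rho> ^ n"
    using refined_difference_bound[OF s(1)] unfolding \<rho>_def by blast
  define c where "c n = q * refined F n" for n
  \<comment> \<open>Collects everything in the error that does not depend on n, so that e n is a
    fixed filter applied to 2m-th differences of level n.\<close>
  define w where "w = 2 * single (-1) (1/4) ^ m * R"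
  define e where "e n = w * dil 2 ((1 - Z) ^ (2 * m) * refined F n)" for n
  have c_Suc: "c (Suc n) = 2 * sigma ^ m * dil 2 (c n) + e n" for n
  proof -
    have "c (Suc n) - 2 * sigma ^ m * dil 2 (c n) = 2 * sigma ^ m * (q * b - dil 2 q) * dil 2 (refined F n)"
      by (simp add: c_def refined_Suc dil.eval_mult algebra_simps)
    also have "\<dots> = 2 * R * (sigma ^ m * (1 - Z) ^ (2 * m)) * dil 2 (refined F n)"
      unfolding q(2) by (simp only: mult_ac)
    also have "\<dots> = e n"
      unfolding sigma_power_mult_one_minus_Z_power by (simp add: e_def w_def dil.eval_mult mult_ac)
    finally show ?thesis by (simp add: algebra_simps)
  qed
  have e: "\<bar>lookup (e n) k\<bar> \<le> l1_norm w * C * \<rho> ^ n" for n k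
    unfolding e_def mult.assoc[of "l1_norm w"]
    by (intro abs_lookup_mult_le abs_lookup_dil_le C) simp
  define C1 where "C1 = l1_norm w * C"
  have "0 \<le> C1" using C l1_norm_nonneg by (simp add: C1_def)
  \<comment> \<open>First differences decay no faster than the contraction 1/2 of the B-spline
    scheme, however small \<rho> is; 3/4 is the margin required by
    \<open>halving_recurrence_bound\<close>.\<close>
  define \<theta> where "\<theta> = max \<rho> (3 / 4)"
  have \<theta>: "0 < \<theta>" "\<theta> < 1" "\<rho> \<le> \<theta>" using \<rho> by (auto simp: \<theta>_def)
  define K where "K = max (l1_norm ((1 - Z) * c 0)) (4 * (2 * C1))"
  have K: "\<bar>lookup ((1 - Z) * c n) k\<bar> \<le> K * \<theta> ^ n" for n k
    unfolding K_def
  proof (rule halving_recurrence_bound[where \<rho> = \<rho>])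
    fix n U k assume "\<And>k. \<bar>lookup ((1 - Z) * c n) k\<bar> \<le> U"
    then have "\<bar>lookup ((1 - Z) * (2 * sigma ^ m * dil 2 (c n))) k\<bar> \<le> U / 2"
      by (rule spline_scheme_contraction[OF m_pos])
    moreover have "\<bar>lookup ((1 - Z) * e n) k\<bar> \<le> 2 * (C1 * \<rho> ^ n)"
      using e unfolding C1_def by (rule abs_lookup_one_minus_Z_mult_le)
    ultimately show "\<bar>lookup ((1 - Z) * c (Suc n)) k\<bar> \<le> U / 2 + 2 * C1 * \<rho> ^ n"
      unfolding c_Suc distrib_left lookup_add by linarith
  qed (use \<open>0 \<le> C1\<close> \<rho> in \<open>auto simp: \<theta>_def abs_lookup_le_l1_norm\<close>)
  have "1 - Z dvd 1 - q"
    by (rule one_minus_Z_dvd) (simp add: at_one.eval_diff at_one.eval_one q)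
  then obtain v where v: "1 - q = (1 - Z) * v" by (elim dvdE)
  \<comment> \<open>A truncated geometric series: r inverts q modulo (1 - q)^(2m), hence modulo (1 -
    z)^(2m). It recovers the data from c n up to 2m-th differences.\<close>
  define r where "r = (\<Sum>i<2 * m. (1 - q) ^ i)"
  have F_eq: "refined F n = r * c n + v ^ (2 * m) * ((1 - Z) ^ (2 * m) * refined F n)" for n
  proof -
    have "q * r = 1 - (1 - q) ^ (2 * m)"
      using one_diff_power_eq[of "1 - q" "2 * m"] by (simp add: r_def)
    then have "refined F n = (q * r + (1 - q) ^ (2 * m)) * refined F n" by simp
    also have "\<dots> = r * c n + v ^ (2 * m) * ((1 - Z) ^ (2 * m) * refined F n)"
      unfolding v power_mult_distrib c_def distrib_right by (simp only: mult_ac)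
    finally show ?thesis .
  qed
  define K1 where "K1 = l1_norm r * K + 2 * (l1_norm (v ^ (2 * m)) * C)"
  have \<rho>\<theta>: "l1_norm G * (C * \<rho> ^ n) \<le> l1_norm G * C * \<theta> ^ n" for G n
    using \<rho> \<theta> C l1_norm_nonneg[of G] by (simp add: mult.assoc mult_left_mono power_mono)
  have \<Delta>: "\<bar>lookup ((1 - Z) * refined F n) k\<bar> \<le> K1 * \<theta> ^ n" for n k
  proof -
    have eq: "(1 - Z) * refined F n = r * ((1 - Z) * c n) +
        (1 - Z) * (v ^ (2 * m) * ((1 - Z) ^ (2 * m) * refined F n))"
      by (subst F_eq) (simp add: algebra_simps)
    have "\<bar>lookup (r * ((1 - Z) * c n)) k\<bar> \<le> l1_norm r * (K * \<theta> ^ n)"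
      by (rule abs_lookup_mult_le) (rule K)
    moreover have "\<bar>lookup ((1 - Z) * (v ^ (2 * m) * ((1 - Z) ^ (2 * m) * refined F n))) k\<bar>
        \<le> 2 * (l1_norm (v ^ (2 * m)) * (C * \<rho> ^ n))"
      by (intro abs_lookup_one_minus_Z_mult_le abs_lookup_mult_le C)
    moreover have "K1 * \<theta> ^ n = l1_norm r * (K * \<theta> ^ n) + 2 * (l1_norm (v ^ (2 * m)) * C * \<theta> ^ n)"
      by (simp add: K1_def algebra_simps)
    ultimately show ?thesis
      using \<rho>\<theta>[of "v ^ (2 * m)" n] unfolding eq lookup_add by linarith
  qed
  have near_c: "\<bar>lookup (refined F n) k - lookup (c n) k\<bar> \<le> l1_norm v * K1 * \<theta> ^ n" for n k
  proof -
    have "refined F n - c n = v * ((1 - Z) * refined F n)"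
    proof -
      have "refined F n - c n = (1 - q) * refined F n"
        by (simp add: c_def left_diff_distrib)
      then show ?thesis
        unfolding v by (simp only: mult_ac)
    qed
    then have "lookup (refined F n) k - lookup (c n) k = lookup (v * ((1 - Z) * refined F n)) k"
      by (metis lookup_minus)
    then show ?thesis
      using abs_lookup_mult_le[OF \<Delta>, of v n k] by (simp add: mult.assoc)
  qed
  obtain M where M: "0 \<le> M" "\<And>c D x. (\<And>k. \<bar>lookup ((1 - Z) * c) k\<bar> \<le> D) \<Longrightarrow>
      \<bar>act c ?N x - lookup c \<lfloor>x\<rfloor>\<bar> \<le> M * D"
    using act_spline_near_coeff[OF m_pos] by blast
  \<comment> \<open>The error e n is built from data of level n but lives on level n + 1; this shift
    of index is the origin of the division by \<rho> in the final constant.\<close>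
  define d where "d j = (case j of 0 \<Rightarrow> c 0 | Suc n \<Rightarrow> e n)" for j
  have telescope: "act (c n) ?N (2 ^ n * x) = (\<Sum>j\<le>n. act (d j) ?N (2 ^ j * x))" for n x
  proof (induction n)
    case (Suc n)
    have "act (c (Suc n)) ?N (2 ^ Suc n * x) =
        act (2 * sigma ^ m * dil 2 (c n)) ?N (2 * (2 ^ n * x)) + act (e n) ?N (2 ^ Suc n * x)"
      by (simp add: c_Suc act_add mult.assoc)
    also have "act (2 * sigma ^ m * dil 2 (c n)) ?N (2 * (2 ^ n * x)) = act (c n) ?N (2 ^ n * x)"
      by (rule act_spline_refine[OF m_pos])
    finally show ?case using Suc by (simp add: d_def)
  qed (simp add: d_def)
  \<comment> \<open>The three constants account for linear interpolation, for passing from the data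
    to c n, and for passing from the coefficients c n to the spline they generate.\<close>
  have close: "\<bar>linear_interpolant n (lookup (refined F n)) x - (\<Sum>j\<le>n. act (d j) ?N (2 ^ j * x))\<bar>
      \<le> (K1 + l1_norm v * K1 + M * K) * \<theta> ^ n" for n x
  proof -
    let ?k = "\<lfloor>2 ^ n * x\<rfloor>" and ?t = "frac (2 ^ n * x)"
    have "linear_interpolant n (lookup (refined F n)) x - lookup (refined F n) ?k =
        ?t * lookup ((1 - Z) * refined F n) (?k + 1)"
      by (simp add: linear_interpolant_def left_diff_distrib lookup_minus lookup_single_mult algebra_simps)
    also have "\<bar>\<dots>\<bar> \<le> 1 * (K1 * \<theta> ^ n)"
      unfolding abs_mult using \<Delta>[of n "?k + 1"] frac_lt_1[of "2 ^ n * x"]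
      by (intro mult_mono) (auto simp: less_imp_le)
    finally have "\<bar>linear_interpolant n (lookup (refined F n)) x - lookup (refined F n) ?k\<bar> \<le> K1 * \<theta> ^ n"
      by simp
    moreover have "\<bar>act (c n) ?N (2 ^ n * x) - lookup (c n) ?k\<bar> \<le> M * (K * \<theta> ^ n)"
      by (rule M(2)) (rule K)
    moreover have "(K1 + l1_norm v * K1 + M * K) * \<theta> ^ n =
        K1 * \<theta> ^ n + l1_norm v * K1 * \<theta> ^ n + M * (K * \<theta> ^ n)"
      by (simp add: algebra_simps)
    ultimately show ?thesis
      using near_c[of n ?k] unfolding telescope[symmetric] by linarith
  qed
  have "(\<lambda>n. linear_interpolant n (lookup (refined F n)) x -
        (\<Sum>j\<le>n. act (d j) ?N (2 ^ j * x))) \<longlonglongrightarrow> 0" for x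
  proof (rule Lim_null_comparison)
    show "(\<lambda>n. (K1 + l1_norm v * K1 + M * K) * \<theta> ^ n) \<longlonglongrightarrow> 0"
      using \<theta> by (intro tendsto_mult_right_zero LIMSEQ_power_zero) simp
  qed (use close in simp)
  moreover have "\<bar>lookup (d j) k\<bar> \<le> max (l1_norm (c 0)) (C1 / \<rho>) * \<rho> ^ j" for j k
  proof (cases j)
    case 0
    then show ?thesis using abs_lookup_le_l1_norm[of "c 0" k] by (simp add: d_def)
  next
    case (Suc n)
    then have "\<bar>lookup (d j) k\<bar> \<le> C1 / \<rho> * \<rho> ^ j"
      using e[of n k] \<rho> by (simp add: d_def C1_def)
    also have "\<dots> \<le> max (l1_norm (c 0)) (C1 / \<rho>) * \<rho> ^ j"
      using \<rho> by (intro mult_right_mono) auto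
    finally show ?thesis .
  qed
  ultimately show ?thesis using that by blast
qed

theorem convergent_and_regular:
  assumes s: "growth_exponent b s" "0 \<le> s" and \<beta>: "0 \<le> \<beta>" "\<beta> < 2 * real m - 1 - s"
    and f0: "f0 \<in> initial_data"
  shows "convergent (\<lambda>j. linear_interpolant j (subdivision a f0 j) x)"
    and "limit_function a f0 \<in> holder_class \<beta>"
proof -
  let ?N = "spline m (2 * m - 1)"
  obtain F where F: "f0 = lookup F"
    using f0 unfolding lookup_range_initial_data by blast
  define \<rho> where "\<rho> = (2::real) powr (s - (2 * real m - 1))"
  obtain d C where d: "\<And>j k. \<bar>lookup (d j) k\<bar> \<le> C * \<rho> ^ j"
    and lim: "\<And>x. (\<lambda>n. linear_interpolant n (lookup (refined F n)) x -
        (\<Sum>j\<le>n. act (d j) ?N (2 ^ j * x))) \<longlonglongrightarrow> 0"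
    using refined_spline_series[OF s, of F] \<beta> unfolding \<rho>_def by auto
  have "2 powr \<beta> * \<rho> < 1"
    using \<beta> by (simp add: \<rho>_def powr_add[symmetric] powr_less_one)
  note series = spline_series_holder[OF m_pos d _ this \<beta>(1)]
  have "subdivision a f0 = (\<lambda>n. lookup (refined F n))"
    by (simp add: fun_eq_iff F subdivision_lookup refined_def)
  moreover have "(\<lambda>n. linear_interpolant n (lookup (refined F n)) x) \<longlonglongrightarrow>
      suminf (\<lambda>j. act (d j) ?N (2 ^ j * x))" for x
  proof -
    have "(\<lambda>n. \<Sum>j\<le>n. act (d j) ?N (2 ^ j * x)) \<longlonglongrightarrow> suminf (\<lambda>j. act (d j) ?N (2 ^ j * x))"
      using series(1) \<beta> s by (simp add: sums_def_le \<rho>_def)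
    from tendsto_add[OF lim[of x] this] show ?thesis by simp
  qed
  ultimately have conv: "(\<lambda>n. linear_interpolant n (subdivision a f0 n) x) \<longlonglongrightarrow>
      suminf (\<lambda>j. act (d j) ?N (2 ^ j * x))" for x by simp
  then show "convergent (\<lambda>j. linear_interpolant j (subdivision a f0 j) x)"
    by (auto simp: convergent_def)
  have "limit_function a f0 = (\<lambda>x. suminf (\<lambda>j. act (d j) ?N (2 ^ j * x)))"
    using conv by (simp add: fun_eq_iff limit_function_def limI)
  then show "limit_function a f0 \<in> holder_class \<beta>"
    using series(2) \<beta> s by (simp add: \<rho>_def)
qed

end

section \<open>Regularity implies decay of differences\<close>

text \<open>From sin x \<ge> x - x^3 / 6 and x^2 \<le> 4, as pi / 2 < 2. Squared, the constant is
  the 1/9 of \<open>cos_product_lower_bound\<close>.\<close>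

lemma sin_ge_third:
  assumes "0 \<le> x" "x \<le> pi / 2"
  shows "x / 3 \<le> sin x"
proof -
  have "\<bar>sin x - (\<Sum>n<3. sin_coeff n * x ^ n)\<bar> \<le> inverse (fact 3) * \<bar>x\<bar> ^ 3"
    by (rule Maclaurin_sin_bound)
  moreover have "(\<Sum>n<3. sin_coeff n * x ^ n) = x"
    by (simp add: sin_coeff_def numeral_3_eq_3)
  ultimately have "\<bar>sin x - x\<bar> * 6 \<le> x ^ 3"
    using assms by (simp add: fact_numeral)
  then have "x - x ^ 3 / 6 \<le> sin x"
    using abs_ge_minus_self[of "sin x - x"] by (simp add: field_simps)
  moreover have "x ^ 3 \<le> 4 * x"
  proof -
    have "x * (x * x) \<le> x * (2 * 2)"
      using assms pi_less_4 by (intro mult_left_mono mult_mono) auto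
    then show ?thesis by (simp add: power3_eq_cube mult_ac)
  qed
  ultimately show ?thesis by linarith
qed

text \<open>Telescoping the double-angle formula in \<open>\<Prod>\<^sub>j cos (\<xi> / 2\<^sup>j\<^sup>+\<^sup>1)\<close> gives a lower bound that is uniform in \<open>r\<close>.\<close>

lemma cos_product_lower_bound:
  fixes \<Phi> :: "nat \<Rightarrow> real \<Rightarrow> real"
  assumes "\<And>\<xi>. 1 \<le> \<Phi> 0 \<xi>"
    and step: "\<And>r \<xi>. (cos (\<xi> / 4))\<^sup>2 ^ m * \<Phi> r (\<xi> / 2) \<le> \<Phi> (Suc r) \<xi>"
    and nonneg: "\<And>r \<xi>. 0 \<le> \<Phi> r \<xi>" and "\<bar>\<xi>\<bar> \<le> pi"
  shows "(1 / 9) ^ m \<le> \<Phi> r \<xi>"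
proof (cases "\<xi> = 0")
  case True
  have "1 \<le> \<Phi> r 0"
  proof (induction r)
    case (Suc r)
    then show ?case using step[of 0 r] by simp
  qed (rule assms(1))
  moreover have "(1 / 9) ^ m \<le> (1::real)" by (rule power_le_one) auto
  ultimately show ?thesis using True by simp
next
  case False
  have *: "(sin (\<xi> / 2))\<^sup>2 ^ m \<le> \<Phi> r \<xi> * (2 ^ r * sin (\<xi> / 2 ^ Suc r))\<^sup>2 ^ m" for r \<xi>
  proof (induction r arbitrary: \<xi>)
    case 0
    have "1 * (sin (\<xi> / 2))\<^sup>2 ^ m \<le> \<Phi> 0 \<xi> * (sin (\<xi> / 2))\<^sup>2 ^ m"
      by (intro mult_right_mono assms(1)) simp
    then show ?case by simp
  next
    case (Suc r)
    have "sin (\<xi> / 2) = 2 * sin (\<xi> / 4) * cos (\<xi> / 4)"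
      using sin_double[of "\<xi> / 4"] by simp
    then have "(sin (\<xi> / 2))\<^sup>2 ^ m = (2 * cos (\<xi> / 4))\<^sup>2 ^ m * (sin (\<xi> / 2 / 2))\<^sup>2 ^ m"
      by (simp add: power_mult_distrib mult_ac)
    also have "\<dots> \<le> (2 * cos (\<xi> / 4))\<^sup>2 ^ m * (\<Phi> r (\<xi> / 2) * (2 ^ r * sin (\<xi> / 2 / 2 ^ Suc r))\<^sup>2 ^ m)"
      by (intro mult_left_mono Suc) simp
    also have "\<dots> = ((cos (\<xi> / 4))\<^sup>2 ^ m * \<Phi> r (\<xi> / 2)) * (2 ^ Suc r * sin (\<xi> / 2 ^ Suc (Suc r)))\<^sup>2 ^ m"
      by (simp add: power_mult_distrib mult_ac)
    also have "\<dots> \<le> \<Phi> (Suc r) \<xi> * (2 ^ Suc r * sin (\<xi> / 2 ^ Suc (Suc r)))\<^sup>2 ^ m"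
      by (intro mult_right_mono step) simp
    finally show ?case .
  qed
  \<comment> \<open>The sine left over at the finest scale is bounded by |xi| / 2 uniformly in r,
    while the one at the coarsest scale is at least |xi| / 6.\<close>
  have "\<bar>2 ^ r * sin (\<xi> / 2 ^ Suc r)\<bar> \<le> \<bar>\<xi>\<bar> / 2"
    using abs_sin_x_le_abs_x[of "\<xi> / 2 ^ Suc r"] by (simp add: abs_mult field_simps)
  then have "(2 ^ r * sin (\<xi> / 2 ^ Suc r))\<^sup>2 \<le> (\<xi> / 2)\<^sup>2"
    by (simp add: abs_le_square_iff[symmetric])
  then have upper: "(2 ^ r * sin (\<xi> / 2 ^ Suc r))\<^sup>2 ^ m \<le> (\<xi> / 2)\<^sup>2 ^ m"
    by (rule power_mono) simp
  have "\<bar>\<xi>\<bar> / 2 / 3 \<le> sin (\<bar>\<xi>\<bar> / 2)"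
    using assms by (intro sin_ge_third) auto
  then have "(\<bar>\<xi>\<bar> / 2 / 3)\<^sup>2 \<le> (sin (\<bar>\<xi>\<bar> / 2))\<^sup>2"
    by (intro power_mono) auto
  also have "(sin (\<bar>\<xi>\<bar> / 2))\<^sup>2 = (sin (\<xi> / 2))\<^sup>2"
    by (simp add: abs_if)
  finally have "1 / 9 * (\<xi> / 2)\<^sup>2 \<le> (sin (\<xi> / 2))\<^sup>2"
    by (simp add: power_divide)
  then have "(1 / 9 * (\<xi> / 2)\<^sup>2) ^ m \<le> (sin (\<xi> / 2))\<^sup>2 ^ m"
    by (intro power_mono) auto
  then have "(1 / 9) ^ m * (\<xi> / 2)\<^sup>2 ^ m \<le> (sin (\<xi> / 2))\<^sup>2 ^ m"
    by (simp only: power_mult_distrib)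
  also have "\<dots> \<le> \<Phi> r \<xi> * (\<xi> / 2)\<^sup>2 ^ m"
    using *[of \<xi> r] mult_left_mono[OF upper nonneg[of r \<xi>]] by linarith
  finally show ?thesis
    using False by (subst (asm) mult_le_cancel_right_pos) auto
qed

section \<open>Differences of functions in a Hoelder class\<close>

lemma times_cont_differentiable_DERIV:
  assumes "times_cont_differentiable q f" "i < q"
  shows "((deriv ^^ i) f has_real_derivative (deriv ^^ Suc i) f x) (at x)"
  using assms DERIV_deriv_iff_real_differentiable
  by (auto simp: times_cont_differentiable_def differentiable_on_def)

lemma times_cont_differentiable_le:
  assumes "times_cont_differentiable q f" "p \<le> q"
  shows "times_cont_differentiable p f"
  using assms
  by (cases "p = q") (auto simp: times_cont_differentiable_def intro: differentiable_imp_continuous_on)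

text \<open>The mean value theorem trades each unit difference for one derivative. The window [l, u]
  is explicit since the derivative may be bounded only locally, and it shrinks by 1 per
  step.\<close>

lemma abs_differences_le_derivative:
  fixes D :: "nat \<Rightarrow> real \<Rightarrow> real"
  assumes "\<And>i x. i < q \<Longrightarrow> (D i has_real_derivative D (Suc i) x) (at x)"
    and "\<And>x. l \<le> x \<Longrightarrow> x \<le> u \<Longrightarrow> \<bar>D q x\<bar> \<le> K" and "l + real q \<le> x" "x \<le> u"
  shows "\<bar>act ((1 - Z) ^ q) (D 0) x\<bar> \<le> K"
  using assms
proof (induction q arbitrary: D l)
  case (Suc q)
  define E where "E i x = D i x - D i (x - 1)" for i x
  have "act ((1 - Z) ^ Suc q) (D 0) x = act ((1 - Z) ^ q) (E 0) x"
    unfolding power_Suc2 act_mult by (simp add: act_one_minus_Z[abs_def] E_def[abs_def])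
  also have "\<bar>\<dots>\<bar> \<le> K"
  proof (rule Suc.IH[of E "l + 1"])
    fix i x assume "i < q"
    then have "(D i has_real_derivative D (Suc i) y) (at y)" for y using Suc.prems by auto
    then show "(E i has_real_derivative E (Suc i) x) (at x)"
      unfolding E_def[abs_def] using DERIV_shift[of "D i" _ x "- 1"]
      by (intro DERIV_diff) auto
  next
    fix y assume y: "l + 1 \<le> y" "y \<le> u"
    obtain z where "y - 1 < z" "z < y" "D q y - D q (y - 1) = (y - (y - 1)) * D (Suc q) z"
      using MVT2[of "y - 1" y "D q" "D (Suc q)"] Suc.prems(1) by auto
    then show "\<bar>E q y\<bar> \<le> K"
      using Suc.prems(2)[of z] y by (simp add: E_def)
  qed (use Suc.prems in auto)
  finally show ?case .
qed auto

lemma abs_differences_le: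
  assumes "\<And>y. x - real n \<le> y \<Longrightarrow> y \<le> x \<Longrightarrow> \<bar>g y\<bar> \<le> K"
  shows "\<bar>act ((1 - Z) ^ n) g x\<bar> \<le> 2 ^ n * K"
  using assms
proof (induction n arbitrary: x)
  case (Suc n)
  have "\<bar>act ((1 - Z) ^ n) g x\<bar> \<le> 2 ^ n * K" "\<bar>act ((1 - Z) ^ n) g (x - 1)\<bar> \<le> 2 ^ n * K"
    by (rule Suc.IH, use Suc.prems in auto)+
  then show ?case unfolding act_one_minus_Z_power_Suc by simp
qed simp

lemma act_power_split: "p \<le> n \<Longrightarrow> act (F ^ n) g x = act (F ^ (n - p)) (act (F ^ p) g) x"
  by (simp add: act_mult[symmetric] power_add[symmetric])

lemma DERIV_funpow_scaled:
  fixes h :: real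
  assumes "times_cont_differentiable q f" "i < q"
  shows "((\<lambda>x. h ^ i * (deriv ^^ i) f (h * x)) has_real_derivative
    h ^ Suc i * (deriv ^^ Suc i) f (h * x)) (at x)"
proof -
  have "((\<lambda>x. (deriv ^^ i) f (h * x)) has_real_derivative (deriv ^^ Suc i) f (h * x) * h) (at x)"
    by (rule DERIV_chain2[OF times_cont_differentiable_DERIV[OF assms]])
       (auto intro!: derivative_eq_intros)
  from DERIV_cmult[OF this, of "h ^ i"] show ?thesis
    by (simp add: mult_ac)
qed

text \<open>Of the N differences, q become derivatives and yield a factor h each; the others cost at
  most a factor 2 each. Since h \<le> 1, one compact interval serves all steps.\<close>

lemma differences_bound_smooth:
  assumes f: "times_cont_differentiable q f" and "q \<le> N"
  obtains C where "\<And>h. 0 < h \<Longrightarrow> h \<le> 1 \<Longrightarrow> \<bar>act ((1 - Z) ^ N) (\<lambda>x. f (h * x)) R\<bar> \<le> C * h powr real q"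
proof -
  let ?B = "\<bar>R\<bar> + real N"
  have "continuous_on {- ?B..?B} ((deriv ^^ q) f)"
    using f by (auto simp: times_cont_differentiable_def intro: continuous_on_subset)
  then have "bounded ((deriv ^^ q) f ` {- ?B..?B})"
    by (intro compact_imp_bounded compact_continuous_image) auto
  then obtain K where K: "\<And>x. x \<in> {- ?B..?B} \<Longrightarrow> \<bar>(deriv ^^ q) f x\<bar> \<le> K"
    unfolding bounded_iff real_norm_def by blast
  show ?thesis
  proof
    fix h :: real assume h: "0 < h" "h \<le> 1"
    have top: "\<bar>h ^ q * (deriv ^^ q) f (h * x)\<bar> \<le> K * h powr real q" if "R - real N \<le> x" "x \<le> R" for x
    proof -
      have "\<bar>h * x\<bar> \<le> 1 * ?B"
        unfolding abs_mult using h that by (intro mult_mono) auto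
      then have "\<bar>(deriv ^^ q) f (h * x)\<bar> \<le> K"
        by (intro K) (auto simp: abs_le_iff)
      then show ?thesis
        using h by (simp add: abs_mult powr_realpow mult.commute[of K] mult_left_mono)
    qed
    have "\<bar>act ((1 - Z) ^ q) (\<lambda>x. h ^ 0 * (deriv ^^ 0) f (h * x)) y\<bar> \<le> K * h powr real q"
      if "R - real (N - q) \<le> y" "y \<le> R" for y
      using DERIV_funpow_scaled[OF f] top that assms
      by (intro abs_differences_le_derivative[of q "\<lambda>i x. h ^ i * (deriv ^^ i) f (h * x)" "R - real N" R]) auto
    then have "\<bar>act ((1 - Z) ^ N) (\<lambda>x. f (h * x)) R\<bar> \<le> 2 ^ (N - q) * (K * h powr real q)"
      unfolding act_power_split[OF \<open>q \<le> N\<close>] by (intro abs_differences_le) auto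
    then show "\<bar>act ((1 - Z) ^ N) (\<lambda>x. f (h * x)) R\<bar> \<le> (2 ^ (N - q) * K) * h powr real q"
      by (simp add: mult.assoc)
  qed
qed

text \<open>As before, but one further difference is spent on the Hoelder increment, which requires
  q < N.\<close>

lemma differences_bound_holder:
  assumes f: "times_cont_differentiable q f" "holder_continuous \<alpha> ((deriv ^^ q) f)" and "q < N"
  obtains C where "\<And>h. 0 < h \<Longrightarrow> h \<le> 1 \<Longrightarrow> \<bar>act ((1 - Z) ^ N) (\<lambda>x. f (h * x)) R\<bar> \<le> C * h powr (real q + \<alpha>)"
proof -
  obtain K where K: "\<And>x y. \<bar>(deriv ^^ q) f x - (deriv ^^ q) f y\<bar> \<le> K * \<bar>x - y\<bar> powr \<alpha>"
    using f by (auto simp: holder_continuous_def)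
  show ?thesis
  proof
    fix h :: real assume h: "0 < h" "h \<le> 1"
    define E where "E i x = h ^ i * (deriv ^^ i) f (h * x) - h ^ i * (deriv ^^ i) f (h * (x - 1))" for i x
    have E_deriv: "(E i has_real_derivative E (Suc i) x) (at x)" if "i < q" for i x
      unfolding E_def[abs_def]
      using DERIV_funpow_scaled[OF f(1) that]
        DERIV_shift[of "\<lambda>x. h ^ i * (deriv ^^ i) f (h * x)" _ x "- 1"]
      by (intro DERIV_diff) auto
    have top: "\<bar>E q x\<bar> \<le> K * h powr (real q + \<alpha>)" for x
    proof -
      have "\<bar>E q x\<bar> = h ^ q * \<bar>(deriv ^^ q) f (h * x) - (deriv ^^ q) f (h * (x - 1))\<bar>"
        using h unfolding E_def right_diff_distrib[of "h ^ q", symmetric] by (simp add: abs_mult)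
      also have "\<dots> \<le> h ^ q * (K * \<bar>h * x - h * (x - 1)\<bar> powr \<alpha>)"
        using h by (intro mult_left_mono K) auto
      also have "\<bar>h * x - h * (x - 1)\<bar> = h" using h by (simp add: right_diff_distrib)
      finally show ?thesis using h by (simp add: powr_add powr_realpow mult_ac)
    qed
    have eq: "act ((1 - Z) ^ Suc q) (\<lambda>x. f (h * x)) = act ((1 - Z) ^ q) (E 0)"
      unfolding power_Suc2 by (intro ext) (simp add: act_mult act_one_minus_Z[abs_def] E_def[abs_def])
    have "\<bar>act ((1 - Z) ^ Suc q) (\<lambda>x. f (h * x)) y\<bar> \<le> K * h powr (real q + \<alpha>)" for y
      unfolding eq by (rule abs_differences_le_derivative[where l = "y - real q" and u = y])
        (use E_deriv top in auto)
    then have "\<bar>act ((1 - Z) ^ N) (\<lambda>x. f (h * x)) R\<bar> \<le> 2 ^ (N - Suc q) * (K * h powr (real q + \<alpha>))"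
      using act_power_split[of "Suc q" N] \<open>q < N\<close> abs_differences_le by simp
    then show "\<bar>act ((1 - Z) ^ N) (\<lambda>x. f (h * x)) R\<bar> \<le> (2 ^ (N - Suc q) * K) * h powr (real q + \<alpha>)"
      by (simp add: mult.assoc)
  qed
qed

text \<open>N differences detect no smoothness beyond order N, hence the minimum.\<close>

lemma differences_bound:
  assumes f: "f \<in> holder_class \<beta>" and "0 \<le> \<beta>"
  obtains C where "\<And>h. 0 < h \<Longrightarrow> h \<le> 1 \<Longrightarrow>
    \<bar>act ((1 - Z) ^ N) (\<lambda>x. f (h * x)) R\<bar> \<le> C * h powr (min \<beta> (real N))"
proof -
  let ?q = "nat \<lfloor>\<beta>\<rfloor>"
  have tcd: "times_cont_differentiable ?q f" and
    hol: "0 < frac \<beta> \<Longrightarrow> holder_continuous (frac \<beta>) ((deriv ^^ ?q) f)"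
    using f by (auto simp: holder_class_def)
  have \<beta>: "\<beta> = real ?q + frac \<beta>" using assms by (simp add: frac_def)
  consider "N \<le> ?q" | "?q < N" "frac \<beta> = 0" | "?q < N" "0 < frac \<beta>"
    using frac_ge_0[of \<beta>] by linarith
  then show ?thesis
  proof cases
    case 1
    then have "min \<beta> (real N) = real N" using \<beta> frac_ge_0[of \<beta>] by linarith
    then show ?thesis
      using differences_bound_smooth[OF times_cont_differentiable_le[OF tcd 1] order_refl, of R] that by metis
  next
    case 2
    then have "min \<beta> (real N) = real ?q" using \<beta> by linarith
    then show ?thesis
      using differences_bound_smooth[OF tcd less_imp_le[OF 2(1)], of R] that by metis
  next
    case 3
    then have "min \<beta> (real N) = real ?q + frac \<beta>" using \<beta> frac_lt_1[of \<beta>] by linarith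
    then show ?thesis
      using differences_bound_holder[OF tcd hol[OF 3(2)] 3(1), of R] that by metis
  qed
qed

text \<open>The lowest exponent is at least -L (1 + 2 + ... + 2^(n-1)). After decimation by 2^n this
  leaves indices from -L on, independently of n.\<close>

lemma iter_symbol_lookup_eq_zero:
  assumes b: "\<And>k. k < - int L \<Longrightarrow> lookup b k = 0" and k: "k < - int L * (2 ^ n - 1)"
  shows "lookup (iter_symbol b n) k = 0"
  using k
proof (induction n arbitrary: k)
  case 0
  then show ?case by (simp add: lookup_one)
next
  case (Suc n)
  have "lookup b l * lookup (dil 2 (iter_symbol b n)) (k - l) = 0" for l
  proof (cases "l < - int L \<or> odd (k - l)")
    case True
    then show ?thesis using b by (auto simp: lookup_dil)
  next
    case False
    then have "k - l < 2 * (- int L * (2 ^ n - 1))"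
      using Suc.prems by (simp add: algebra_simps)
    then have "(k - l) div 2 < - int L * (2 ^ n - 1)" by linarith
    then show ?thesis using Suc.IH by (simp add: lookup_dil)
  qed
  then show ?case
    unfolding iter_symbol.simps lookup_mult_keys by (intro sum.neutral ballI)
qed

text \<open>Coefficients are recovered from their differences by summation from the lowest index, which
  only involves \<open>L + 1\<close> indices up to \<open>0\<close>.\<close>

lemma abs_lookup_le_difference:
  assumes zero: "\<And>k. k < - int L \<Longrightarrow> lookup D k = 0"
    and diff: "\<And>k. k \<le> 0 \<Longrightarrow> \<bar>lookup ((1 - Z) * D) k\<bar> \<le> E" and "k \<le> 0"
  shows "\<bar>lookup D k\<bar> \<le> (real L + 1) * E"
proof -
  have "0 \<le> E" using diff[of 0] by simp
  have *: "\<bar>lookup D k\<bar> \<le> of_int (k + int L + 1) * E" if "- int L - 1 \<le> k" "k \<le> 0" for k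
    using that
  proof (induction k rule: int_ge_induct)
    case base
    then show ?case using zero by simp
  next
    case (step k)
    have "\<bar>lookup D (k + 1) - lookup D k\<bar> \<le> E"
      using diff[of "k + 1"] step.prems by (simp add: left_diff_distrib lookup_minus lookup_single_mult)
    then show ?case using step by (simp add: algebra_simps)
  qed
  have "of_int (k + int L + 1) * E \<le> (real L + 1) * E"
    using \<open>0 \<le> E\<close> assms(3) by (intro mult_right_mono) auto
  then show ?thesis
    using zero[of k] *[of k] \<open>0 \<le> E\<close> assms(3) by (cases "k < - int L") auto
qed

lemma abs_lookup_le_difference_power:
  assumes zero: "\<And>k. k < - int L \<Longrightarrow> lookup D k = 0"
    and diff: "\<And>k. k \<le> 0 \<Longrightarrow> \<bar>lookup ((1 - Z) ^ i * D) k\<bar> \<le> E" and "k \<le> 0"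
  shows "\<bar>lookup D k\<bar> \<le> (real L + 1) ^ i * E"
  using diff \<open>k \<le> 0\<close>
proof (induction i arbitrary: E k)
  case (Suc i)
  have zero_i: "lookup ((1 - Z) ^ i * D) k = 0" if "k < - int L" for k
    using that
  proof (induction i arbitrary: k)
    case (Suc i)
    have "(1 - Z) ^ Suc i * D = (1 - Z) ^ i * D - Z * ((1 - Z) ^ i * D)"
      by (simp add: left_diff_distrib mult.assoc)
    then show ?case
      using Suc.IH[of k] Suc.IH[of "k - 1"] Suc.prems
      by (simp only: lookup_minus lookup_single_mult)
  qed (simp add: zero)
  have "\<bar>lookup ((1 - Z) ^ i * D) k\<bar> \<le> (real L + 1) * E" if "k \<le> 0" for k
    using Suc.prems(1) that by (intro abs_lookup_le_difference[OF zero_i]) (auto simp: mult.assoc)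
  from Suc.IH[OF this Suc.prems(2)] show ?case by (simp add: mult_ac)
qed simp

lemma linear_interpolant_knot:
  "linear_interpolant (n + r) c (of_int k / 2 ^ n) = c (2 ^ r * k)"
proof -
  have "2 ^ (n + r) * (of_int k / 2 ^ n) = (of_int (2 ^ r * k) :: real)"
    by (simp add: power_add)
  then show ?thesis
    unfolding linear_interpolant_def by (metis floor_of_int frac_of_int mult_1 mult_zero_left add_0_right diff_zero)
qed

section \<open>Sampling the limit function\<close>

context nonneg_symbol
begin

text \<open>The values at the integers of the r-th level, started from a unit impulse; for
  convergent schemes they tend to integer samples of the limit function.\<close>

definition \<Phi> :: "nat \<Rightarrow> laurent_poly"
  where "\<Phi> r = dec (2 ^ r) (iter_symbol a r)"

lemma a_nonneg: "circle_nonneg a"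
  using circle_nonneg_of_nat[of 2]
  by (auto intro!: circle_nonneg_mult circle_nonneg_power circle_nonneg_sigma b_nonneg)

lemma \<Phi>_0: "\<Phi> 0 = 1"
  by (simp add: \<Phi>_def)

text \<open>Splitting off the factor a(z^(2^r)) exhibits \<Phi> as iterates of the transfer operator
  sending F to \<open>dec 2 (a * F)\<close>.\<close>

lemma \<Phi>_Suc: "\<Phi> (Suc r) = dec 2 (a * \<Phi> r)"
proof -
  have "\<Phi> (Suc r) = dec 2 (dec (2 ^ r) (dil (2 ^ r) a * iter_symbol a r))"
    by (simp add: \<Phi>_def iter_symbol_Suc dec_dec mult.commute del: iter_symbol.simps)
  then show ?thesis by (simp add: dec_dil_mult \<Phi>_def)
qed

lemma \<Phi>_nonneg: "circle_nonneg (\<Phi> r)"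
  by (induction r) (simp_all add: \<Phi>_0 \<Phi>_Suc circle_nonneg_one circle_nonneg_dec_two circle_nonneg_mult a_nonneg)

lemma dec_iter_symbol_add: "dec (2 ^ r) (iter_symbol a (n + r)) = iter_symbol a n * \<Phi> r"
  unfolding add.commute[of n r] iter_symbol_add \<Phi>_def
  by (subst mult.commute) (simp add: dec_dil_mult)

end

locale large_symbol = nonneg_symbol +
  assumes b_ge_one: "1 \<le> Re (circle b \<xi>)"
begin

text \<open>Of the two terms of \<open>circle_dec_two\<close> only the one at xi / 2 is kept. The 2
  in the symbol cancels the averaging 1/2, and b \<ge> 1 leaves just the cosine factor.\<close>

lemma \<Phi>_lower_bound:
  assumes "\<bar>\<xi>\<bar> \<le> pi"
  shows "(1 / 9) ^ m \<le> Re (circle (\<Phi> r) \<xi>)"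
proof (rule cos_product_lower_bound[where \<Phi> = "\<lambda>r \<xi>. Re (circle (\<Phi> r) \<xi>)"])
  fix r and \<xi> :: real
  have "(cos (\<xi> / 4))\<^sup>2 ^ m * Re (circle (\<Phi> r) (\<xi> / 2)) * 1 \<le>
      (cos (\<xi> / 4))\<^sup>2 ^ m * Re (circle (\<Phi> r) (\<xi> / 2)) * Re (circle b (\<xi> / 2))"
    using circle_nonneg_Re[OF \<Phi>_nonneg] b_ge_one by (intro mult_left_mono mult_nonneg_nonneg) auto
  also have "\<dots> = Re (circle (a * \<Phi> r) (\<xi> / 2)) / 2"
  proof -
    have "Re (circle (sigma ^ m) (\<xi> / 2)) = (cos (\<xi> / 4))\<^sup>2 ^ m"
      by (simp add: circle.eval_power circle_sigma flip: of_real_power)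
    moreover have "circle a (\<xi> / 2) = 2 * circle (sigma ^ m * b) (\<xi> / 2)"
      by (simp only: mult.assoc circle.eval_mult circle.eval_numeral)
    ultimately have "Re (circle a (\<xi> / 2)) = 2 * ((cos (\<xi> / 4))\<^sup>2 ^ m * Re (circle b (\<xi> / 2)))"
      by (simp add: Re_circle_mult[OF circle_nonneg_power[OF circle_nonneg_sigma]])
    then show ?thesis
      unfolding Re_circle_mult[OF a_nonneg] by simp
  qed
  also have "\<dots> \<le> Re (circle (\<Phi> (Suc r)) \<xi>)"
    using circle_nonneg_Re[OF circle_nonneg_mult[OF a_nonneg \<Phi>_nonneg], of r "\<xi> / 2 + pi"]
    by (simp add: \<Phi>_Suc circle_dec_two add_divide_distrib)
  finally show "(cos (\<xi> / 4))\<^sup>2 ^ m * Re (circle (\<Phi> r) (\<xi> / 2)) \<le> Re (circle (\<Phi> (Suc r)) \<xi>)"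
    by simp
qed (use assms circle_nonneg_Re[OF \<Phi>_nonneg] in \<open>auto simp: \<Phi>_0 circle.eval_one\<close>)

text \<open>The left hand side is a mean of nonnegative values over the circle, and the samples of the limit
  function only multiply these values by \<open>lim\<^sub>r \<Phi>\<^sub>r\<close>, which is bounded below.\<close>

lemma zero_coeff_le_limit_differences:
  assumes conv: "\<And>x. (\<lambda>j. linear_interpolant j (lookup (iter_symbol a j)) x) \<longlonglongrightarrow> f x"
  shows "(1 / 9) ^ m * lookup (delta ^ m * iter_symbol a n) 0 \<le> act (delta ^ m) (\<lambda>x. f (1 / 2 ^ n * x)) 0"
proof (rule LIMSEQ_le_const)
  have "(\<lambda>r. lookup (iter_symbol a n * \<Phi> r) k) \<longlonglongrightarrow> f (1 / 2 ^ n * of_int k)" for k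
  proof -
    have "(\<lambda>r. linear_interpolant (n + r) (lookup (iter_symbol a (n + r))) (of_int k / 2 ^ n)) \<longlonglongrightarrow> f (of_int k / 2 ^ n)"
      using LIMSEQ_ignore_initial_segment[OF conv[of "of_int k / 2 ^ n"], of n] by (simp add: add.commute)
    moreover have "linear_interpolant (n + r) (lookup (iter_symbol a (n + r))) (of_int k / 2 ^ n) =
        lookup (iter_symbol a n * \<Phi> r) k" for r
      by (simp add: linear_interpolant_knot dec_iter_symbol_add[symmetric] lookup_dec)
    ultimately show ?thesis by simp
  qed
  then have "(\<lambda>r. \<Sum>l\<in>keys (delta ^ m). lookup (delta ^ m) l * lookup (iter_symbol a n * \<Phi> r) (0 - l))
      \<longlonglongrightarrow> (\<Sum>l\<in>keys (delta ^ m). lookup (delta ^ m) l * f (1 / 2 ^ n * of_int (0 - l)))"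
    by (intro tendsto_sum tendsto_mult_left)
  then show "(\<lambda>r. lookup (delta ^ m * (iter_symbol a n * \<Phi> r)) 0) \<longlonglongrightarrow> act (delta ^ m) (\<lambda>x. f (1 / 2 ^ n * x)) 0"
    by (simp add: lookup_mult_keys[of "delta ^ m"] act_def)
next
  let ?G = "delta ^ m * iter_symbol a n"
  have G: "circle_nonneg ?G"
    by (intro circle_nonneg_mult circle_nonneg_power circle_nonneg_delta circle_nonneg_iter_symbol a_nonneg)
  have "(1 / 9) ^ m * lookup ?G 0 \<le> lookup (?G * \<Phi> r) 0" for r
  proof -
    have "0 \<le> lookup (?G * (\<Phi> r - single 0 ((1 / 9) ^ m))) 0"
    proof (rule zero_coeff_nonneg)
      fix \<xi> :: real assume "\<bar>\<xi>\<bar> \<le> pi"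
      then show "0 \<le> Re (circle (?G * (\<Phi> r - single 0 ((1 / 9) ^ m))) \<xi>)"
        using \<Phi>_lower_bound[of \<xi> r] circle_nonneg_Re[OF G, of \<xi>]
        unfolding Re_circle_mult[OF G] by (simp add: circle.eval_diff circle.eval_single)
    qed
    then show ?thesis by (simp add: right_diff_distrib lookup_minus lookup_mult_single)
  qed
  then show "\<exists>N. \<forall>r\<ge>N. (1 / 9) ^ m * lookup ?G 0 \<le> lookup (delta ^ m * (iter_symbol a n * \<Phi> r)) 0"
    by (simp add: mult.assoc)
qed

text \<open>For the impulse, 2m-th differences with step 2^(-n) are of order 2^(-n min(\<beta>,
  2m)); the factor 4^m / 2 per level from \<open>delta_power_iter_symbol\<close> supplies 2m - 1. It
  remains to remove the differences still attached to the product of the b(z^(2^j)).\<close>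

theorem growth_exponent_of_regular_limit:
  assumes conv: "\<And>x. convergent (\<lambda>j. linear_interpolant j (subdivision a (lookup 1) j) x)"
    and f: "limit_function a (lookup 1) \<in> holder_class \<beta>" and "0 \<le> \<beta>"
  shows "growth_exponent b (2 * real m - 1 - min \<beta> (2 * real m))"
proof -
  let ?f = "limit_function a (lookup 1)" and ?\<beta> = "min \<beta> (2 * real m)"
  obtain C where C: "\<And>h. 0 < h \<Longrightarrow> h \<le> 1 \<Longrightarrow>
      \<bar>act ((1 - Z) ^ (2 * m)) (\<lambda>x. ?f (h * x)) (real m)\<bar> \<le> C * h powr ?\<beta>"
    using differences_bound[OF f \<open>0 \<le> \<beta>\<close>, of "2 * m" "real m"] by auto
  have sub: "subdivision a (lookup 1) = (\<lambda>n. lookup (iter_symbol a n))"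
    by (simp add: fun_eq_iff subdivision_lookup dil.eval_one)
  have lim: "(\<lambda>j. linear_interpolant j (lookup (iter_symbol a j)) x) \<longlonglongrightarrow> ?f x" for x
    using conv[of x] by (simp add: limit_function_def sub convergent_LIMSEQ_iff)
  obtain L :: nat where L: "\<And>k. k < - int L \<Longrightarrow> lookup b k = 0"
  proof
    fix k assume "k < - int (nat (Max (insert 0 (uminus ` keys b))))"
    then have "Max (insert 0 (uminus ` keys b)) < - k" by simp
    then have "- k \<notin> uminus ` keys b" by auto
    then show "lookup b k = 0" by (auto simp: in_keys_iff)
  qed
  define W where "W = l1_norm ((- 4 * Z) ^ m)"
  define K where "K = (real L + 1) ^ (2 * m) * W * (9 ^ m * C)"
  have "lookup (iter_symbol b n) 0 \<le> K * 2 powr (real n * (2 * real m - 1 - ?\<beta>))" for n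
  proof -
    define h where "h = (1 / 2 ^ n :: real)"
    have h: "0 < h" "h \<le> 1" by (simp_all add: h_def)
    have "- 4 * Z = single 1 (- 4)"
      using mult_single[of 0 "4::real" "1::int" 1] by (simp add: single_uminus)
    then have pow: "(- 4 * Z) ^ m = single (int m) ((- 4) ^ m)"
      by (simp only:) (induction m, simp_all add: mult_single)
    \<comment> \<open>Evaluating the backward differences at m centres them at the origin, where
      positivity applies.\<close>
    have "act ((1 - Z) ^ (2 * m)) (\<lambda>x. ?f (h * x)) (real m) =
        (- 4) ^ m * act (delta ^ m) (\<lambda>x. ?f (h * x)) 0"
      unfolding one_minus_Z_power_eq_delta_power pow act_mult by (simp add: act_single)
    then have "4 ^ m * \<bar>act (delta ^ m) (\<lambda>x. ?f (h * x)) 0\<bar> \<le> C * h powr ?\<beta>"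
      using C[OF h] by (simp add: abs_mult power_abs)
    moreover have "1 * \<bar>act (delta ^ m) (\<lambda>x. ?f (h * x)) 0\<bar> \<le> 4 ^ m * \<bar>act (delta ^ m) (\<lambda>x. ?f (h * x)) 0\<bar>"
      by (intro mult_right_mono) auto
    ultimately have "act (delta ^ m) (\<lambda>x. ?f (h * x)) 0 \<le> C * h powr ?\<beta>" by linarith
    with zero_coeff_le_limit_differences[OF lim, of n]
    have "(1 / 9) ^ m * lookup (delta ^ m * iter_symbol a n) 0 \<le> C * h powr ?\<beta>"
      by (simp add: h_def)
    then have A: "lookup (delta ^ m * iter_symbol a n) 0 \<le> 9 ^ m * C * h powr ?\<beta>"
      by (simp add: power_divide field_simps)
    let ?G = "dil (2 ^ n) (delta ^ m) * iter_symbol b n"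
    define E where "E = 9 ^ m * C * 2 powr (real n * (2 * real m - 1 - ?\<beta>))"
    have "2 ^ n * lookup ?G 0 = 4 ^ (n * m) * lookup (delta ^ m * iter_symbol a n) 0"
      by (metis delta_power_iter_symbol lookup_numeral_power_mult)
    also have "\<dots> \<le> 4 ^ (n * m) * (9 ^ m * C * h powr ?\<beta>)"
      using A by (intro mult_left_mono) auto
    also have "\<dots> = 2 ^ n * E"
    proof -
      have "(4::real) ^ (n * m) = 2 ^ (2 * (n * m))"
        by (simp add: power_mult)
      also have "\<dots> = 2 powr (2 * real n * real m)"
        by (subst powr_realpow[symmetric]) (simp_all add: mult_ac)
      also have "\<dots> * h powr ?\<beta> = 2 ^ n * 2 powr (real n * (2 * real m - 1 - ?\<beta>))"
        by (simp add: h_def powr_divide powr_realpow[symmetric] powr_powr powr_add[symmetric]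
            powr_diff[symmetric] divide_powr_uminus algebra_simps)
      finally show ?thesis by (simp add: E_def mult_ac)
    qed
    finally have "lookup ?G 0 \<le> E" by simp
    moreover have "circle_nonneg ?G"
      by (intro circle_nonneg_mult circle_nonneg_dil circle_nonneg_power circle_nonneg_delta
          circle_nonneg_iter_symbol b_nonneg)
    ultimately have G: "\<bar>lookup ?G k\<bar> \<le> E" for k
      using abs_lookup_le_zero_coeff order_trans by blast
    \<comment> \<open>Decimation turns the differences of step 2^n in \<open>?G\<close> into unit
      differences of D and keeps the zeroth coefficient. As D starts at -L for every n, undoing the
      2m differences costs a constant factor only.\<close>
    define D where "D = dec (2 ^ n) (iter_symbol b n)"
    have "\<bar>lookup ((- 4 * Z) ^ m * (delta ^ m * D)) k\<bar> \<le> W * E" for k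
      unfolding W_def
    proof (rule abs_lookup_mult_le)
      fix k
      have "lookup (delta ^ m * D) k = lookup ?G (2 ^ n * k)"
        by (simp add: D_def dec_dil_mult[symmetric] lookup_dec)
      then show "\<bar>lookup (delta ^ m * D) k\<bar> \<le> E" using G by simp
    qed
    then have "\<bar>lookup ((1 - Z) ^ (2 * m) * D) k\<bar> \<le> W * E" for k
      by (simp add: one_minus_Z_power_eq_delta_power mult.assoc)
    moreover have "lookup D k = 0" if "k < - int L" for k
    proof -
      have "2 ^ n * k \<le> 2 ^ n * (- int L - 1)"
        using that by (intro mult_left_mono) auto
      also have "\<dots> < - int L * (2 ^ n - 1)"
        using less_le_trans[of "- (2 ^ n)" 0 "int L"] by (simp add: algebra_simps)
      finally show ?thesis
        by (simp add: D_def lookup_dec iter_symbol_lookup_eq_zero[OF L])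
    qed
    ultimately have "\<bar>lookup D 0\<bar> \<le> (real L + 1) ^ (2 * m) * (W * E)"
      by (intro abs_lookup_le_difference_power) auto
    then show ?thesis by (simp add: D_def lookup_dec K_def E_def mult_ac)
  qed
  then show ?thesis unfolding growth_exponent_def by blast
qed

end

section \<open>Comparison of growth exponents\<close>

definition min_growth :: "laurent_poly \<Rightarrow> real"
  where "min_growth b = Inf {s. growth_exponent b s}"

lemma iter_symbol_one: "iter_symbol 1 n = 1"
  by (induction n) (simp_all add: dil.eval_one)

lemma growth_exponent_one: "growth_exponent 1 0"
  by (auto simp: growth_exponent_def iter_symbol_one)

lemma Re_circle_iter_symbol_le:
  assumes b: "circle_nonneg b" and b': "circle_nonneg b'" and "0 \<le> K"
    and le: "\<And>\<xi>. Re (circle b \<xi>) \<le> K * Re (circle b' \<xi>)"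
  shows "Re (circle (iter_symbol b n) \<xi>) \<le> K ^ n * Re (circle (iter_symbol b' n) \<xi>)"
proof (induction n arbitrary: \<xi>)
  case (Suc n)
  have "Re (circle b \<xi>) * Re (circle (iter_symbol b n) (2 * \<xi>)) \<le>
      (K * Re (circle b' \<xi>)) * (K ^ n * Re (circle (iter_symbol b' n) (2 * \<xi>)))"
    using Suc le circle_nonneg_Re[OF b'] circle_nonneg_Re[OF circle_nonneg_iter_symbol[OF b]] \<open>0 \<le> K\<close>
    by (intro mult_mono) auto
  then show ?case
    by (simp add: Re_circle_mult b b' circle_dil mult_ac)
qed simp

text \<open>Nonnegative factors can be multiplied, so the bound holds with K^n for the n-fold
  products and then for their means.\<close>

lemma growth_exponent_compare:
  assumes "circle_nonneg b" "circle_nonneg b'" "0 < K"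
    and "\<And>\<xi>. Re (circle b \<xi>) \<le> K * Re (circle b' \<xi>)" and "growth_exponent b' s"
  shows "growth_exponent b (s + log 2 K)"
proof -
  obtain C where C: "\<And>n. lookup (iter_symbol b' n) 0 \<le> C * 2 powr (real n * s)"
    using assms(5) by (auto simp: growth_exponent_def)
  have "lookup (iter_symbol b n) 0 \<le> C * 2 powr (real n * (s + log 2 K))" for n
  proof -
    have "0 \<le> lookup (single 0 (K ^ n) * iter_symbol b' n - iter_symbol b n) 0"
      using Re_circle_iter_symbol_le[OF assms(1,2) less_imp_le[OF assms(3)] assms(4)]
      by (intro zero_coeff_nonneg) (simp add: circle.eval_diff circle.eval_mult circle.eval_single)
    then have "lookup (iter_symbol b n) 0 \<le> K ^ n * lookup (iter_symbol b' n) 0"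
      by (simp add: lookup_minus lookup_single_mult)
    also have "\<dots> \<le> K ^ n * (C * 2 powr (real n * s))"
      using assms(3) by (intro mult_left_mono C) auto
    also have "K ^ n = 2 powr (real n * log 2 K)"
      using assms(3) by (simp add: powr_nat_mult)
    finally show ?thesis
      by (simp add: distrib_left powr_add mult_ac)
  qed
  then show ?thesis unfolding growth_exponent_def by blast
qed

context large_symbol
begin

lemma one_le_zero_coeff: "1 \<le> lookup (iter_symbol b n) 0"
proof -
  have "Re (circle (iter_symbol 1 n) \<xi>) \<le> 1 ^ n * Re (circle (iter_symbol b n) \<xi>)" for \<xi>
    using b_ge_one by (intro Re_circle_iter_symbol_le b_nonneg circle_nonneg_one) (auto simp: circle.eval_one)
  then have "lookup (1 :: laurent_poly) 0 \<le> lookup (iter_symbol b n) 0"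
    by (intro zero_coeff_mono) (simp add: iter_symbol_one)
  then show ?thesis by simp
qed

lemma growth_exponent_nonneg:
  assumes "growth_exponent b s"
  shows "0 \<le> s"
proof (rule ccontr)
  assume "\<not> 0 \<le> s"
  obtain C where C: "\<And>n. lookup (iter_symbol b n) 0 \<le> C * 2 powr (real n * s)"
    using assms by (auto simp: growth_exponent_def)
  have "(\<lambda>n. C * (2 powr s) ^ n) \<longlonglongrightarrow> 0"
    using \<open>\<not> 0 \<le> s\<close> by (intro tendsto_mult_right_zero LIMSEQ_power_zero) (simp add: powr_less_one)
  moreover have "1 \<le> C * (2 powr s) ^ n" for n
    using C[of n] one_le_zero_coeff[of n] by (simp add: powr_nat_mult)
  ultimately have "(1::real) \<le> 0"
    by (intro LIMSEQ_le_const) auto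
  then show False by simp
qed

lemma growth_exponent_exists: "\<exists>s. growth_exponent b s"
proof -
  have "Re (circle b \<xi>) \<le> max 1 (l1_norm b) * Re (circle 1 \<xi>)" for \<xi>
  proof -
    have "Re (circle b \<xi>) \<le> (\<Sum>k\<in>keys b. \<bar>lookup b k\<bar>)"
      unfolding Re_circle
    proof (rule sum_mono)
      fix k
      have "lookup b k * cos (of_int k * \<xi>) \<le> \<bar>lookup b k\<bar> * \<bar>cos (of_int k * \<xi>)\<bar>"
        unfolding abs_mult[symmetric] by (rule abs_ge_self)
      also have "\<dots> \<le> \<bar>lookup b k\<bar> * 1" by (intro mult_left_mono) auto
      finally show "lookup b k * cos (of_int k * \<xi>) \<le> \<bar>lookup b k\<bar>" by simp
    qed
    then show ?thesis by (simp add: circle.eval_one l1_norm_def)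
  qed
  moreover have "0 < max 1 (l1_norm b)" by simp
  ultimately show ?thesis
    using growth_exponent_compare[OF b_nonneg circle_nonneg_one _ _ growth_exponent_one] by blast
qed

lemma bdd_below_growth_exponents: "bdd_below {s. growth_exponent b s}"
  using growth_exponent_nonneg by (intro bdd_belowI[of _ 0]) auto

lemma min_growth_le: "growth_exponent b s \<Longrightarrow> min_growth b \<le> s"
  unfolding min_growth_def by (rule cInf_lower) (auto simp: bdd_below_growth_exponents)

lemma min_growth_nonneg: "0 \<le> min_growth b"
  unfolding min_growth_def using growth_exponent_exists growth_exponent_nonneg
  by (intro cInf_greatest) auto

lemma growth_exponent_below:
  assumes "min_growth b < t"
  obtains s where "growth_exponent b s" "s < t"
  using cInf_lessD[of "{s. growth_exponent b s}" t] assms growth_exponent_exists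
  by (auto simp: min_growth_def)

text \<open>The infimum \<open>min_growth\<close> need not be attained, so each lower order uses a
  growth exponent strictly beneath its threshold. \<open>pos\<close> makes order 0 admissible and so
  gives convergence.\<close>

theorem has_holder_regularity_min_growth:
  assumes pos: "min_growth b < 2 * real m - 1"
  shows "has_holder_regularity a (2 * real m - 1 - min_growth b)"
proof -
  have regular: "limit_function a f0 \<in> holder_class \<beta>"
    and conv: "convergent (\<lambda>j. linear_interpolant j (subdivision a f0 j) x)"
    if \<beta>: "0 \<le> \<beta>" "\<beta> < 2 * real m - 1 - min_growth b" and f0: "f0 \<in> initial_data" for \<beta> f0 x
  proof -
    have "min_growth b < 2 * real m - 1 - \<beta>" using \<beta> by linarith
    then obtain s where s: "growth_exponent b s" "s < 2 * real m - 1 - \<beta>"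
      by (rule growth_exponent_below)
    have "\<beta> < 2 * real m - 1 - s" using s by linarith
    from convergent_and_regular[OF s(1) growth_exponent_nonneg[OF s(1)] \<beta>(1) this f0]
    show "limit_function a f0 \<in> holder_class \<beta>"
      "convergent (\<lambda>j. linear_interpolant j (subdivision a f0 j) x)" by blast+
  qed
  have conv0: "convergent (\<lambda>j. linear_interpolant j (subdivision a f0 j) x)" if "f0 \<in> initial_data" for f0 x
    using conv[of 0, OF _ _ that] pos by simp
  have one: "lookup 1 \<in> initial_data"
    by (auto simp: lookup_range_initial_data)
  \<comment> \<open>The impulse is the witness for every larger order. The cap at 2m is harmless: it
    would force \<open>min_growth b\<close> to be at most -1.\<close>
  have "limit_function a (lookup 1) \<notin> holder_class \<beta>" if "2 * real m - 1 - min_growth b < \<beta>" for \<beta>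
  proof
    assume "limit_function a (lookup 1) \<in> holder_class \<beta>"
    then have "growth_exponent b (2 * real m - 1 - min \<beta> (2 * real m))"
      using that pos by (intro growth_exponent_of_regular_limit conv0 one) auto
    then have "min_growth b \<le> 2 * real m - 1 - min \<beta> (2 * real m)"
      by (rule min_growth_le)
    then show False using that min_growth_nonneg by (simp add: min_def split: if_splits)
  qed
  then show ?thesis
    unfolding has_holder_regularity_def convergent_scheme_def
    using regular conv0 one pos by (intro conjI allI impI ballI) (auto intro!: bexI[of _ "lookup 1"])
qed

end

lemma min_growth_compare:
  assumes "large_symbol m b" "large_symbol m' b'" "0 < K"
    and "\<And>\<xi>. Re (circle b \<xi>) \<le> K * Re (circle b' \<xi>)"
  shows "min_growth b \<le> min_growth b' + log 2 K"
proof (rule field_le_epsilon)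
  interpret b: large_symbol m b by fact
  interpret b': large_symbol m' b' by fact
  fix e :: real assume "0 < e"
  then obtain s where s: "growth_exponent b' s" "s < min_growth b' + e"
    using b'.growth_exponent_below[of "min_growth b' + e"] by auto
  have "min_growth b \<le> s + log 2 K"
    by (intro b.min_growth_le growth_exponent_compare[OF b.b_nonneg b'.b_nonneg assms(3,4) s(1)])
  then show "min_growth b \<le> min_growth b' + log 2 K + e" using s by linarith
qed

section \<open>Truncated binomial series\<close>

text \<open>For m \<ge> 1 these are the Taylor coefficients of (1 - y)^(-m).\<close>

definition weight :: "nat \<Rightarrow> nat \<Rightarrow> real"
  where "weight m k = real ((m - 1 + k) choose k)"

lemma weight_nonneg: "0 \<le> weight m k"
  by (simp add: weight_def)

lemma weight_zero [simp]: "weight m 0 = 1"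
  by (simp add: weight_def)

lemma weight_Suc_left:
  assumes "1 \<le> m"
  shows "real m * weight (Suc m) k = real (m + k) * weight m k"
proof -
  have "(m + k - k) * ((m + k) choose k) = (m + k) * ((m + k - 1) choose k)"
    by (rule binomial_absorb_comp)
  then have "m * ((m + k) choose k) = (m + k) * ((m - 1 + k) choose k)"
    using assms by simp
  then show ?thesis
    unfolding weight_def by (metis diff_Suc_1 of_nat_mult)
qed

lemma weight_Suc_right:
  assumes "1 \<le> m"
  shows "real (Suc k) * weight m (Suc k) = real m * weight (Suc m) k"
proof -
  have "Suc k * (Suc (m - 1 + k) choose Suc k) = Suc (m - 1 + k) * ((m - 1 + k) choose k)"
    by (rule Suc_times_binomial)
  then have "real (Suc k) * weight m (Suc k) = real (m + k) * weight m k"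
    using assms unfolding weight_def by (metis Suc_diff_1 add_Suc add_Suc_right less_eq_Suc_le of_nat_mult One_nat_def)
  then show ?thesis using weight_Suc_left[OF assms] by simp
qed

lemma sum_weight:
  assumes "1 \<le> m"
  shows "(\<Sum>k\<le>l. weight m k) = weight (Suc m) l"
proof -
  have "(\<Sum>k\<le>l. (m - 1 + k) choose k) = Suc (m - 1 + l) choose l"
    by (rule sum_choose_lower)
  then have "(\<Sum>k\<le>l. (m - 1 + k) choose k) = (m + l) choose l"
    using assms by simp
  then show ?thesis
    unfolding weight_def of_nat_sum[symmetric] by simp
qed

text \<open>With \<open>sum_weight\<close>: the mean index under these weights is m l / (m + 1), the
  point where the weights w of \<open>binomial_partial_sum_Suc_left_le\<close> change sign.\<close>

lemma sum_index_weight: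
  assumes "1 \<le> m"
  shows "real (Suc m) * (\<Sum>k\<le>l. real k * weight m k) = real m * real l * weight (Suc m) l"
proof (induction l)
  case (Suc l)
  have "weight (Suc m) (Suc l) = weight (Suc m) l + weight m (Suc l)"
    using sum_weight[OF assms, of "Suc l"] sum_weight[OF assms, of l] by simp
  then have "real m * real (Suc l) * weight (Suc m) (Suc l) =
      real m * (real (Suc l) * weight (Suc m) l + real m * weight (Suc m) l)"
    using weight_Suc_right[OF assms, of l] by (simp only: distrib_left mult.assoc)
  moreover have "real (Suc m) * (\<Sum>k\<le>Suc l. real k * weight m k) =
      real m * real l * weight (Suc m) l + real (Suc m) * (real m * weight (Suc m) l)"
    using Suc weight_Suc_right[OF assms, of l] by (simp only: sum.atMost_Suc distrib_left)
  ultimately show ?case by (simp add: algebra_simps)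
qed simp

definition binomial_partial_sum :: "nat \<Rightarrow> nat \<Rightarrow> real \<Rightarrow> real"
  where "binomial_partial_sum m l y = (\<Sum>k\<le>l. weight m k * y ^ k)"

lemma binomial_partial_sum_mono_right:
  assumes "l \<le> l'" "0 \<le> y"
  shows "binomial_partial_sum m l y \<le> binomial_partial_sum m l' y"
  unfolding binomial_partial_sum_def using assms by (intro sum_mono2) (auto simp: weight_nonneg)

lemma one_le_binomial_partial_sum: "0 \<le> y \<Longrightarrow> 1 \<le> binomial_partial_sum m l y"
  using binomial_partial_sum_mono_right[of 0 l y m] by (simp add: binomial_partial_sum_def)

text \<open>The new coefficient is m / (l + 1) times the sum of the old ones, and its power of y is
  the smallest on [0, 1].\<close>

lemma binomial_partial_sum_Suc_right_le:
  assumes "1 \<le> m" "0 \<le> y" "y \<le> 1"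
  shows "binomial_partial_sum m (Suc l) y \<le> (real m + real (Suc l)) / real (Suc l) * binomial_partial_sum m l y"
proof -
  have "real (Suc l) * (weight m (Suc l) * y ^ Suc l) = real m * (\<Sum>k\<le>l. weight m k * y ^ Suc l)"
    using weight_Suc_right[OF assms(1), of l] sum_weight[OF assms(1), of l]
    by (simp only: mult.assoc[symmetric] sum_distrib_right[symmetric])
  also have "\<dots> \<le> real m * binomial_partial_sum m l y"
    unfolding binomial_partial_sum_def using assms
    by (intro mult_left_mono sum_mono power_decreasing) (auto simp: weight_nonneg)
  finally have "weight m (Suc l) * y ^ Suc l \<le> real m / real (Suc l) * binomial_partial_sum m l y"
    by (simp add: field_simps del: of_nat_Suc)
  then have "binomial_partial_sum m (Suc l) y \<le> binomial_partial_sum m l y + real m / real (Suc l) * binomial_partial_sum m l y"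
    by (simp add: binomial_partial_sum_def)
  also have "\<dots> = (real m + real (Suc l)) / real (Suc l) * binomial_partial_sum m l y"
    by (simp add: field_simps del: of_nat_Suc)
  finally show ?thesis .
qed

lemma binomial_partial_sum_mono_left:
  assumes "1 \<le> m" "0 \<le> y"
  shows "binomial_partial_sum m l y \<le> binomial_partial_sum (Suc m) l y"
  unfolding binomial_partial_sum_def
proof (intro sum_mono mult_right_mono)
  fix k
  have "real m * weight m k \<le> real (m + k) * weight m k"
    by (intro mult_right_mono) (auto simp: weight_nonneg)
  then have "real m * weight m k \<le> real m * weight (Suc m) k"
    by (simp only: weight_Suc_left[OF assms(1)])
  then show "weight m k \<le> weight (Suc m) k" using assms by simp
qed (use assms in simp)

text \<open>The weights \<open>(m + 1) k - m l\<close> change sign once, at \<open>j\<close>, and sum to zero against the coefficients.\<close>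

lemma binomial_partial_sum_Suc_left_le:
  assumes "1 \<le> m" "0 \<le> y" "y \<le> 1"
  shows "binomial_partial_sum (Suc m) l y \<le> (real m + real l + 1) / (real m + 1) * binomial_partial_sum m l y"
proof -
  define w where "w k = real (Suc m) * real k - real m * real l" for k
  define j where "j = m * l div Suc m"
  \<comment> \<open>Up to j the weight is at most zero and y^k is at least y^j; beyond j both
    relations reverse. So freezing the power at j raises every term.\<close>
  have "weight m k * w k * y ^ k \<le> weight m k * w k * y ^ j" for k
  proof (cases "k \<le> j")
    case True
    have "Suc m * k \<le> m * l"
      using mult_le_mono2[OF True, of "Suc m"] unfolding j_def
      by (meson div_times_less_eq_dividend mult.commute order_trans times_div_less_eq_dividend)
    then have "real (Suc m * k) \<le> real (m * l)" by (simp only: of_nat_le_iff)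
    then have "w k \<le> 0" by (simp only: w_def of_nat_mult diff_le_0_iff_le)
    moreover have "y ^ j \<le> y ^ k" using True assms by (intro power_decreasing)
    ultimately show ?thesis
      using weight_nonneg[of m k] by (intro mult_left_mono_neg mult_nonneg_nonpos)
  next
    case False
    then have "m * l < Suc m * k"
      unfolding j_def by (metis div_less_iff_less_mult mult.commute not_le zero_less_Suc)
    then have "real (m * l) < real (Suc m * k)" by (simp only: of_nat_less_iff)
    then have "0 \<le> w k" by (simp only: w_def of_nat_mult diff_ge_0_iff_ge less_imp_le)
    moreover have "y ^ k \<le> y ^ j" using False assms by (intro power_decreasing) auto
    ultimately show ?thesis
      using weight_nonneg[of m k] by (intro mult_left_mono mult_nonneg_nonneg)
  qed
  then have "(\<Sum>k\<le>l. weight m k * w k * y ^ k) \<le> (\<Sum>k\<le>l. weight m k * w k * y ^ j)"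
    by (rule sum_mono)
  also have "\<dots> = (real (Suc m) * (\<Sum>k\<le>l. real k * weight m k) - real m * real l * (\<Sum>k\<le>l. weight m k)) * y ^ j"
    by (simp add: w_def sum_distrib_left sum_distrib_right sum_subtractf[symmetric] algebra_simps)
  also have "\<dots> = 0"
    by (simp only: sum_index_weight[OF assms(1)] sum_weight[OF assms(1)]) simp
  finally have "(\<Sum>k\<le>l. weight m k * w k * y ^ k) \<le> 0" .
  \<comment> \<open>Multiplying by m expresses both sums by the same coefficients via
    \<open>weight_Suc_left\<close>; then (m + 1)(m + k) - m (m + l + 1) = w k.\<close>
  moreover have "real m * ((real m + 1) * binomial_partial_sum (Suc m) l y - (real m + real l + 1) * binomial_partial_sum m l y) =
      (\<Sum>k\<le>l. weight m k * w k * y ^ k)"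
  proof -
    have "real m * binomial_partial_sum (Suc m) l y = (\<Sum>k\<le>l. real (m + k) * weight m k * y ^ k)"
      unfolding binomial_partial_sum_def sum_distrib_left mult.assoc[symmetric] weight_Suc_left[OF assms(1)] ..
    then have "real m * ((real m + 1) * binomial_partial_sum (Suc m) l y - (real m + real l + 1) * binomial_partial_sum m l y) =
        (real m + 1) * (\<Sum>k\<le>l. real (m + k) * weight m k * y ^ k) -
        real m * (real m + real l + 1) * (\<Sum>k\<le>l. weight m k * y ^ k)"
      by (simp add: binomial_partial_sum_def right_diff_distrib mult.left_commute mult.assoc)
    also have "\<dots> = (\<Sum>k\<le>l. weight m k * w k * y ^ k)"
      unfolding sum_distrib_left sum_subtractf[symmetric]
      by (intro sum.cong) (auto simp: w_def algebra_simps)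
    finally show ?thesis .
  qed
  ultimately have "real m * ((real m + 1) * binomial_partial_sum (Suc m) l y - (real m + real l + 1) * binomial_partial_sum m l y) \<le> 0"
    by linarith
  then have "(real m + 1) * binomial_partial_sum (Suc m) l y \<le> (real m + real l + 1) * binomial_partial_sum m l y"
    using assms(1) unfolding mult_le_0_iff by force
  then show ?thesis by (simp add: field_simps)
qed

section \<open>Pseudo-splines\<close>

definition pseudo_factor :: "nat \<Rightarrow> nat \<Rightarrow> laurent_poly"
  where "pseudo_factor m l = (\<Sum>k=0..l. of_nat ((m - 1 + k) choose k) * delta ^ k)"

lemma Re_circle_pseudo_factor:
  "Re (circle (pseudo_factor m l) \<xi>) = binomial_partial_sum m l ((sin (\<xi> / 2))\<^sup>2)"
proof -
  have "circle (pseudo_factor m l) \<xi> = of_real (binomial_partial_sum m l ((sin (\<xi> / 2))\<^sup>2))"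
    by (simp add: pseudo_factor_def binomial_partial_sum_def weight_def circle.eval_simps circle_delta atLeast0AtMost)
  then show ?thesis by simp
qed

lemma large_symbol_pseudo_factor:
  assumes "1 \<le> m"
  shows "large_symbol m (pseudo_factor m l)"
proof
  have "at_one delta = 0"
    by (simp add: delta_def at_one.eval_simps)
  then have "at_one (pseudo_factor m l) = (\<Sum>k=0..l. real ((m - 1 + k) choose k) * 0 ^ k)"
    by (simp add: pseudo_factor_def at_one.eval_sum at_one.eval_mult at_one.eval_power at_one.eval_of_nat)
  also have "\<dots> = (\<Sum>k=0..l. if k = 0 then 1 else 0)"
    by (intro sum.cong) auto
  finally show "at_one (pseudo_factor m l) = 1" by simp
  show "circle_nonneg (pseudo_factor m l)"
    unfolding pseudo_factor_def
    by (intro circle_nonneg_sum circle_nonneg_mult circle_nonneg_of_nat circle_nonneg_power circle_nonneg_delta)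
  show "1 \<le> Re (circle (pseudo_factor m l) \<xi>)" for \<xi>
    by (simp add: Re_circle_pseudo_factor one_le_binomial_partial_sum)
qed fact

lemma pseudo_spline_symbol_eq: "pseudo_spline_symbol m l = 2 * sigma ^ m * pseudo_factor m l"
  by (simp add: pseudo_spline_symbol_def pseudo_factor_def)

definition regularity_exponent :: "nat \<Rightarrow> nat \<Rightarrow> real"
  where "regularity_exponent m l = 2 * real m - 1 - min_growth (pseudo_factor m l)"

lemma regularity_exponent_compare:
  assumes "1 \<le> m" "1 \<le> m'" "0 < K"
    and "\<And>y. 0 \<le> y \<Longrightarrow> y \<le> 1 \<Longrightarrow> binomial_partial_sum m l y \<le> K * binomial_partial_sum m' l' y"
  shows "regularity_exponent m' l' + 2 * (real m - real m') - log 2 K \<le> regularity_exponent m l"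
proof -
  have "min_growth (pseudo_factor m l) \<le> min_growth (pseudo_factor m' l') + log 2 K"
    using assms
    by (intro min_growth_compare[of m _ m'] large_symbol_pseudo_factor)
       (auto simp: Re_circle_pseudo_factor power_le_one abs_square_le_1)
  then show ?thesis by (simp add: regularity_exponent_def)
qed

lemma regularity_exponent_antimono:
  assumes "1 \<le> m" "l \<le> l'"
  shows "regularity_exponent m l' \<le> regularity_exponent m l"
  using regularity_exponent_compare[of m m 1 l l'] binomial_partial_sum_mono_right[OF assms(2)] assms by simp

lemma regularity_exponent_Suc_right_ge:
  assumes "1 \<le> m"
  shows "regularity_exponent m l - log 2 ((real m + real (Suc l)) / real (Suc l)) \<le> regularity_exponent m (Suc l)"
  using regularity_exponent_compare[OF assms assms _ binomial_partial_sum_Suc_right_le[OF assms], of l] assms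
  by (simp add: divide_pos_pos)

text \<open>l' is left free to cover both a fixed l and the diagonal, where l' = l + 1.\<close>

lemma regularity_exponent_Suc_left_le:
  assumes "1 \<le> m" "l \<le> l'"
  shows "regularity_exponent (Suc m) l' \<le> regularity_exponent m l + 2"
proof -
  have "binomial_partial_sum m l y \<le> 1 * binomial_partial_sum (Suc m) l' y" if "0 \<le> y" for y
    using binomial_partial_sum_mono_right[OF assms(2) that, of m] binomial_partial_sum_mono_left[OF assms(1) that, of l'] by simp
  then show ?thesis
    using regularity_exponent_compare[of m "Suc m" 1 l l'] assms by simp
qed

lemma regularity_exponent_Suc_left_ge:
  assumes "1 \<le> m"
  shows "regularity_exponent m l + log 2 (4 * real m / (real m + real l)) \<le> regularity_exponent (Suc m) l"
proof -
  have m: "0 < real m" "0 < real m + real l" using assms by auto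
  have "binomial_partial_sum (Suc m) l y \<le> (real m + real l) / real m * binomial_partial_sum m l y" if "0 \<le> y" "y \<le> 1" for y
  proof -
    \<comment> \<open>Relaxes 1 + l / (m + 1) to 1 + l / m, the form required by the stated
      bound.\<close>
    have "(real m + real l + 1) / (real m + 1) \<le> (real m + real l) / real m"
      using m by (simp add: field_simps)
    then have "(real m + real l + 1) / (real m + 1) * binomial_partial_sum m l y \<le> (real m + real l) / real m * binomial_partial_sum m l y"
      using one_le_binomial_partial_sum[OF that(1), of m l] by (intro mult_right_mono) auto
    with binomial_partial_sum_Suc_left_le[OF assms that, of l] show ?thesis by linarith
  qed
  then have "regularity_exponent m l + 2 - log 2 ((real m + real l) / real m) \<le> regularity_exponent (Suc m) l"
    using regularity_exponent_compare[of "Suc m" m "(real m + real l) / real m" l l] assms m by simp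
  moreover have "log 2 (4 * real m / (real m + real l)) = 2 - log 2 ((real m + real l) / real m)"
  proof -
    have "4 * real m / (real m + real l) = 2 powr 2 / ((real m + real l) / real m)"
      by simp
    also have "log 2 \<dots> = log 2 (2 powr 2) - log 2 ((real m + real l) / real m)"
      using m by (intro log_divide_pos) auto
    finally show ?thesis by (simp only: log_powr_cancel)
  qed
  ultimately show ?thesis by simp
qed

text \<open>The diagonal step passes through (m + 1, m - 1). Raising l costs (2m + 1) / m and
  raising m costs 2m / (m + 1), here without the relaxation to (m + l) / m; the product K satisfies
  4 / K = (2m + 2) / (2m + 1).\<close>

lemma regularity_exponent_diagonal_ge:
  assumes "1 \<le> m"
  shows "regularity_exponent m (m - 1) + log 2 ((2 * real m + 2) / (2 * real m + 1)) \<le> regularity_exponent (m + 1) m"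
proof -
  define K where "K = (2 * real m + 1) / real m * (2 * real m / (real m + 1))"
  have m: "0 < real m" "Suc (m - 1) = m" "real (m - 1) = real m - 1" using assms by auto
  have K: "0 < K" using m by (simp add: K_def)
  have "binomial_partial_sum (Suc m) m y \<le> K * binomial_partial_sum m (m - 1) y" if "0 \<le> y" "y \<le> 1" for y
  proof -
    have "binomial_partial_sum (Suc m) m y \<le> (2 * real m + 1) / real m * binomial_partial_sum (Suc m) (m - 1) y"
    proof -
      have "real (Suc m) + real (Suc (m - 1)) = 2 * real m + 1" using m by simp
      then show ?thesis
        using binomial_partial_sum_Suc_right_le[of "Suc m" y "m - 1"] that m(2) by simp
    qed
    also have "\<dots> \<le> (2 * real m + 1) / real m * (2 * real m / (real m + 1) * binomial_partial_sum m (m - 1) y)"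
    proof -
      have "real m + real (m - 1) + 1 = 2 * real m" using m by simp
      then show ?thesis
        using binomial_partial_sum_Suc_left_le[OF assms that, of "m - 1"] m(1) by (intro mult_left_mono) auto
    qed
    finally show ?thesis by (simp only: K_def mult.assoc)
  qed
  then have "regularity_exponent m (m - 1) + 2 - log 2 K \<le> regularity_exponent (Suc m) m"
    using regularity_exponent_compare[of "Suc m" m K m "m - 1"] assms K by simp
  moreover have "log 2 ((2 * real m + 2) / (2 * real m + 1)) = 2 - log 2 K"
  proof -
    have "K = 2 * (2 * real m + 1) / (real m + 1)"
      using m(1) by (simp add: K_def)
    then have "(2 * real m + 2) / (2 * real m + 1) = 2 powr 2 / K"
      by (simp only:) (simp add: divide_simps, simp add: algebra_simps)
    also have "log 2 \<dots> = log 2 (2 powr 2) - log 2 K"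
      using K by (intro log_divide_pos) auto
    finally show ?thesis by (simp only: log_powr_cancel)
  qed
  ultimately show ?thesis by simp
qed

text \<open>Starts from b = 1, whose growth exponent 0 gives 2m - 1 = 1 for linear B-splines; each
  diagonal step adds a nonnegative logarithm. By antitonicity in l this makes every exponent
  positive, as \<open>has_holder_regularity_min_growth\<close> demands.\<close>

lemma one_le_regularity_exponent_diagonal: "1 \<le> regularity_exponent (Suc n) n"
proof (induction n)
  case 0
  interpret large_symbol 1 "pseudo_factor 1 0" by (rule large_symbol_pseudo_factor) simp
  have "pseudo_factor 1 0 = 1" by (simp add: pseudo_factor_def)
  then have "min_growth (pseudo_factor 1 0) \<le> 0"
    by (intro min_growth_le) (simp add: growth_exponent_one)
  then show ?case by (simp add: regularity_exponent_def)
next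
  case (Suc n)
  have "0 \<le> log 2 ((2 * real (Suc n) + 2) / (2 * real (Suc n) + 1))"
    by (subst zero_le_log_cancel_iff) auto
  moreover have "regularity_exponent (Suc n) n + log 2 ((2 * real (Suc n) + 2) / (2 * real (Suc n) + 1))
      \<le> regularity_exponent (Suc (Suc n)) (Suc n)"
    using regularity_exponent_diagonal_ge[of "Suc n"] by (simp only: diff_Suc_1 Suc_eq_plus1) simp
  ultimately show ?case using Suc by linarith
qed

lemma one_le_regularity_exponent:
  assumes "1 \<le> m" "l \<le> m - 1"
  shows "1 \<le> regularity_exponent m l"
  using regularity_exponent_antimono[OF assms] one_le_regularity_exponent_diagonal[of "m - 1"] assms by simp

lemma has_holder_regularity_pseudo_spline:
  assumes "1 \<le> m" "l \<le> m - 1"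
  shows "has_holder_regularity (pseudo_spline_symbol m l) (regularity_exponent m l)"
proof -
  interpret large_symbol m "pseudo_factor m l" by (rule large_symbol_pseudo_factor) fact
  show ?thesis
    unfolding pseudo_spline_symbol_eq regularity_exponent_def
    using one_le_regularity_exponent[OF assms] by (intro has_holder_regularity_min_growth) (simp add: regularity_exponent_def)
qed

lemma pseudo_spline_regularity_eq:
  assumes "1 \<le> m" "l \<le> m - 1"
  shows "pseudo_spline_regularity m l = regularity_exponent m l"
  unfolding pseudo_spline_regularity_def holder_regularity_def
  using has_holder_regularity_pseudo_spline[OF assms]
  by (rule the_equality) (metis has_holder_regularity_unique has_holder_regularity_pseudo_spline[OF assms])

lemma strict_mono_on_atLeastI:
  fixes f :: "nat \<Rightarrow> real"
  assumes "\<And>i. k \<le> i \<Longrightarrow> f i < f (Suc i)"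
  shows "strict_mono_on {k..} f"
proof (rule strict_mono_onI)
  fix i j assume "i \<in> {k..}" "i < j"
  from \<open>i < j\<close> have "k \<le> i \<longrightarrow> f i < f j"
  proof (induction rule: less_Suc_induct)
    case (2 i j l)
    then show ?case by (metis less_imp_le order_trans less_trans)
  qed (use assms in blast)
  then show "f i < f j" using \<open>i \<in> {k..}\<close> by simp
qed

theorem theorem3:
  shows
    "(\<forall>m\<ge>1. \<forall>l\<le>m - 1.
        has_holder_regularity (pseudo_spline_symbol m l) (pseudo_spline_regularity m l)) \<and>

     (\<forall>m\<ge>1. antimono_on {0..m - 1} (\<lambda>l. pseudo_spline_regularity m l) \<and>
        (\<forall>l\<in>{1..m - 1}.
          pseudo_spline_regularity m (l - 1) - log 2 ((real m + real l) / real l)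
            \<le> pseudo_spline_regularity m l \<and>
          pseudo_spline_regularity m l \<le> pseudo_spline_regularity m (l - 1))) \<and>

     (\<forall>l. strict_mono_on {l + 1..} (\<lambda>m. pseudo_spline_regularity m l)) \<and>
     (\<forall>m\<ge>1. \<forall>l\<in>{0..m - 1}.
        pseudo_spline_regularity m l + log 2 (4 * real m / (real m + real l))
          \<le> pseudo_spline_regularity (m + 1) l \<and>
        pseudo_spline_regularity (m + 1) l \<le> pseudo_spline_regularity m l + 2) \<and>

     strict_mono_on {1..} dubuc_deslauriers_regularity \<and>
     (\<forall>m\<ge>1.
        dubuc_deslauriers_regularity m + log 2 ((2 * real m + 2) / (2 * real m + 1))
          \<le> dubuc_deslauriers_regularity (m + 1) \<and>
        dubuc_deslauriers_regularity (m + 1) \<le> dubuc_deslauriers_regularity m + 2)"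
proof (intro conjI)
  show "\<forall>m\<ge>1. \<forall>l\<le>m - 1.
      has_holder_regularity (pseudo_spline_symbol m l) (pseudo_spline_regularity m l)"
    by (simp add: pseudo_spline_regularity_eq has_holder_regularity_pseudo_spline)
  show "\<forall>m\<ge>1. antimono_on {0..m - 1} (\<lambda>l. pseudo_spline_regularity m l) \<and>
        (\<forall>l\<in>{1..m - 1}.
          pseudo_spline_regularity m (l - 1) - log 2 ((real m + real l) / real l)
            \<le> pseudo_spline_regularity m l \<and>
          pseudo_spline_regularity m l \<le> pseudo_spline_regularity m (l - 1))"
  proof (intro allI impI conjI ballI)
    fix m :: nat assume m: "1 \<le> m"
    show "antimono_on {0..m - 1} (\<lambda>l. pseudo_spline_regularity m l)"
      using m by (intro monotone_onI) (simp add: pseudo_spline_regularity_eq regularity_exponent_antimono)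
    fix l assume l: "l \<in> {1..m - 1}"
    then have "l - 1 \<le> m - 1" "l \<le> m - 1" "Suc (l - 1) = l" by auto
    then show "pseudo_spline_regularity m (l - 1) - log 2 ((real m + real l) / real l)
            \<le> pseudo_spline_regularity m l"
      "pseudo_spline_regularity m l \<le> pseudo_spline_regularity m (l - 1)"
      using regularity_exponent_Suc_right_ge[OF m, of "l - 1"] regularity_exponent_antimono[OF m, of "l - 1" l] m
      by (simp_all add: pseudo_spline_regularity_eq)
  qed
  have left_ge: "pseudo_spline_regularity m l + log 2 (4 * real m / (real m + real l))
          \<le> pseudo_spline_regularity (m + 1) l"
    and left_le: "pseudo_spline_regularity (m + 1) l \<le> pseudo_spline_regularity m l + 2"
    if "1 \<le> m" "l \<le> m - 1" for m l
    using regularity_exponent_Suc_left_ge[of m l] regularity_exponent_Suc_left_le[of m l l] that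
    by (simp_all add: pseudo_spline_regularity_eq)
  then show "\<forall>m\<ge>1. \<forall>l\<in>{0..m - 1}.
        pseudo_spline_regularity m l + log 2 (4 * real m / (real m + real l))
          \<le> pseudo_spline_regularity (m + 1) l \<and>
        pseudo_spline_regularity (m + 1) l \<le> pseudo_spline_regularity m l + 2"
    by simp
  show "\<forall>l. strict_mono_on {l + 1..} (\<lambda>m. pseudo_spline_regularity m l)"
  proof (intro allI strict_mono_on_atLeastI)
    fix l m :: nat assume "l + 1 \<le> m"
    \<comment> \<open>Strict because l < m makes 4m exceed m + l.\<close>
    then have "0 < log 2 (4 * real m / (real m + real l))"
      by (subst zero_less_log_cancel_iff) (auto simp: less_divide_eq)
    moreover have "1 \<le> m" "l \<le> m - 1" using \<open>l + 1 \<le> m\<close> by auto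
    ultimately show "pseudo_spline_regularity m l < pseudo_spline_regularity (Suc m) l"
      using left_ge[of m l] unfolding Suc_eq_plus1 by linarith
  qed
  have diag_ge: "dubuc_deslauriers_regularity m + log 2 ((2 * real m + 2) / (2 * real m + 1))
          \<le> dubuc_deslauriers_regularity (m + 1)"
    and diag_le: "dubuc_deslauriers_regularity (m + 1) \<le> dubuc_deslauriers_regularity m + 2"
    if "1 \<le> m" for m
    using regularity_exponent_diagonal_ge[of m] regularity_exponent_Suc_left_le[of m "m - 1" m] that
    by (simp_all add: dubuc_deslauriers_regularity_def pseudo_spline_regularity_eq)
  then show "\<forall>m\<ge>1.
        dubuc_deslauriers_regularity m + log 2 ((2 * real m + 2) / (2 * real m + 1))
          \<le> dubuc_deslauriers_regularity (m + 1) \<and>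
        dubuc_deslauriers_regularity (m + 1) \<le> dubuc_deslauriers_regularity m + 2"
    by simp
  show "strict_mono_on {1..} dubuc_deslauriers_regularity"
  proof (rule strict_mono_on_atLeastI)
    fix m :: nat assume "1 \<le> m"
    have "0 < log 2 ((2 * real m + 2) / (2 * real m + 1))"
      by (subst zero_less_log_cancel_iff) auto
    with diag_ge[OF \<open>1 \<le> m\<close>]
    show "dubuc_deslauriers_regularity m < dubuc_deslauriers_regularity (Suc m)"
      unfolding Suc_eq_plus1 by linarith
  qed
qed

end
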